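(* Let $D$ be the polarity design obtained from $PG(6,2)$ (defined in the context), a $2$-$(127,15,155)$ design. Let $C$ be the binary linear code of length $127$ spanned by the incidence vectors of the blocks of $D$, and let $C^{*}$ be its extended code of length $128$ (a binary $[128,64,16]$ code). Then the weight distribution of $C^{*}$ is identical with the weight distribution of the third-order binary Reed–Muller code $R(3,7)$. Explicitly, writing $A_i$ for the number of codewords of weight $i$ in $C^{*}$, we have $A_i=0$ unless $i\in\{0,16,24,28,32,\dots,104,112,128\}$ with $4\mid i$, $A_{128-i}=A_i$ for all $i$, and $A_0=1$, $A_{16}=94488$, $A_{20}=0$, $A_{24}=74078592$, $A_{28}=3128434688$, $A_{32}=312335197020$, $A_{36}=18125860315136$, $A_{40}=552366841342848$, $A_{44}=9491208609103872$, $A_{48}=94117043084875944$, $A_{52}=549823502398291968$, $A_{56}=1920604779257215744$, $A_{60}=4051966906789380096$, $A_{64}=5193595576952890822$.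
   Context: Polarity design from $PG(2s,q)$: let $\Pi=PG(2s,q)$ be the $2s$-dimensional projective geometry over $GF(q)$, let $H$ be a hyperplane of $\Pi$ (so $H\cong PG(2s-1,q)$), and let $\pi$ be a polarity of $H$ (an inclusion-reversing involutory bijection on the set of subspaces of $H$, sending projective $t$-subspaces of $H$ to $(2s-2-t)$-subspaces of $H$). The polarity design $D$ has as points the points of $\Pi$, and as blocks: (i) all $s$-dimensional projective subspaces of $\Pi$ contained in $H$, and (ii) for every $s$-dimensional projective subspace $S$ of $\Pi$ not contained in $H$, the set $(S\setminus H)\cup \pi(S\cap H)$ (here $S\cap H$ is an $(s-1)$-subspace of $H$, and so is $\pi(S\cap H)$). Here $s=3$, $q=2$, giving a $2$-$(127,15,155)$ design. The extended code $C^{*}$ of a binary code $C$ of length $n$ is obtained by appending to each codeword an overall parity-check coordinate, giving a code of length $n+1$ in which all weights are even. $R(3,7)$ denotes the binary Reed–Muller code of length $2^7=128$ and order $3$. *)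

theory Defs
  imports "HOL-Analysis.Analysis" "HOL-Library.Z2"
begin

section \<open>Projective geometry over a field\<close>

text \<open>The type \<open>('a, 'n) pg_point\<close> is the point set of the projective space of (projective)
  dimension \<open>CARD('n) - 1\<close> over the field \<open>'a\<close>.\<close>

typedef (overloaded) ('a::field, 'n::finite) pg_point =
  "{P :: ('a ^ 'n) set. vec.subspace P \<and> vec.dim P = 1}"
proof -
  let ?e = "axis undefined 1 :: 'a ^ 'n"
  have "vec.independent {?e}"
    by (simp add: vec.dependent_single axis_eq_0_iff)
  then have "vec.dim (vec.span {?e}) = 1"
    by (simp add: vec.dim_span_eq_card_independent)
  then show ?thesis
    using vec.subspace_span by blast
qed

instance pg_point :: ("{field, finite}", finite) finite
proof
  have "inj (Rep_pg_point :: ('a, 'b) pg_point \<Rightarrow> _)"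
    by (simp add: inj_def Rep_pg_point_inject)
  then show "finite (UNIV :: ('a, 'b) pg_point set)"
    by (rule finite_imageD[rotated]) simp
qed

text \<open>Projective subspaces are sets of points. Their projective dimension is an integer, so that
  the empty subspace, of dimension \<open>-1\<close>, is included.\<close>

definition pg_subspace :: "int \<Rightarrow> ('a::field, 'n::finite) pg_point set \<Rightarrow> bool" where
  "pg_subspace t S \<longleftrightarrow>
     (\<exists>U. vec.subspace U \<and> int (vec.dim U) = t + 1 \<and> S = {p. Rep_pg_point p \<subseteq> U})"

definition pg_subspaces_of ::
    "('a::field, 'n::finite) pg_point set \<Rightarrow> ('a, 'n) pg_point set set" where
  "pg_subspaces_of H = {S. S \<subseteq> H \<and> (\<exists>t. pg_subspace t S)}"

text \<open>Here \<open>d\<close> is the projective dimension of \<open>H\<close>; the values of \<open>\<pi>\<close> outside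
  \<open>pg_subspaces_of H\<close> are irrelevant.\<close>

definition polarity ::
    "int \<Rightarrow> ('a::field, 'n::finite) pg_point set
      \<Rightarrow> (('a, 'n) pg_point set \<Rightarrow> ('a, 'n) pg_point set) \<Rightarrow> bool" where
  "polarity d H \<pi> \<longleftrightarrow>
     bij_betw \<pi> (pg_subspaces_of H) (pg_subspaces_of H) \<and>
     (\<forall>S \<in> pg_subspaces_of H. \<pi> (\<pi> S) = S) \<and>
     (\<forall>S \<in> pg_subspaces_of H. \<forall>T \<in> pg_subspaces_of H. S \<subseteq> T \<longrightarrow> \<pi> T \<subseteq> \<pi> S) \<and>
     (\<forall>t. \<forall>S \<in> pg_subspaces_of H. pg_subspace t S \<longrightarrow> pg_subspace (d - 1 - t) (\<pi> S))"

definition polarity_design ::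
    "int \<Rightarrow> ('a::field, 'n::finite) pg_point set
      \<Rightarrow> (('a, 'n) pg_point set \<Rightarrow> ('a, 'n) pg_point set) \<Rightarrow> ('a, 'n) pg_point set set" where
  "polarity_design s H \<pi> =
     {S. pg_subspace s S \<and> S \<subseteq> H} \<union>
     {(S - H) \<union> \<pi> (S \<inter> H) | S. pg_subspace s S \<and> \<not> S \<subseteq> H}"


section \<open>Block designs\<close>

text \<open>A \<open>t\<close>-\<open>(v, k, \<lambda>)\<close> design without repeated blocks whose point set is a whole type.\<close>

definition block_design ::
    "nat \<Rightarrow> nat \<Rightarrow> nat \<Rightarrow> nat \<Rightarrow> 'p::finite set set \<Rightarrow> bool" where
  "block_design t v k l \<B> \<longleftrightarrow>
     CARD('p) = v \<and> (\<forall>B \<in> \<B>. card B = k) \<and>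
     (\<forall>T. card T = t \<longrightarrow> card {B \<in> \<B>. T \<subseteq> B} = l)"


section \<open>Binary codes\<close>

instance bit :: finite
proof
  have "(UNIV :: bit set) \<subseteq> {0, 1}"
    using bit_not_one_iff by blast
  then show "finite (UNIV :: bit set)"
    by (rule finite_subset) simp
qed

text \<open>Codes of length \<open>n\<close> are subsets of \<open>bit ^ 'p\<close> with \<open>CARD('p) = n\<close>; the coordinates are
  indexed by an arbitrary finite type instead of \<open>{1..n}\<close>.\<close>

definition weight :: "bit ^ 'p::finite \<Rightarrow> nat" where
  "weight x = card {i. x $ i \<noteq> 0}"

definition hamming_dist :: "bit ^ 'p::finite \<Rightarrow> bit ^ 'p \<Rightarrow> nat" where
  "hamming_dist x y = card {i. x $ i \<noteq> y $ i}"

definition num_weight :: "(bit ^ 'p::finite) set \<Rightarrow> nat \<Rightarrow> nat" where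
  "num_weight C i = card {x \<in> C. weight x = i}"

definition linear_code :: "nat \<Rightarrow> nat \<Rightarrow> nat \<Rightarrow> (bit ^ 'p::finite) set \<Rightarrow> bool" where
  "linear_code n k d C \<longleftrightarrow>
     CARD('p) = n \<and> vec.subspace C \<and> vec.dim C = k \<and>
     {hamming_dist x y | x y. x \<in> C \<and> y \<in> C \<and> x \<noteq> y} \<noteq> {} \<and>
     Min {hamming_dist x y | x y. x \<in> C \<and> y \<in> C \<and> x \<noteq> y} = d"

definition incidence_vector :: "'p::finite set \<Rightarrow> bit ^ 'p" where
  "incidence_vector B = (\<chi> p. if p \<in> B then 1 else 0)"

definition design_code :: "'p::finite set set \<Rightarrow> (bit ^ 'p) set" where
  "design_code \<B> = vec.span (incidence_vector ` \<B>)"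

text \<open>The parity-check coordinate is the one with index \<open>None\<close>.\<close>

definition extend_word :: "bit ^ 'p::finite \<Rightarrow> bit ^ 'p option" where
  "extend_word x = (\<chi> i. case i of None \<Rightarrow> (\<Sum>p\<in>UNIV. x $ p) | Some p \<Rightarrow> x $ p)"

definition extended_code :: "(bit ^ 'p::finite) set \<Rightarrow> (bit ^ 'p option) set" where
  "extended_code C = extend_word ` C"

text \<open>The code \<open>R(r, m)\<close>, \<open>m = CARD('m)\<close>: value vectors, indexed by the points of \<open>bit ^ 'm\<close>,
  of the polynomials of degree at most \<open>r\<close> in \<open>m\<close> variables. Square-free monomials, which
  correspond to subsets \<open>I\<close> of the variables, suffice since \<open>x\<^sup>2 = x\<close> on \<open>bit\<close>.\<close>

definition reed_muller :: "nat \<Rightarrow> (bit ^ (bit ^ 'm::finite)) set" where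
  "reed_muller r = vec.span {(\<chi> x. \<Prod>i\<in>I. x $ i) | I. card I \<le> r}"

end

theory Submission
  imports Defs
begin

text \<open>
  Both codes are self-dual and doubly even of length 128. By the MacWilliams identity the weight
  enumerator of such a code is invariant under the octahedral group generated by
  \<open>z \<mapsto> (1 - z)/(1 + z)\<close> and \<open>z \<mapsto> \<i> z\<close>. If two such enumerators agree up to \<open>z^20\<close>, their difference
  vanishes to order 24 at all six points of the orbit of 0, which is impossible for a nonzero form of
  degree 128. So everything is determined by \<open>A 4 = A 8 = A 12 = A 20 = 0\<close> and \<open>A 16 = 94488\<close>.

  To find the small weights, identify the points with the nonzero vectors of \<open>V = bit ^ 7\<close> and the
  parity coordinate with 0. Then \<open>R(3,7)\<close> consists of the sets meeting every flat of codimension 3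
  evenly. The code of the design has the generators \<open>W\<close> (a 4-dimensional subspace of the hyperplane
  \<open>U\<close>) and \<open>(z + Y) \<union> \<pi> Y\<close> (\<open>Y\<close> a 3-dimensional subspace of \<open>U\<close>, \<open>z \<notin> U\<close>). The part of a codeword in
  each of the two cosets of \<open>U\<close> meets the flats of codimension 2 evenly. Such sets have at least 8
  elements; Parseval's identity shows that they are flats when they have 8 elements and that they
  never have 10.
\<close>

text \<open>Two points need a reason: why the code of the design is self-dual, and why its words of
  weight 16 are as many as those of \<open>R(3,7)\<close>. The map \<open>\<rho>\<close> that
  \<open>\<pi>\<close> induces on planes is an involution preserving the sizes of intersections of
  planes. Two blocks then meet evenly for a parity reason: if \<open>Y \<inter> Y' = {0}\<close>,
  the sums of vectors of \<open>Y\<close> and \<open>Y'\<close> fill \<open>U\<close>, so the cosets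
  outside \<open>U\<close> meet in exactly one point, which makes up for the single common vector 0
  of \<open>\<rho> Y\<close> and \<open>\<rho> Y'\<close>. The identity map has these properties as
  well; for it the blocks are all 4-dimensional subspaces and their span is \<open>R(3,7)\<close>.
  Accordingly the count of words of weight 16 does not depend on \<open>\<rho>\<close>: there are
  \<open>2 * 651 * 4\<close> cosets of solids, each in one half, and \<open>1395 * 64\<close> unions
  of a coset of \<open>Y\<close> and a coset of \<open>\<rho> Y\<close>, in total
  \<open>94488 = 11811 * 8\<close>, the number of 4-dimensional flats. The obstacle is that a word
  of the design code crossing both halves need not be a flat, so small words have to be classified
  half by half.\<close>

declare add_bit_eq_xor [simp del] mult_bit_eq_and [simp del]

subsection \<open>Binary vector spaces\<close>

lemma bit_add_self [simp]: "a + a = (0 :: bit)"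
  by (cases a) simp_all

lemma bit_add_eq_0_iff [simp]: "a + b = 0 \<longleftrightarrow> a = (b :: bit)"
  by (cases a; cases b) simp_all

lemma vec_bit_add_self [simp]: "x + x = (0 :: bit ^ 'n::finite)"
  by (simp add: vec_eq_iff)

lemma vec_bit_add_left_cancel [simp]: "x + (x + y) = (y :: bit ^ 'n::finite)"
  by (simp add: add.assoc[symmetric])

lemma vec_bit_minus [simp]: "x - y = x + (y :: bit ^ 'n::finite)"
  by (simp add: vec_eq_iff)

lemma vec_bit_add_eq_0_iff: "x + y = 0 \<longleftrightarrow> x = (y :: bit ^ 'n::finite)"
  by (simp add: vec_eq_iff)

lemma CARD_bit [simp]: "CARD(bit) = 2"
proof -
  have "(UNIV :: bit set) = {0, 1}"
    using bit_not_one_iff by blast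
  then have "CARD(bit) = card {0, 1 :: bit}"
    by (simp only:)
  then show ?thesis
    by simp
qed

lemma ex_bit_iff: "(\<exists>k::bit. P k) \<longleftrightarrow> P 0 \<or> P 1"
  by (metis bit.exhaust)

lemma subspace_bit_iff:
  "vec.subspace (W :: (bit ^ 'n::finite) set) \<longleftrightarrow> 0 \<in> W \<and> (\<forall>x\<in>W. \<forall>y\<in>W. x + y \<in> W)"
proof -
  have "c *s x = (if c = 0 then 0 else x)" for c and x :: "bit ^ 'n"
    by (cases c) simp_all
  then show ?thesis
    unfolding vec.subspace_def by auto
qed

text \<open>Adding a vector \<open>a\<close> outside the span of \<open>B\<close> doubles the span:
  it becomes the disjoint union of \<open>vec.span B\<close> and its translate by
  \<open>a\<close>.\<close>

lemma card_subspace: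
  fixes W :: "(bit ^ 'n::finite) set"
  assumes "vec.subspace W"
  shows "card W = 2 ^ vec.dim W"
proof -
  have *: "card (vec.span B) = 2 ^ card B" if "finite B" "vec.independent B"
    for B :: "(bit ^ 'n) set"
    using that
  proof (induction B rule: finite_induct)
    case (insert a B)
    let ?S = "vec.span B"
    have a: "a \<notin> ?S" "vec.independent B"
      using insert.prems insert.hyps by (auto simp: vec.independent_insert)
    have "vec.span (insert a B) = ?S \<union> (+) a ` ?S"
    proof -
      have "x \<in> vec.span (insert a B) \<longleftrightarrow> x \<in> ?S \<or> a + x \<in> ?S" for x
      proof -
        show ?thesis
          by (auto simp: vec.span_insert ex_bit_iff add.commute)
      qed
      moreover have "x \<in> (+) a ` ?S \<longleftrightarrow> a + x \<in> ?S" for x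
        by (auto intro: image_eqI[of _ _ "a + x"])
      ultimately show ?thesis
        by blast
    qed
    moreover have "?S \<inter> (+) a ` ?S = {}"
    proof -
      have "a \<in> ?S" if "y \<in> ?S" "a + y \<in> ?S" for y
        using vec.span_diff[OF that(2) that(1)] by (simp add: add.assoc)
      then show ?thesis
        using a by blast
    qed
    ultimately have "card (vec.span (insert a B)) = card ?S + card ((+) a ` ?S)"
      by (simp add: card_Un_disjoint)
    then show ?case
      using insert a by (simp add: card_image)
  qed simp
  obtain B where "B \<subseteq> W" "vec.independent B" "W \<subseteq> vec.span B" "card B = vec.dim W"
    using vec.basis_exists by blast
  moreover from this have "vec.span B = W"
    using assms vec.span_minimal by blast
  ultimately show ?thesis
    using *[of B] by simp
qed

lemma card_subspace_pos: "vec.subspace W \<Longrightarrow> 0 < card (W :: (bit ^ 'n::finite) set)"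
  by (simp add: card_subspace)

definition coset :: "bit ^ 'n::finite \<Rightarrow> (bit ^ 'n) set \<Rightarrow> (bit ^ 'n) set" where
  "coset x W = (+) x ` W"

text \<open>Translation by \<open>x\<close> is an involution in characteristic 2, so membership
  needs no existential witness. This turns most identities between cosets into statements about
  sums.\<close>

lemma mem_coset [simp]: "y \<in> coset x W \<longleftrightarrow> x + y \<in> W"
  unfolding coset_def by (auto intro: image_eqI[of _ _ "x + y"])

lemma card_coset [simp]: "card (coset x W) = card W"
  by (simp add: coset_def card_image)

lemma coset_0 [simp]: "coset 0 W = W"
  by auto

lemma coset_eq_iff:
  assumes "vec.subspace W"
  shows "coset x W = coset y W \<longleftrightarrow> x + y \<in> W"
proof
  assume "coset x W = coset y W"
  then have "y \<in> coset x W"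
    using assms by (simp add: subspace_bit_iff)
  then show "x + y \<in> W"
    by simp
next
  assume *: "x + y \<in> W"
  have "x + z \<in> W \<longleftrightarrow> y + z \<in> W" for z
  proof -
    have "y + z = (x + y) + (x + z)" "x + z = (x + y) + (y + z)"
      by (simp_all add: ac_simps)
    then show ?thesis
      using * assms unfolding subspace_bit_iff by metis
  qed
  then show "coset x W = coset y W"
    by auto
qed

lemma coset_self [simp]: "vec.subspace W \<Longrightarrow> x \<in> coset x W"
  by (simp add: subspace_bit_iff)

lemma coset_disjoint:
  assumes "vec.subspace W" "x + y \<notin> W"
  shows "coset x W \<inter> coset y W = {}"
proof -
  have "x + y \<in> W" if "x + z \<in> W" "y + z \<in> W" for z
  proof -
    have "x + y = (x + z) + (y + z)"
      by (simp add: ac_simps)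
    then show ?thesis
      using that assms unfolding subspace_bit_iff by metis
  qed
  then show ?thesis
    using assms by auto
qed

section \<open>Characters, orthogonal complements and hyperplane sections\<close>

definition bdot :: "bit ^ 'n::finite \<Rightarrow> bit ^ 'n \<Rightarrow> bit" where
  "bdot x y = (\<Sum>i\<in>UNIV. x $ i * y $ i)"

lemma bdot_commute: "bdot x y = bdot y x"
  by (simp add: bdot_def mult.commute)

lemma bdot_add_right: "bdot x (y + z) = bdot x y + bdot x z"
  by (simp add: bdot_def distrib_left sum.distrib)

lemma bdot_add_left: "bdot (x + y) z = bdot x z + bdot y z"
  by (simp add: bdot_def distrib_right sum.distrib)

lemma bdot_0_left [simp]: "bdot 0 x = 0" and bdot_0_right [simp]: "bdot x 0 = 0"
  by (simp_all add: bdot_def)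

lemma bdot_axis: "bdot (axis i 1) x = x $ i"
proof -
  have "bdot (axis i 1) x = (\<Sum>j\<in>UNIV. if j = i then x $ j else 0)"
    unfolding bdot_def by (rule sum.cong) (auto simp: axis_def)
  then show ?thesis
    by simp
qed

lemma bdot_nondegenerate: "(\<forall>a. bdot a x = 0) \<longleftrightarrow> x = 0"
  by (metis bdot_0_right bdot_axis vec_eq_iff zero_index)

lemma subspace_kernel: "vec.subspace W \<Longrightarrow> vec.subspace {w \<in> W. bdot a w = 0}"
  by (auto simp: subspace_bit_iff bdot_add_right)

text \<open>The nontrivial additive character of the field with two elements, real-valued so that
  Fourier sums can be formed.\<close>

definition sg :: "bit \<Rightarrow> real" where
  "sg b = (if b = 0 then 1 else -1)"

lemma sg_0 [simp]: "sg 0 = 1" and sg_1 [simp]: "sg 1 = -1"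
  by (simp_all add: sg_def)

lemma sg_add: "sg (a + b) = sg a * sg b"
  by (cases a; cases b) simp_all

text \<open>Orthogonality of characters: if \<open>bdot a v = 1\<close> for some \<open>v\<close> in
  \<open>W\<close>, translation by \<open>v\<close> permutes \<open>W\<close> and changes the sign
  of the sum.\<close>

lemma sum_sg_subspace:
  assumes "vec.subspace W"
  shows "(\<Sum>x\<in>W. sg (bdot a x)) = (if \<forall>x\<in>W. bdot a x = 0 then real (card W) else 0)"
proof (cases "\<forall>x\<in>W. bdot a x = 0")
  case False
  then obtain v where v: "v \<in> W" "bdot a v = 1"
    by auto
  have "(\<Sum>x\<in>W. sg (bdot a x)) = (\<Sum>x\<in>W. sg (bdot a (v + x)))"
    by (rule sum.reindex_bij_witness[of _ "(+) v" "(+) v"])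
      (use assms v in \<open>auto simp: subspace_bit_iff\<close>)
  also have "\<dots> = - (\<Sum>x\<in>W. sg (bdot a x))"
    by (simp add: bdot_add_right sg_add v sum_negf)
  finally show ?thesis
    using False by auto
qed simp

definition dual :: "(bit ^ 'n::finite) set \<Rightarrow> (bit ^ 'n) set" where
  "dual W = {x. \<forall>y\<in>W. bdot x y = 0}"

lemma subspace_dual: "vec.subspace (dual W)"
  by (auto simp: dual_def subspace_bit_iff bdot_add_left)

text \<open>Both sides evaluate the double sum of \<open>sg (bdot a x)\<close> over all
  \<open>a\<close> and all \<open>x \<in> W\<close>: summing over \<open>x\<close> first leaves the
  \<open>a\<close> in \<open>dual W\<close>, summing over \<open>a\<close> first leaves only
  \<open>x = 0\<close>.\<close>

lemma card_dual:
  fixes W :: "(bit ^ 'n::finite) set"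
  assumes "vec.subspace W"
  shows "card W * card (dual W) = 2 ^ CARD('n)"
proof -
  have "real (card W * card (dual W)) = (\<Sum>a\<in>UNIV. if a \<in> dual W then real (card W) else 0)"
    by (simp add: sum.If_cases)
  also have "\<dots> = (\<Sum>a\<in>UNIV. \<Sum>x\<in>W. sg (bdot a x))"
    using sum_sg_subspace[OF assms] by (intro sum.cong) (auto simp: dual_def)
  also have "\<dots> = (\<Sum>x\<in>W. \<Sum>a\<in>UNIV. sg (bdot x a))"
    by (subst sum.swap) (simp add: bdot_commute)
  also have "\<dots> = (\<Sum>x\<in>W. if x = 0 then real CARD(bit ^ 'n) else 0)"
  proof (rule sum.cong)
    fix x :: "bit ^ 'n"
    have "(\<forall>a. bdot x a = 0) \<longleftrightarrow> x = 0"
      using bdot_nondegenerate[of x] by (simp add: bdot_commute)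
    then show "(\<Sum>a\<in>UNIV. sg (bdot x a)) = (if x = 0 then real CARD(bit ^ 'n) else 0)"
      using sum_sg_subspace[of UNIV x] by simp
  qed simp
  also have "\<dots> = real (2 ^ CARD('n))"
    using assms by (simp add: subspace_bit_iff)
  finally show ?thesis
    by (simp only: of_nat_eq_iff)
qed

lemma dual_dual:
  fixes W :: "(bit ^ 'n::finite) set"
  assumes "vec.subspace W"
  shows "dual (dual W) = W"
proof (rule sym, rule card_subset_eq)
  show "W \<subseteq> dual (dual W)"
    by (auto simp: dual_def bdot_commute)
  have "card W * card (dual W) = card (dual W) * card (dual (dual W))"
    using card_dual[OF assms] card_dual[OF subspace_dual[of W]] by simp
  then show "card W = card (dual (dual W))"
    using card_subspace_pos[OF subspace_dual[of W]] by (auto simp: mult.commute)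
qed simp

lemma card_kernel:
  assumes W: "vec.subspace W" and v: "v \<in> W" "bdot a v = 1"
  shows "card W = 2 * card {w \<in> W. bdot a w = 0}"
proof -
  let ?K = "{w \<in> W. bdot a w = 0}"
  have "W = ?K \<union> coset v ?K"
  proof (intro set_eqI)
    fix x
    have "v + x \<in> W \<longleftrightarrow> x \<in> W"
      using W v unfolding subspace_bit_iff by (metis vec_bit_add_left_cancel)
    then show "x \<in> W \<longleftrightarrow> x \<in> ?K \<union> coset v ?K"
      using v by (cases "bdot a x") (auto simp: bdot_add_right)
  qed
  moreover have "?K \<inter> coset v ?K = {}"
    using v by (auto simp: bdot_add_right)
  ultimately have "card W = card ?K + card (coset v ?K)"
    by (metis (no_types, lifting) card_Un_disjoint finite)
  then show ?thesis
    by simp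
qed

text \<open>The empty case stands apart because it is not a coset; otherwise a base point in the
  section makes it a coset of a kernel. That the size drops at most by half drives the inductions
  over codimension.\<close>

lemma coset_Int_hyperplane:
  assumes W: "vec.subspace W"
  shows "coset x W \<inter> {y. bdot a y = c} = {} \<or>
    (\<exists>x' W'. vec.subspace W' \<and> W' \<subseteq> W \<and> coset x W \<inter> {y. bdot a y = c} = coset x' W' \<and>
      (card W' = card W \<or> card W = 2 * card W'))"
proof (cases "coset x W \<inter> {y. bdot a y = c} = {}")
  case False
  then obtain z where "z \<in> coset x W \<inter> {y. bdot a y = c}"
    by blast
  then have z: "x + z \<in> W" "bdot a z = c"
    by auto
  let ?K = "{w \<in> W. bdot a w = 0}"
  have "coset x W = coset z W"
    using W z coset_eq_iff by blast
  then have "coset x W \<inter> {y. bdot a y = c} = coset z W \<inter> {y. bdot a y = c}"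
    by (simp only:)
  also have "\<dots> = coset z ?K"
    using z(2) by (auto simp: bdot_add_right)
  finally have "coset x W \<inter> {y. bdot a y = c} = coset z ?K" .
  moreover have "card ?K = card W \<or> card W = 2 * card ?K"
  proof (cases "\<forall>w\<in>W. bdot a w = 0")
    case True
    then have "?K = W"
      by auto
    then show ?thesis
      by simp
  qed (use card_kernel[OF W] in auto)
  ultimately show ?thesis
    using subspace_kernel[OF W] by (metis (no_types, lifting) mem_Collect_eq subsetI)
qed simp

subsection \<open>Sets meeting all flats of bounded codimension evenly\<close>

text \<open>Since \<open>a = 0\<close> is allowed, a step may leave the set unchanged, so all flats
  of codimension at most \<open>r\<close> are tested. In dimension \<open>m > r\<close> these sets
  are the words of the Reed--Muller code of order \<open>m - r - 1\<close>.\<close>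

primrec even_on_flats :: "nat \<Rightarrow> (bit ^ 'n::finite) set \<Rightarrow> bool" where
  "even_on_flats 0 S \<longleftrightarrow> even (card S)"
| "even_on_flats (Suc r) S \<longleftrightarrow> (\<forall>a c. even_on_flats r (S \<inter> {x. bdot a x = c}))"

lemma even_on_flats_Suc_imp: "even_on_flats (Suc r) S \<Longrightarrow> even_on_flats r S"
proof -
  assume "even_on_flats (Suc r) S"
  then have "even_on_flats r (S \<inter> {x. bdot 0 x = 0})"
    by (simp only: even_on_flats.simps)
  then show ?thesis
    by simp
qed

lemma even_on_flats_mono: "even_on_flats s S \<Longrightarrow> r \<le> s \<Longrightarrow> even_on_flats r S"
  by (induction s) (auto simp: le_Suc_eq simp del: even_on_flats.simps dest: even_on_flats_Suc_imp)

lemma card_sym_diff: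
  assumes "finite A" "finite B"
  shows "card (sym_diff A B) + 2 * card (A \<inter> B) = card A + card B"
proof -
  have "card A = card (A - B) + card (A \<inter> B)" "card B = card (B - A) + card (A \<inter> B)"
    using assms card_Diff_subset_Int[of A B] card_Diff_subset_Int[of B A]
    by (metis Int_commute add.commute card_Int_Diff)+
  moreover have "card (sym_diff A B) = card (A - B) + card (B - A)"
    using assms by (intro card_Un_disjoint) auto
  ultimately show ?thesis
    by simp
qed

lemma even_card_sym_diff:
  "even (card (sym_diff A B)) \<longleftrightarrow> (even (card A) \<longleftrightarrow> even (card B))" if "finite A" "finite B"
  using arg_cong[OF card_sym_diff[OF that], of even] by simp

lemma even_on_flats_sym_diff:
  "even_on_flats r A \<Longrightarrow> even_on_flats r B \<Longrightarrow> even_on_flats r (sym_diff A B)"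
proof (induction r arbitrary: A B)
  case (Suc r)
  have "sym_diff A B \<inter> H = sym_diff (A \<inter> H) (B \<inter> H)" for H
    by auto
  then show ?case
    using Suc by simp
qed (simp add: even_card_sym_diff)

text \<open>As \<open>card S\<close> is even, \<open>S\<close> has two distinct points. Some
  functional separates them, so both halves of \<open>S\<close> are nonempty and the induction
  hypothesis applies to each.\<close>

lemma even_on_flats_min_card:
  "even_on_flats r S \<Longrightarrow> S \<noteq> {} \<Longrightarrow> 2 ^ Suc r \<le> card S"
proof (induction r arbitrary: S)
  case 0
  then have "card S \<noteq> 0" "even (card S)"
    by simp_all
  then show ?case
    by (metis One_nat_def even_iff_mod_2_eq_zero less_2_cases_iff linorder_not_less odd_one power_one_right)
next
  case (Suc r)
  have "even (card S)"
    using even_on_flats_mono[OF Suc.prems(1), of 0] by simp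
  then have "card S \<noteq> 1"
    by auto
  then obtain x y where xy: "x \<in> S" "y \<in> S" "x \<noteq> y"
    using Suc.prems(2) by (metis is_singletonI' is_singleton_altdef)
  then have "x + y \<noteq> 0"
    by (simp add: vec_bit_add_eq_0_iff)
  then obtain a where "bdot a (x + y) \<noteq> 0"
    using bdot_nondegenerate by blast
  then have a: "bdot a x \<noteq> bdot a y"
    by (auto simp: bdot_add_right)
  let ?H = "\<lambda>c. S \<inter> {z. bdot a z = c}"
  have ge: "2 ^ Suc r \<le> card (?H (bdot a u))" if "u \<in> S" for u
    using Suc.prems(1) that by (intro Suc.IH) auto
  have "card (?H (bdot a x)) + card (?H (bdot a y)) = card (?H (bdot a x) \<union> ?H (bdot a y))"
    using a by (intro card_Un_disjoint[symmetric]) auto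
  also have "\<dots> \<le> card S"
    by (intro card_mono) auto
  finally show ?case
    using ge[OF xy(1)] ge[OF xy(2)] by simp
qed

lemma even_on_flats_empty [simp]: "even_on_flats r {}"
  by (induction r) simp_all

text \<open>A nonempty hyperplane section of a coset is a coset of at least half the size, so after
  \<open>r\<close> sections the size is still divisible by 2.\<close>

lemma even_on_flats_coset:
  "vec.subspace W \<Longrightarrow> 2 ^ Suc r dvd card W \<Longrightarrow> even_on_flats r (coset x W)"
proof (induction r arbitrary: x W)
  case (Suc r)
  have "even_on_flats r (coset x W \<inter> {y. bdot a y = c})" for a c
  proof -
    consider "coset x W \<inter> {y. bdot a y = c} = {}"
      | x' W' where "vec.subspace W'" "coset x W \<inter> {y. bdot a y = c} = coset x' W'"
        "card W' = card W \<or> card W = 2 * card W'"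
      using coset_Int_hyperplane[OF Suc.prems(1)] by meson
    then show ?thesis
    proof cases
      case 2
      have "2 ^ Suc r dvd card W'"
        using Suc.prems(2) 2(3) by (auto elim: dvd_mult_left dvd_trans[rotated])
      then show ?thesis
        using Suc.IH 2 by simp
    qed simp
  qed
  then show ?case
    by simp
qed simp

lemma even_on_flats_Int:
  "finite L \<Longrightarrow> card L \<le> r \<Longrightarrow> even_on_flats r S \<Longrightarrow>
    even (card (S \<inter> {x. \<forall>j\<in>L. bdot (b j) x = c j}))"
proof (induction L arbitrary: S r rule: finite_induct)
  case empty
  then show ?case
    using even_on_flats_mono[of r S 0] by simp
next
  case (insert l L)
  then obtain r' where r': "r = Suc r'" "card L \<le> r'"
    by (cases r) auto
  have "S \<inter> {x. \<forall>j\<in>insert l L. bdot (b j) x = c j} =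
      (S \<inter> {x. bdot (b l) x = c l}) \<inter> {x. \<forall>j\<in>L. bdot (b j) x = c j}"
    by auto
  then show ?case
    using insert.IH[of r' "S \<inter> {x. bdot (b l) x = c l}"] insert.prems r' by simp
qed

text \<open>Parity on the cosets of size \<open>2 ^ k\<close> passes to larger ones, because a
  functional that does not vanish on \<open>W\<close> cuts each coset of \<open>W\<close> into two
  of half the size. The region \<open>G\<close> restricts the test to one half of the space.\<close>

lemma even_card_Int_coset:
  assumes base: "\<And>x W. vec.subspace W \<Longrightarrow> card W = 2 ^ k \<Longrightarrow> coset x W \<subseteq> G \<Longrightarrow>
      even (card (S \<inter> coset x W))"
    and "vec.subspace W" "card W = 2 ^ j" "k \<le> j" "coset x W \<subseteq> G"
  shows "even (card (S \<inter> coset x W))"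
  using assms(2-)
proof (induction j arbitrary: W x)
  case (Suc j)
  show ?case
  proof (cases "k = Suc j")
    case False
    have "card W \<noteq> 1"
      using Suc.prems by simp
    then have "W \<noteq> {0}"
      by auto
    then obtain v where v: "v \<in> W" "v \<noteq> 0"
      using Suc.prems(1) by (auto simp: subspace_bit_iff)
    then obtain a where a: "bdot a v = 1"
      using bdot_nondegenerate[of v] by auto
    let ?K = "{w \<in> W. bdot a w = 0}"
    have K: "vec.subspace ?K" "card ?K = 2 ^ j"
      using subspace_kernel card_kernel[of W v a] Suc.prems v a by auto
    have W: "u + w \<in> W \<longleftrightarrow> w \<in> W" if "u \<in> W" for u w
      using Suc.prems(1) that unfolding subspace_bit_iff by (metis vec_bit_add_left_cancel)
    have split: "coset x W = coset x ?K \<union> coset (v + x) ?K"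
      using v a by (auto simp: bdot_add_right add.assoc W)
    have "coset x ?K \<inter> coset (v + x) ?K = {}"
      using a by (auto simp: bdot_add_right)
    then have "card (S \<inter> coset x W) = card (S \<inter> coset x ?K) + card (S \<inter> coset (v + x) ?K)"
      unfolding split Int_Un_distrib by (intro card_Un_disjoint) auto
    moreover have "even (card (S \<inter> coset x ?K))" "even (card (S \<inter> coset (v + x) ?K))"
      using Suc.IH[OF K] Suc.prems False split by auto
    ultimately show ?thesis
      by simp
  qed (use Suc.prems base in simp)
qed (use base in simp)

text \<open>Turns orthogonality to the flats of one size into \<open>even_on_flats\<close>:
  \<open>r\<close> hyperplanes cut a coset of size \<open>2 ^ j\<close> down to nothing or to at
  least \<open>2 ^ (j - r)\<close> points, hence at least \<open>2 ^ k\<close>.\<close>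

lemma even_on_flats_Int_coset:
  assumes base: "\<And>x W. vec.subspace W \<Longrightarrow> card W = 2 ^ k \<Longrightarrow> coset x W \<subseteq> G \<Longrightarrow>
      even (card (S \<inter> coset x W))"
    and "vec.subspace W" "card W = 2 ^ j" "k + r \<le> j" "coset x W \<subseteq> G"
  shows "even_on_flats r (S \<inter> coset x W)"
  using assms(2-)
proof (induction r arbitrary: W x j)
  case 0
  then show ?case
    using even_card_Int_coset[of k G S W j x, OF base] by auto
next
  case (Suc r)
  have "even_on_flats r (S \<inter> coset x W \<inter> {y. bdot a y = c})" for a c
  proof -
    consider "coset x W \<inter> {y. bdot a y = c} = {}"
      | x' W' where "vec.subspace W'" "coset x W \<inter> {y. bdot a y = c} = coset x' W'"
        "card W' = card W \<or> card W = 2 * card W'"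
      using coset_Int_hyperplane[OF Suc.prems(1)] by meson
    then show ?thesis
    proof cases
      case 1
      then show ?thesis
        by (metis Int_assoc Int_empty_right even_on_flats_empty)
    next
      case 2
      obtain j' where j: "j = Suc j'"
        using Suc.prems(3) by (cases j) auto
      obtain i where "card W' = 2 ^ i" "k + r \<le> i"
      proof (cases "card W' = card W")
        case True
        then show ?thesis
          using that[of j] Suc.prems by simp
      next
        case False
        then show ?thesis
          using that[of j'] Suc.prems 2(3) j by simp
      qed
      moreover have "coset x' W' \<subseteq> G"
        using 2(2) Suc.prems(4) by auto
      ultimately have "even_on_flats r (S \<inter> coset x' W')"
        using Suc.IH[OF 2(1)] by blast
      then show ?thesis
        by (simp add: Int_assoc 2(2))
    qed
  qed
  then show ?case
    by simp
qed

lemma subspace_card_dvd: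
  assumes "vec.subspace (W :: (bit ^ 'n::finite) set)" "2 ^ k \<le> card W"
  shows "2 ^ k dvd card W"
  using assms by (simp add: card_subspace le_imp_power_dvd)

lemma coset_Int_hyperplanes:
  assumes "finite J" "vec.subspace W"
  shows "coset x W \<inter> {y. \<forall>j\<in>J. bdot (b j) y = c j} = {} \<or>
    (\<exists>x' W'. vec.subspace W' \<and> W' \<subseteq> W \<and>
      coset x W \<inter> {y. \<forall>j\<in>J. bdot (b j) y = c j} = coset x' W' \<and>
      card W \<le> card W' * 2 ^ card J)"
  using assms(1)
proof (induction J rule: finite_induct)
  case empty
  then show ?case
    using assms(2) by auto
next
  case (insert l J)
  let ?F = "coset x W \<inter> {y. \<forall>j\<in>J. bdot (b j) y = c j}"
  have eq: "coset x W \<inter> {y. \<forall>j\<in>insert l J. bdot (b j) y = c j} = ?F \<inter> {y. bdot (b l) y = c l}"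
    by auto
  show ?case
  proof (cases "?F = {}")
    case False
    then obtain x' W' where W': "vec.subspace W'" "W' \<subseteq> W" "?F = coset x' W'"
        "card W \<le> card W' * 2 ^ card J"
      using insert.IH by auto
    consider "coset x' W' \<inter> {y. bdot (b l) y = c l} = {}"
      | x'' W'' where "vec.subspace W''" "W'' \<subseteq> W'"
        "coset x' W' \<inter> {y. bdot (b l) y = c l} = coset x'' W''"
        "card W'' = card W' \<or> card W' = 2 * card W''"
      using coset_Int_hyperplane[OF W'(1)] by meson
    then show ?thesis
    proof cases
      case 1
      then show ?thesis
        unfolding eq W'(3) by (rule disjI1)
    next
      case 2
      have "card W' \<le> 2 * card W''"
        using 2(4) by auto
      then have "card W' * 2 ^ card J \<le> card W'' * 2 ^ card (insert l J)"
        using insert.hyps by simp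
      then show ?thesis
        unfolding eq W'(3) using 2 W' by (meson order_trans)
    qed
  next
    case True
    then show ?thesis
      unfolding eq by auto
  qed
qed

section \<open>Codewords as sets, and the algebraic normal form\<close>

lemma bit_add_eq_1_iff: "a + b = 1 \<longleftrightarrow> a \<noteq> (b :: bit)"
  by (cases a; cases b) simp_all

definition supp :: "bit ^ 'i::finite \<Rightarrow> 'i set" where
  "supp x = {i. x $ i \<noteq> 0}"

lemma weight_eq: "weight x = card (supp x)"
  by (simp add: weight_def supp_def)

lemma supp_0 [simp]: "supp 0 = {}"
  by (simp add: supp_def)

lemma supp_add: "supp (x + y) = sym_diff (supp x) (supp y)"
proof -
  have "a + b = 1 \<longleftrightarrow> (a = 1 \<and> b \<noteq> 1) \<or> (b = 1 \<and> a \<noteq> 1)" for a b :: bit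
    by (cases a; cases b) simp_all
  then show ?thesis
    by (auto simp: supp_def)
qed

lemma supp_incidence_vector [simp]: "supp (incidence_vector S) = S"
  by (auto simp: supp_def incidence_vector_def)

lemma incidence_vector_supp [simp]: "incidence_vector (supp x) = x"
  by (auto simp: supp_def incidence_vector_def vec_eq_iff)

lemma incidence_vector_sym_diff:
  "incidence_vector (sym_diff S T) = incidence_vector S + incidence_vector T"
  by (metis incidence_vector_supp supp_add supp_incidence_vector)

lemma incidence_vector_empty [simp]: "incidence_vector {} = 0"
  by (metis incidence_vector_supp supp_0)

lemma incidence_vector_disjoint_Un:
  "S \<inter> T = {} \<Longrightarrow> incidence_vector (S \<union> T) = incidence_vector S + incidence_vector T"
  using incidence_vector_sym_diff[of S T] by (simp add: Diff_triv Int_commute)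

lemma weight_incidence_vector [simp]: "weight (incidence_vector S) = card S"
  by (simp add: weight_eq)

lemma of_nat_bit_eq_0_iff [simp]: "of_nat n = (0 :: bit) \<longleftrightarrow> even n"
  by (induction n) (auto simp: add.commute)

lemma bdot_eq_card: "bdot x y = of_nat (card (supp x \<inter> supp y))"
proof -
  have "x $ i * y $ i = (if i \<in> supp x \<inter> supp y then 1 else 0)" for i
    by (auto simp: supp_def)
  then show ?thesis
    by (simp add: bdot_def sum.If_cases Int_def)
qed

lemma bdot_eq_0_iff: "bdot x y = 0 \<longleftrightarrow> even (card (supp x \<inter> supp y))"
  by (simp add: bdot_eq_card)

lemma card_between:
  assumes "finite X" "Y \<subseteq> X"
  shows "card {J. Y \<subseteq> J \<and> J \<subseteq> X} = 2 ^ card (X - Y)"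
proof -
  have "bij_betw (\<lambda>J. Y \<union> J) (Pow (X - Y)) {J. Y \<subseteq> J \<and> J \<subseteq> X}"
    by (rule bij_betw_byWitness[of _ "\<lambda>J. J - Y"]) (use assms in auto)
  then show ?thesis
    using assms(1) by (simp add: bij_betw_same_card[symmetric] card_Pow)
qed

text \<open>This is Moebius inversion modulo 2: a nonempty interval of the subset lattice has a
  power of 2 as its size, which is odd only for a single point.\<close>

lemma odd_card_between:
  assumes "finite X"
  shows "odd (card {J. Y \<subseteq> J \<and> J \<subseteq> X}) \<longleftrightarrow> Y = X"
proof (cases "Y \<subseteq> X")
  case True
  then show ?thesis
    using assms by (auto simp: card_between)
next
  case False
  then have "{J. Y \<subseteq> J \<and> J \<subseteq> X} = {}"
    by auto
  then have "card {J. Y \<subseteq> J \<and> J \<subseteq> X} = 0"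
    by (simp only: card.empty)
  then show ?thesis
    using False by (metis even_zero order_refl)
qed

text \<open>The coefficients are those of the algebraic normal form of the indicator function of \<open>S\<close> in the
  coordinates \<open>\<phi>\<close>.\<close>

lemma incidence_vector_moebius:
  fixes \<phi> :: "bit ^ 'n::finite \<Rightarrow> bit ^ 'm::finite"
  assumes "inj \<phi>"
  shows "incidence_vector S =
    (\<Sum>J\<in>UNIV. of_nat (card {y \<in> S. supp (\<phi> y) \<subseteq> J}) *s incidence_vector {x. J \<subseteq> supp (\<phi> x)})"
proof -
  have "(\<Sum>J\<in>UNIV. of_nat (card {y \<in> S. supp (\<phi> y) \<subseteq> J}) * (if J \<subseteq> supp (\<phi> x) then 1 else 0))
      = (if x \<in> S then 1 else 0 :: bit)" for x
  proof -
    let ?X = "supp (\<phi> x)"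
    have "(\<Sum>J\<in>UNIV. of_nat (card {y \<in> S. supp (\<phi> y) \<subseteq> J}) * (if J \<subseteq> ?X then 1 else 0 :: bit))
        = (\<Sum>J\<in>UNIV. \<Sum>y\<in>S. if supp (\<phi> y) \<subseteq> J \<and> J \<subseteq> ?X then 1 else 0)"
    proof (rule sum.cong)
      fix J
      have "(\<Sum>y\<in>S. if supp (\<phi> y) \<subseteq> J then 1 else 0 :: bit) = of_nat (card {y \<in> S. supp (\<phi> y) \<subseteq> J})"
        by (simp add: sum.If_cases Int_def)
      then show "of_nat (card {y \<in> S. supp (\<phi> y) \<subseteq> J}) * (if J \<subseteq> ?X then 1 else 0 :: bit) =
          (\<Sum>y\<in>S. if supp (\<phi> y) \<subseteq> J \<and> J \<subseteq> ?X then 1 else 0)"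
        by auto
    qed simp
    also have "\<dots> = (\<Sum>y\<in>S. of_nat (card {J. supp (\<phi> y) \<subseteq> J \<and> J \<subseteq> ?X}))"
      by (subst sum.swap) (simp add: sum.If_cases Int_def)
    also have "\<dots> = (\<Sum>y\<in>S. if y = x then 1 else 0)"
    proof (rule sum.cong)
      fix y
      have "odd (card {J. supp (\<phi> y) \<subseteq> J \<and> J \<subseteq> ?X}) \<longleftrightarrow> y = x"
        by (metis assms finite incidence_vector_supp injD odd_card_between)
      then show "of_nat (card {J. supp (\<phi> y) \<subseteq> J \<and> J \<subseteq> ?X}) = (if y = x then 1 else 0 :: bit)"
        by (cases "y = x") (simp_all flip: bit_not_zero_iff)
    qed simp
    finally show ?thesis
      by simp
  qed
  then show ?thesis
    by (simp add: vec_eq_iff incidence_vector_def)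
qed

text \<open>The coefficient of the monomial \<open>J\<close> is the parity of \<open>S\<close> on
  points satisfying \<open>card (- J)\<close> equations, so it vanishes if that number is at most
  \<open>r\<close>. It also vanishes unless \<open>J0 \<subseteq> J\<close>, because every point of
  \<open>S\<close> satisfies the equations of \<open>J0\<close>. \<open>K\<close> is arbitrary, so
  that one expansion serves both codes.\<close>

lemma even_on_flats_imp_mem_span:
  fixes b :: "'m::finite \<Rightarrow> bit ^ 'n::finite" and k :: "'m \<Rightarrow> bit"
  assumes inj: "inj (\<lambda>x. (\<chi> j. bdot (b j) x + k j) :: bit ^ 'm)"
    and S: "even_on_flats r S" "S \<subseteq> {x. \<forall>j\<in>J0. bdot (b j) x + k j = 1}"
    and K: "vec.subspace K"
    and flats: "\<And>J. card J + r < CARD('m) \<Longrightarrow> J0 \<subseteq> J \<Longrightarrow>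
      incidence_vector {x. \<forall>j\<in>J. bdot (b j) x + k j = 1} \<in> K"
  shows "incidence_vector S \<in> K"
proof -
  define \<phi> where "\<phi> = (\<lambda>x. (\<chi> j. bdot (b j) x + k j) :: bit ^ 'm)"
  have "of_nat (card {y \<in> S. supp (\<phi> y) \<subseteq> J}) *s incidence_vector {x. J \<subseteq> supp (\<phi> x)} \<in> K" for J
  proof (cases "even (card {y \<in> S. supp (\<phi> y) \<subseteq> J})")
    case True
    then have "of_nat (card {y \<in> S. supp (\<phi> y) \<subseteq> J}) = (0 :: bit)"
      by simp
    then show ?thesis
      using K by (simp only: vec.scale_zero_left subspace_bit_iff)
  next
    case False
    have eq: "{y \<in> S. supp (\<phi> y) \<subseteq> J} = S \<inter> {x. \<forall>j\<in>- J. bdot (b j) x = k j}"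
      by (auto simp: \<phi>_def supp_def)
    have "\<not> card (- J) \<le> r"
      using even_on_flats_Int[of "- J" r S b k] S(1) False eq by auto
    moreover have "card J + card (- J) = CARD('m)"
      by (metis Compl_partition boolean_algebra.conj_cancel_right card_Un_disjoint finite)
    moreover have "J0 \<subseteq> J"
    proof (rule ccontr)
      assume "\<not> J0 \<subseteq> J"
      then obtain j where "j \<in> J0" "j \<notin> J"
        by auto
      then have "j \<in> supp (\<phi> y)" if "y \<in> S" for y
        using S(2) that by (auto simp: \<phi>_def supp_def simp del: bit_add_eq_0_iff)
      then have "{y \<in> S. supp (\<phi> y) \<subseteq> J} = {}"
        using \<open>j \<notin> J\<close> by blast
      then show False
        using False by (metis card.empty even_zero)
    qed
    moreover have "{x. J \<subseteq> supp (\<phi> x)} = {x. \<forall>j\<in>J. bdot (b j) x + k j = 1}"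
      by (auto simp: \<phi>_def supp_def bit_add_eq_1_iff)
    ultimately have "incidence_vector {x. J \<subseteq> supp (\<phi> x)} \<in> K"
      using flats[of J] by simp
    then show ?thesis
      using K by (rule vec.subspace_scale[rotated])
  qed
  then have "(\<Sum>J\<in>UNIV. of_nat (card {y \<in> S. supp (\<phi> y) \<subseteq> J}) *s
      incidence_vector {x. J \<subseteq> supp (\<phi> x)}) \<in> K"
    by (intro vec.subspace_sum[OF K])
  moreover have "inj \<phi>"
    using inj by (simp add: \<phi>_def)
  ultimately show ?thesis
    by (simp only: incidence_vector_moebius[of \<phi> S])
qed

lemma supp_subspace_even_on_flats:
  "vec.subspace {x :: bit ^ (bit ^ 'n::finite). even_on_flats r (supp x)}"
  unfolding subspace_bit_iff by (auto simp: supp_add even_on_flats_sym_diff)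

subsection \<open>Binary codes\<close>

text \<open>Adding a generator \<open>u\<close> to \<open>v\<close> changes the weight by
  \<open>weight u - 2 * card (supp u \<inter> supp v)\<close>. The overlap must be even, so the
  induction also carries orthogonality to all generators.\<close>

lemma doubly_even_span:
  assumes "\<And>x. x \<in> X \<Longrightarrow> 4 dvd weight x" "\<And>x y. x \<in> X \<Longrightarrow> y \<in> X \<Longrightarrow> bdot x y = 0"
    and "x \<in> vec.span X"
  shows "4 dvd weight x"
proof -
  have "(\<forall>y\<in>X. bdot y x = 0) \<and> 4 dvd weight x"
    using assms(3)
  proof (induction rule: vec.span_induct_alt)
    case (step c u v)
    have "4 dvd weight (u + v)"
    proof -
      have "even (card (supp u \<inter> supp v))"
        using step by (simp add: bdot_eq_0_iff)
      then have "4 dvd 2 * card (supp u \<inter> supp v)"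
        by auto
      moreover have "4 dvd weight (u + v) + 2 * card (supp u \<inter> supp v)"
        using assms(1)[of u] step by (simp add: weight_eq supp_add card_sym_diff)
      ultimately show ?thesis
        using dvd_add_left_iff by blast
    qed
    then show ?case
      using step assms(2) by (cases c) (auto simp: bdot_add_right)
  qed (simp add: weight_eq)
  then show ?thesis
    by simp
qed

section \<open>The MacWilliams identity and self-dual codes\<close>

lemma sg_sum: "sg (sum f A) = prod (\<lambda>i. sg (f i)) A"
  by (induction A rule: infinite_finite_induct) (simp_all add: sg_add)

text \<open>The sum factors over the coordinates: a choice of \<open>y\<close> picks
  \<open>z * sg (x $ i)\<close> or 1 at each \<open>i\<close>.\<close>

lemma sum_weight_sg:
  fixes z :: real and x :: "bit ^ 'i::finite"
  shows "(\<Sum>y\<in>UNIV. z ^ weight y * sg (bdot x y)) =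
    (1 - z) ^ weight x * (1 + z) ^ (CARD('i) - weight x)"
proof -
  have "(\<Sum>y\<in>UNIV. z ^ weight y * sg (bdot x y)) =
      (\<Sum>X\<in>UNIV. (\<Prod>i\<in>X. z * sg (x $ i)) * (\<Prod>i\<in>UNIV - X. 1))"
  proof (rule sum.reindex_bij_witness[of _ incidence_vector supp])
    fix y
    have "sg (bdot x y) = (\<Prod>i\<in>UNIV. if i \<in> supp y then sg (x $ i) else 1)"
      unfolding bdot_def sg_sum by (rule prod.cong) (auto simp: supp_def)
    also have "\<dots> = (\<Prod>i\<in>supp y. sg (x $ i))"
      by (simp add: prod.If_cases)
    finally show "(\<Prod>i\<in>supp y. z * sg (x $ i)) * (\<Prod>i\<in>UNIV - supp y. 1) =
        z ^ weight y * sg (bdot x y)"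
      by (simp add: prod.distrib weight_eq)
  qed simp_all
  also have "\<dots> = (\<Prod>i\<in>UNIV. z * sg (x $ i) + 1)"
    using prod_add[of "UNIV :: 'i set" "\<lambda>i. z * sg (x $ i)" "\<lambda>i. 1"] by simp
  also have "\<dots> = (\<Prod>i\<in>UNIV. if i \<in> supp x then 1 - z else 1 + z)"
    by (rule prod.cong) (auto simp: supp_def)
  also have "\<dots> = (1 - z) ^ weight x * (1 + z) ^ (CARD('i) - weight x)"
    by (simp add: prod.If_cases weight_eq card_Diff_subset Compl_eq_Diff_UNIV)
  finally show ?thesis .
qed

text \<open>Summing the transform \<open>sum_weight_sg\<close> over \<open>C\<close> and exchanging
  the sums, orthogonality of characters keeps exactly the words of the dual code.\<close>

theorem macwilliams:
  fixes z :: real and C :: "(bit ^ 'i::finite) set"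
  assumes "vec.subspace C"
  shows "(\<Sum>x\<in>C. (1 - z) ^ weight x * (1 + z) ^ (CARD('i) - weight x)) =
    card C * (\<Sum>y\<in>dual C. z ^ weight y)"
proof -
  have "(\<Sum>x\<in>C. (1 - z) ^ weight x * (1 + z) ^ (CARD('i) - weight x)) =
      (\<Sum>x\<in>C. \<Sum>y\<in>UNIV. z ^ weight y * sg (bdot x y))"
    by (simp add: sum_weight_sg)
  also have "\<dots> = (\<Sum>y\<in>UNIV. z ^ weight y * (\<Sum>x\<in>C. sg (bdot y x)))"
    by (subst sum.swap) (simp add: sum_distrib_left bdot_commute)
  also have "\<dots> = (\<Sum>y\<in>UNIV. if y \<in> dual C then z ^ weight y * card C else 0)"
    using assms by (intro sum.cong) (auto simp: sum_sg_subspace dual_def)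
  also have "\<dots> = (\<Sum>y\<in>dual C. z ^ weight y * card C)"
    by (simp add: sum.If_cases)
  finally show ?thesis
    by (simp add: sum_distrib_left mult.commute)
qed

lemma card_self_dual:
  fixes C :: "(bit ^ 'i::finite) set"
  assumes "dual C = C" "CARD('i) = 2 * m"
  shows "card C = 2 ^ m"
proof -
  have "(card C)\<^sup>2 = (2 ^ m)\<^sup>2"
    using card_dual[of C] assms subspace_dual[of C]
    by (simp add: power2_eq_square flip: power_add mult_2)
  then show ?thesis
    by simp
qed

subsection \<open>Reed--Muller codes\<close>

text \<open>A monomial of degree at most \<open>r\<close> is the indicator of a flat of dimension at
  least \<open>s + 1\<close>, whose sections of codimension at most \<open>s\<close> are even.
  Conversely, the normal form of a set even on those flats has no monomial of degree above
  \<open>r\<close>.\<close>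

lemma reed_muller_eq:
  assumes "r + s + 1 = CARD('n::finite)"
  shows "reed_muller r = {f :: bit ^ (bit ^ 'n). even_on_flats s (supp f)}"
proof
  let ?M = "\<lambda>I. {x :: bit ^ 'n. \<forall>i\<in>I. x $ i = 1}"
  have mono: "(\<chi> x. \<Prod>i\<in>I. x $ i) = incidence_vector (?M I)" for I
  proof -
    have "(\<Prod>i\<in>I. x $ i) = (if x \<in> ?M I then 1 else 0)" for x :: "bit ^ 'n"
      by (auto simp: prod_zero_iff intro: prod.neutral)
    then show ?thesis
      by (simp add: incidence_vector_def vec_eq_iff)
  qed
  have "even_on_flats s (?M I)" if "card I \<le> r" for I
  proof -
    have "?M I = {} \<or> (\<exists>x' W'. vec.subspace W' \<and> ?M I = coset x' W' \<and>
        card (UNIV :: (bit ^ 'n) set) \<le> card W' * 2 ^ card I)"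
      using coset_Int_hyperplanes[of I UNIV 0 "\<lambda>i. axis i 1" "\<lambda>i. 1"]
      by (auto simp: bdot_axis)
    moreover have coset: "even_on_flats s (coset x' W')"
      if "vec.subspace W'" "card (UNIV :: (bit ^ 'n) set) \<le> card W' * 2 ^ card I"
      for x' and W' :: "(bit ^ 'n) set"
    proof (rule even_on_flats_coset[OF that(1)], rule subspace_card_dvd[OF that(1)])
      have "2 ^ card I \<le> (2 ^ r :: nat)"
        using \<open>card I \<le> r\<close> by simp
      then have "2 ^ CARD('n) \<le> card W' * 2 ^ r"
        using order_trans[OF that(2) mult_le_mono2] by simp
      then have "2 ^ Suc s * 2 ^ r \<le> card W' * 2 ^ r"
        by (simp add: assms[symmetric] power_add mult_ac)
      then show "2 ^ Suc s \<le> card W'"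
        by (simp only: mult_le_cancel2) simp
    qed
    ultimately consider "?M I = {}"
      | x' W' where "vec.subspace W'" "?M I = coset x' W'"
          "card (UNIV :: (bit ^ 'n) set) \<le> card W' * 2 ^ card I"
      by blast
    then show ?thesis
    proof cases
      case 1
      then show ?thesis
        by (simp only: even_on_flats_empty)
    next
      case 2
      then show ?thesis
        using coset[of W' x'] by (simp only:)
    qed
  qed
  then have "{\<chi> x. \<Prod>i\<in>I. x $ i | I. card I \<le> r} \<subseteq> {f :: bit ^ (bit ^ 'n). even_on_flats s (supp f)}"
    unfolding mono by auto
  then show "reed_muller r \<subseteq> {f :: bit ^ (bit ^ 'n). even_on_flats s (supp f)}"
    unfolding reed_muller_def by (rule vec.span_minimal[OF _ supp_subspace_even_on_flats])
  show "{f :: bit ^ (bit ^ 'n). even_on_flats s (supp f)} \<subseteq> reed_muller r"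
  proof
    fix f :: "bit ^ (bit ^ 'n)"
    assume "f \<in> {f. even_on_flats s (supp f)}"
    then have "even_on_flats s (supp f)"
      by simp
    then have "incidence_vector (supp f) \<in> reed_muller r"
    proof (rule even_on_flats_imp_mem_span[of "\<lambda>i. axis i 1" "\<lambda>i. 0" _ _ "{}", rotated])
      show "inj (\<lambda>x. (\<chi> j. bdot (axis j 1) x + 0) :: bit ^ 'n)"
        by (simp add: bdot_axis)
      show "vec.subspace (reed_muller r :: (bit ^ (bit ^ 'n)) set)"
        by (simp add: reed_muller_def)
      fix J :: "'n set"
      assume "card J + s < CARD('n)"
      then have "card J \<le> r"
        using assms by simp
      then have "incidence_vector (?M J) \<in> reed_muller r"
        unfolding reed_muller_def mono by (intro vec.span_base) auto
      then show "incidence_vector {x. \<forall>j\<in>J. bdot (axis j 1) x + 0 = 1} \<in> reed_muller r"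
        by (simp add: bdot_axis)
    qed simp
    then show "f \<in> reed_muller r"
      by simp
  qed
qed

subsection \<open>The weight distribution of a self-dual code of length 128\<close>

text \<open>Doubly even words have weights divisible by 4, so entry \<open>j\<close> stands for
  weight \<open>4 * j\<close>.\<close>

definition weights128 :: "nat list" where
  "weights128 = [1, 0, 0, 0, 94488, 0, 74078592, 3128434688, 312335197020, 18125860315136, 552366841342848, 9491208609103872, 94117043084875944, 549823502398291968, 1920604779257215744, 4051966906789380096, 5193595576952890822, 4051966906789380096, 1920604779257215744, 549823502398291968, 94117043084875944, 9491208609103872, 552366841342848, 18125860315136, 312335197020, 3128434688, 74078592, 0, 94488, 0, 0, 0, 1]"

text \<open>Gleason's theorem in the variable \<open>t = z^4\<close>, with the invariants \<open>1 + 14 t + t\<^sup>2\<close> of degree 8 and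
  \<open>t (1 - t)^4\<close> of degree 24. The coefficients are determined by the weights up to 20.\<close>

lemma weights128_eq:
  "Poly (map real weights128) = [:1, 14, 1:] *
    (\<Sum>k\<le>5. smult ([1, -224, 16336, -430656, 3291264, -6475776] ! k)
      (([:1, 14, 1:] ^ 3) ^ (5 - k) * ([:0, 1:] * [:1, -1:] ^ 4) ^ k))"
proof -
  let ?p = "[:1, 14, 1:] :: real poly"
  let ?x = "[:0, 1:] * [:1, -1:] ^ 4 :: real poly"
  have p3: "?p ^ 3 = [:1, 42, 591, 2828, 591, 42, 1:]"
    by (simp add: power3_eq_cube)
  have "[:1, -1:] ^ 4 = ([:1, -4, 6, -4, 1:] :: real poly)"
    by (simp add: power4_eq_xxxx)
  then have x1: "?x = [:0, 1, -4, 6, -4, 1:]"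
    by simp
  have P: "y ^ 2 = y * y ^ 1" "y ^ 3 = y * y ^ 2" "y ^ 4 = y * y ^ 3" "y ^ 5 = y * y ^ 4"
    for y :: "real poly"
    by (simp_all add: eval_nat_numeral)
  have x2: "?x ^ 2 = [:0, 0, 1, -8, 28, -56, 70, -56, 28, -8, 1:]"
    unfolding P(1)[of ?x] power_one_right unfolding x1 by simp
  have x3: "?x ^ 3 = [:0, 0, 0, 1, -12, 66, -220, 495, -792, 924, -792, 495, -220, 66, -12, 1:]"
    unfolding P(2)[of ?x] x2 unfolding x1 by simp
  have x4: "?x ^ 4 = [:0, 0, 0, 0, 1, -16, 120, -560, 1820, -4368, 8008, -11440, 12870, -11440, 8008, -4368, 1820, -560, 120, -16, 1:]"
    unfolding P(3)[of ?x] x3 unfolding x1 by simp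
  have x5: "?x ^ 5 = [:0, 0, 0, 0, 0, 1, -20, 190, -1140, 4845, -15504, 38760, -77520, 125970, -167960, 184756, -167960, 125970, -77520, 38760, -15504, 4845, -1140, 190, -20, 1:]"
    unfolding P(4)[of ?x] x4 unfolding x1 by simp
  \<comment> \<open>\<open>r1\<close> to \<open>r5\<close> are the stages of Horner's scheme in
    \<open>?p ^ 3\<close>: stage \<open>k\<close> multiplies by \<open>?p ^ 3\<close> and adds the
    term with \<open>?x ^ k\<close>.\<close>
  have r1: "[:1:] * ?p ^ 3 + smult (-224) (?x) = [:1, -182, 1487, 1484, 1487, -182, 1:]"
    by (simp only: p3 x1) simp
  have r2: "[:1, -182, 1487, 1484, 1487, -182, 1:] * ?p ^ 3 + smult (16336) (?x ^ 2) = [:1, -140, 10770, -171484, 885935, 4122216, 7082620, 4122216, 885935, -171484, 10770, -140, 1:]"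
    by (simp only: p3 x2) simp
  have r3: "[:1, -140, 10770, -171484, 885935, 4122216, 7082620, 4122216, 885935, -171484, 10770, -140, 1:] * ?p ^ 3 + smult (-430656) (?x ^ 3) = [:1, -98, 5481, -229712, 4821220, -58063992, 319950036, 4929176528, 16874949854, 24578258100, 16874949854, 4929176528, 319950036, -58063992, 4821220, -229712, 5481, -98, 1:]"
    by (simp only: p3 x3) simp
  have r4: "[:1, -98, 5481, -229712, 4821220, -58063992, 319950036, 4929176528, 16874949854, 24578258100, 16874949854, 4929176528, 319950036, -58063992, 4821220, -229712, 5481, -98, 1:] * ?p ^ 3 + smult (3291264) (?x ^ 4) = [:1, -56, 1956, -54600, 1427298, -28550376, 479164692, -4292968600, 257615665007, 4502798382928, 25174981421896, 65850656900016, 89910553930332, 65850656900016, 25174981421896, 4502798382928, 257615665007, -4292968600, 479164692, -28550376, 1427298, -54600, 1956, -56, 1:]"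
    by (simp only: p3 x4) simp
  have r5: "[:1, -56, 1956, -54600, 1427298, -28550376, 479164692, -4292968600, 257615665007, 4502798382928, 25174981421896, 65850656900016, 89910553930332, 65850656900016, 25174981421896, 4502798382928, 257615665007, -4292968600, 479164692, -28550376, 1427298, -54600, 1956, -56, 1:] * ?p ^ 3 + smult (-6475776) (?x ^ 5) = [:1, -14, 195, -2716, 132317, -1849722, 99842383, 1732491048, 287980479965, 14092401104578, 354785245398791, 4510122772416220, 30620539025650073, 116625833266774726, 257222574496719507, 334225030568532272, 257222574496719507, 116625833266774726, 30620539025650073, 4510122772416220, 354785245398791, 14092401104578, 287980479965, 1732491048, 99842383, -1849722, 132317, -2716, 195, -14, 1:]"
    by (simp only: p3 x5) simp
  have fin: "?p * [:1, -14, 195, -2716, 132317, -1849722, 99842383, 1732491048, 287980479965, 14092401104578, 354785245398791, 4510122772416220, 30620539025650073, 116625833266774726, 257222574496719507, 334225030568532272, 257222574496719507, 116625833266774726, 30620539025650073, 4510122772416220, 354785245398791, 14092401104578, 287980479965, 1732491048, 99842383, -1849722, 132317, -2716, 195, -14, 1:] = Poly (map real weights128)"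
    by (simp add: weights128_def)
  have "(\<Sum>k\<le>5. smult ([1, -224, 16336, -430656, 3291264, -6475776] ! k) ((?p ^ 3) ^ (5 - k) * ?x ^ k)) =
    ((((([:1:] * ?p ^ 3 + smult (-224) ?x) * ?p ^ 3 + smult (16336) (?x ^ 2)) * ?p ^ 3
      + smult (-430656) (?x ^ 3)) * ?p ^ 3 + smult (3291264) (?x ^ 4)) * ?p ^ 3 + smult (-6475776) (?x ^ 5))"
  proof -
    have "(\<Sum>k\<le>5. smult ([1, -224, 16336, -430656, 3291264, -6475776] ! k) (P ^ (5 - k) * X ^ k)) =
      ((((([:1:] * P + smult (-224) X) * P + smult (16336) (X ^ 2)) * P
      + smult (-430656) (X ^ 3)) * P + smult (3291264) (X ^ 4)) * P + smult (-6475776) (X ^ 5))"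
      for P X :: "real poly"
      by (simp add: eval_nat_numeral atMost_Suc) (simp add: algebra_simps)
    then show ?thesis .
  qed
  then show ?thesis
    by (simp only: r1 r2 r3 r4 r5 fin)
qed

text \<open>Homogeneous of degree 32, with \<open>X\<close> and \<open>Y\<close> standing for the
  fourth powers of the two variables of the weight enumerator. The quadratic factor is the
  enumerator of the extended Hamming code of length 8.\<close>

definition gleason_form :: "real \<Rightarrow> real \<Rightarrow> real" where
  "gleason_form X Y = (X\<^sup>2 + 14 * X * Y + Y\<^sup>2) *
    (\<Sum>k\<le>5. [1, -224, 16336, -430656, 3291264, -6475776] ! k *
      ((X\<^sup>2 + 14 * X * Y + Y\<^sup>2) ^ 3) ^ (5 - k) * (X * Y * (X - Y) ^ 4) ^ k)"

lemma poly_weights128: "poly (Poly (map real weights128)) t = gleason_form 1 t"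
  unfolding weights128_eq gleason_form_def
  by (simp add: poly_sum power2_eq_square algebra_simps)

lemma gleason_sum_scale:
  fixes a P Q :: real
  shows "(\<Sum>k\<le>5. [1, -224, 16336, -430656, 3291264, -6475776] ! k * ((a * P) ^ 3) ^ (5 - k) * (a ^ 3 * Q) ^ k) =
    a ^ 15 * (\<Sum>k\<le>5. [1, -224, 16336, -430656, 3291264, -6475776] ! k * (P ^ 3) ^ (5 - k) * Q ^ k)"
  unfolding sum_distrib_left
proof (rule sum.cong)
  fix k :: nat
  assume "k \<in> {..5}"
  then have "3 * (5 - k) + 3 * k = 15"
    by simp
  then have "a ^ 15 = (a ^ 3) ^ (5 - k) * (a ^ 3) ^ k"
    by (simp only: power_mult[symmetric] power_add[symmetric])
  then show "[1, -224, 16336, -430656, 3291264, -6475776] ! k * ((a * P) ^ 3) ^ (5 - k) * (a ^ 3 * Q) ^ k =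
      a ^ 15 * ([1, -224, 16336, -430656, 3291264, -6475776] ! k * (P ^ 3) ^ (5 - k) * Q ^ k)"
    by (simp only: power_mult_distrib mult_ac)
qed simp

lemma gleason_form_scale: "gleason_form (c * X) (c * Y) = c ^ 32 * gleason_form X Y"
proof -
  have 1: "(c * X)\<^sup>2 + 14 * (c * X) * (c * Y) + (c * Y)\<^sup>2 = c\<^sup>2 * (X\<^sup>2 + 14 * X * Y + Y\<^sup>2)"
    by (simp add: power2_eq_square algebra_simps)
  have 2: "c * X * (c * Y) * (c * X - c * Y) ^ 4 = (c\<^sup>2) ^ 3 * (X * Y * (X - Y) ^ 4)"
    by (simp add: power_mult_distrib flip: right_diff_distrib) (simp add: eval_nat_numeral)
  have "c ^ 32 = c\<^sup>2 * (c\<^sup>2) ^ 15"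
    by (simp flip: power_mult power_add)
  then show ?thesis
    unfolding gleason_form_def 1 2 gleason_sum_scale by (simp only: mult_ac)
qed

text \<open>The quadratic invariant is multiplied by \<open>2 ^ 4\<close> and the sextic one by
  \<open>2 ^ 12\<close>; together this gives \<open>2 ^ 64\<close>, the size of a self-dual code of
  length 128, as in the MacWilliams identity.\<close>

lemma gleason_form_invariant:
  "gleason_form ((1 + z) ^ 4) ((1 - z) ^ 4) = 2 ^ 64 * gleason_form 1 (z ^ 4)"
proof -
  have 1: "((1 + z) ^ 4)\<^sup>2 + 14 * (1 + z) ^ 4 * (1 - z) ^ 4 + ((1 - z) ^ 4)\<^sup>2 =
      2 ^ 4 * (1\<^sup>2 + 14 * 1 * z ^ 4 + (z ^ 4)\<^sup>2)"
    by (simp add: eval_nat_numeral algebra_simps)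
  have "(1 + z) ^ 4 - (1 - z) ^ 4 = 8 * (z * (1 + z\<^sup>2))"
    by (simp add: eval_nat_numeral algebra_simps)
  then have "(1 + z) ^ 4 * (1 - z) ^ 4 * ((1 + z) ^ 4 - (1 - z) ^ 4) ^ 4 =
      8 ^ 4 * (((1 + z) * (1 - z)) ^ 4 * (z * (1 + z\<^sup>2)) ^ 4)"
    by (simp add: power_mult_distrib)
  also have "\<dots> = 8 ^ 4 * (z * ((1 + z) * (1 - z) * (1 + z\<^sup>2))) ^ 4"
    by (simp only: power_mult_distrib mult_ac)
  also have "(1 + z) * (1 - z) * (1 + z\<^sup>2) = 1 - z ^ 4"
    by (simp add: eval_nat_numeral algebra_simps)
  finally have 2: "(1 + z) ^ 4 * (1 - z) ^ 4 * ((1 + z) ^ 4 - (1 - z) ^ 4) ^ 4 =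
      (2 ^ 4) ^ 3 * (1 * z ^ 4 * (1 - z ^ 4) ^ 4)"
    by (simp add: power_mult_distrib)
  have "(2 :: real) ^ 64 = 2 ^ 4 * (2 ^ 4) ^ 15"
    by (simp only: power_add[symmetric] power_mult[symmetric]) simp
  then show ?thesis
    unfolding gleason_form_def 1 2 gleason_sum_scale by (simp only: mult_ac)
qed

text \<open>The condition on \<open>X\<close> comes from dehomogenizing at \<open>Y / X\<close>; it
  returns below as \<open>z \<noteq> -1\<close>.\<close>

lemma sum_weights128:
  "(\<Sum>j\<le>32. real (weights128 ! j) * Y ^ j * X ^ (32 - j)) = gleason_form X Y" if "X \<noteq> 0"
proof -
  have *: "poly (Poly xs) t = (\<Sum>i<length xs. xs ! i * t ^ i)" for xs and t :: real
    by (induction xs) (simp_all add: sum.lessThan_Suc_shift sum_distrib_left mult_ac del: sum.lessThan_Suc)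
  have "(\<Sum>j\<le>32. real (weights128 ! j) * t ^ j) = gleason_form 1 t" for t
  proof -
    have len: "length weights128 = 33"
      by (simp add: weights128_def)
    have "gleason_form 1 t = (\<Sum>j<33. map real weights128 ! j * t ^ j)"
      unfolding poly_weights128[symmetric] * by (simp only: length_map len)
    also have "\<dots> = (\<Sum>j\<le>32. real (weights128 ! j) * t ^ j)"
      by (rule sum.cong) (auto simp: len)
    finally show ?thesis
      by simp
  qed
  from this[of "Y / X"] have "gleason_form X Y = X ^ 32 * (\<Sum>j\<le>32. real (weights128 ! j) * (Y / X) ^ j)"
    using gleason_form_scale[of X 1 "Y / X"] that by simp
  also have "\<dots> = (\<Sum>j\<le>32. real (weights128 ! j) * Y ^ j * X ^ (32 - j))"
    unfolding sum_distrib_left using that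
    by (intro sum.cong) (simp_all add: power_divide power_diff)
  finally show ?thesis
    by simp
qed

text \<open>The map \<open>z \<mapsto> z^4\<close> is unramified at 1.\<close>

lemma order_pcompose_power4:
  fixes E R :: "real poly"
  assumes "E \<noteq> 0" "[:-1, 1:] ^ m dvd pcompose E [:0, 0, 0, 0, 1:]"
  shows "[:-1, 1:] ^ m dvd E"
proof -
  let ?q = "[:0, 0, 0, 0, 1:] :: real poly"
  obtain G where G: "E = [:-1, 1:] ^ order 1 E * G" "\<not> [:-1, 1:] dvd G"
    using order_decomp[OF assms(1), of 1] by auto
  have pw: "pcompose (p ^ n) ?q = pcompose p ?q ^ n" for p :: "real poly" and n
    by (induction n) (simp_all add: pcompose_mult one_pCons)
  \<comment> \<open>The cofactor takes the value 4 at 1, so the substitution preserves the order of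
    vanishing there.\<close>
  have "pcompose [:-1, 1:] ?q = [:-1, 1:] * [:1, 1, 1, 1:]"
    by (simp add: pcompose_pCons)
  then have eq: "pcompose E ?q = [:-1, 1:] ^ order 1 E * ([:1, 1, 1, 1:] ^ order 1 E * pcompose G ?q)"
    by (subst G(1)) (simp only: pcompose_mult pw power_mult_distrib mult.assoc)
  let ?S = "[:1, 1, 1, 1:] ^ order 1 E * pcompose G ?q"
  have S: "poly ?S 1 \<noteq> 0"
    using G(2) poly_eq_0_iff_dvd[of G 1] by (simp add: poly_pcompose)
  then have nz: "?S \<noteq> 0"
    by (metis poly_0)
  have "order 1 (pcompose E ?q) = order 1 ([:-1, 1 :: real:] ^ order 1 E) + order 1 ?S"
    unfolding eq using nz by (intro order_mult) auto
  moreover have "order 1 ?S = 0"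
    using S by (rule order_0I)
  moreover have "order 1 ([:-1, 1 :: real:] ^ order 1 E) = order 1 E"
    using order_power_n_n[of 1 "order 1 E"] by simp
  moreover have "m \<le> order 1 (pcompose E ?q)"
    using assms(2) order_divides[of 1 m "pcompose E ?q"] nz eq by auto
  ultimately show ?thesis
    using order_divides[of 1 m E] by simp
qed

text \<open>For the difference \<open>E\<close> of the two enumerators in \<open>t = z^4\<close>,
  the six points of the orbit appear as follows: the low coefficients give the factor
  \<open>t^6\<close> (order 24 at 0), symmetry bounds the degree by 26 (order 24 at infinity), and
  MacWilliams gives the factor \<open>(t - 1)^24\<close>, which covers all four fourth roots of
  unity. As \<open>6 + 24 > 26\<close>, \<open>E\<close> vanishes.\<close>

theorem self_dual_weight_distribution:
  fixes C :: "(bit ^ 'i::finite) set"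
  assumes len: "CARD('i) = 128" and dual: "dual C = C" and de: "\<And>x. x \<in> C \<Longrightarrow> 4 dvd weight x"
    and small: "\<And>i. 0 < i \<Longrightarrow> i < 16 \<Longrightarrow> num_weight C i = 0"
    and A16: "num_weight C 16 = 94488" and A20: "num_weight C 20 = 0"
  shows "num_weight C i = (if 4 dvd i \<and> i \<le> 128 then weights128 ! (i div 4) else 0)"
proof -
  have C: "vec.subspace C"
    using subspace_dual[of C] dual by simp
  have le: "weight x \<le> 128" for x :: "bit ^ 'i"
    unfolding weight_eq len[symmetric] by (rule card_mono) auto
  have zero: "num_weight C i = 0" if "\<not> (4 dvd i \<and> i \<le> 128)" for i
  proof -
    have "{x \<in> C. weight x = i} = {}"
      using that de le by auto
    then show ?thesis
      unfolding num_weight_def by (simp only: card.empty)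
  qed
  have A0: "num_weight C 0 = 1"
  proof -
    have "{x \<in> C. weight x = 0} = {0}"
      using C by (auto simp: subspace_bit_iff weight_eq supp_def vec_eq_iff)
    then show ?thesis
      by (simp add: num_weight_def)
  qed
  \<comment> \<open>All weights are even, so the all-one word is orthogonal to \<open>C\<close> and
    hence lies in it; adding it exchanges the weights \<open>i\<close> and
    \<open>128 - i\<close>.\<close>
  define u where "u = (incidence_vector UNIV :: bit ^ 'i)"
  have "even (weight x)" if "x \<in> C" for x
    using de[OF that] by (auto elim: dvd_trans[rotated])
  then have "u \<in> C"
    using dual by (auto simp: dual_def u_def bdot_eq_0_iff weight_eq)
  have sym: "num_weight C (128 - i) = num_weight C i" if "i \<le> 128" for i
  proof -
    have w: "weight (u + x) = 128 - weight x" for x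
      by (simp add: u_def weight_eq supp_add card_Diff_subset len)
    have "bij_betw ((+) u) {x \<in> C. weight x = i} {x \<in> C. weight x = 128 - i}"
      by (rule bij_betw_byWitness[of _ "(+) u"])
        (use C \<open>u \<in> C\<close> that le in \<open>auto simp: w subspace_bit_iff\<close>)
    then show ?thesis
      unfolding num_weight_def by (rule bij_betw_same_card[symmetric])
  qed
  define d where "d j = real (num_weight C (4 * j)) - real (weights128 ! j)" for j
  have d_low: "d j = 0" if "j < 6" for j
  proof -
    have "j \<in> {0, 1, 2, 3, 4, 5}"
      using that by auto
    then show ?thesis
      using small[of 4] small[of 8] small[of 12] by (auto simp: d_def weights128_def A0 A16 A20)
  qed
  have d_sym: "d (32 - j) = d j" if "j < 6" for j
  proof -
    have "j \<in> {0, 1, 2, 3, 4, 5}"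
      using that by auto
    then have "weights128 ! (32 - j) = weights128 ! j"
      by (auto simp: weights128_def)
    then show ?thesis
      using sym[of "4 * j"] that by (simp add: d_def diff_mult_distrib2)
  qed
  have d_high: "d j = 0" if "26 < j" "j \<le> 32" for j
    using d_sym[of "32 - j"] d_low[of "32 - j"] that by simp
  have sum_C: "(\<Sum>x\<in>C. h (weight x)) = (\<Sum>j\<le>32. real (num_weight C (4 * j)) * h (4 * j))"
    for h :: "nat \<Rightarrow> real"
  proof -
    have "(\<Sum>x\<in>C. h (weight x)) = (\<Sum>j\<le>32. \<Sum>x\<in>{x \<in> C. weight x div 4 = j}. h (weight x))"
    proof (rule sum.group[symmetric])
      show "(\<lambda>x. weight x div 4) ` C \<subseteq> {..32}"
        using le by (auto simp: div_le_mono[of _ 128 4, simplified])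
    qed simp_all
    also have "\<dots> = (\<Sum>j\<le>32. \<Sum>x\<in>{x \<in> C. weight x = 4 * j}. h (4 * j))"
      using de by (intro sum.cong) auto
    finally show ?thesis
      by (simp add: num_weight_def)
  qed
  have mac: "(\<Sum>j\<le>32. real (num_weight C (4 * j)) * ((1 - z) ^ (4 * j) * (1 + z) ^ (128 - 4 * j))) =
      2 ^ 64 * (\<Sum>j\<le>32. real (num_weight C (4 * j)) * z ^ (4 * j))" for z
    using macwilliams[OF C, of z] card_self_dual[OF dual, of 64]
    by (simp add: len dual sum_C[of "\<lambda>w. (1 - z) ^ w * (1 + z) ^ (128 - w)"] sum_C[of "\<lambda>w. z ^ w"])
  have gle: "(\<Sum>j\<le>32. real (weights128 ! j) * ((1 - z) ^ (4 * j) * (1 + z) ^ (128 - 4 * j))) =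
      2 ^ 64 * (\<Sum>j\<le>32. real (weights128 ! j) * z ^ (4 * j))" if "z \<noteq> -1" for z
  proof -
    have "(1 + z) ^ 4 \<noteq> 0"
      using that by (simp add: add_eq_0_iff)
    then have "(\<Sum>j\<le>32. real (weights128 ! j) * ((1 - z) ^ 4) ^ j * ((1 + z) ^ 4) ^ (32 - j)) =
        2 ^ 64 * (\<Sum>j\<le>32. real (weights128 ! j) * (z ^ 4) ^ j * 1 ^ (32 - j))"
      by (simp only: sum_weights128 gleason_form_invariant one_neq_zero not_False_eq_True)
    then show ?thesis
      by (simp add: power_mult[symmetric] diff_mult_distrib2 mult.assoc)
  qed
  let ?q = "[:0, 0, 0, 0, 1:] :: real poly"
  define E where "E = (\<Sum>j\<in>{6..26}. monom (d j) j)"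
  \<comment> \<open>The transformed difference with \<open>(1 - z)^24\<close> taken out, which is
    possible because only \<open>j \<ge> 6\<close> remain.\<close>
  define R where "R = (\<Sum>j\<in>{6..26}. smult (d j) ([:1, -1:] ^ (4 * j - 24) * [:1, 1:] ^ (128 - 4 * j)))"
  have restrict: "(\<Sum>j\<in>{6..26}. d j * h j) = (\<Sum>j\<le>32. d j * h j)" for h :: "nat \<Rightarrow> real"
    by (rule sum.mono_neutral_left) (use d_low d_high in auto)
  have dE: "(\<Sum>j\<le>32. d j * ((1 - z) ^ (4 * j) * (1 + z) ^ (128 - 4 * j))) =
      2 ^ 64 * (\<Sum>j\<le>32. d j * z ^ (4 * j))" if "z \<noteq> -1" for z
    using mac[of z] gle[OF that]
    by (simp add: d_def left_diff_distrib sum_subtractf right_diff_distrib)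
  have eval: "poly ([:1, -1:] ^ 24 * R) z = poly (smult (2 ^ 64) (pcompose E ?q)) z" if "z \<noteq> -1" for z
  proof -
    have "poly ([:1, -1:] ^ 24 * R) z = (\<Sum>j\<in>{6..26}. d j * ((1 - z) ^ (4 * j) * (1 + z) ^ (128 - 4 * j)))"
      unfolding R_def poly_mult poly_sum sum_distrib_left
    proof (rule sum.cong)
      fix j :: nat
      assume "j \<in> {6..26}"
      then have "(1 - z) ^ (4 * j) = (1 - z) ^ 24 * (1 - z) ^ (4 * j - 24)"
        by (simp flip: power_add)
      then show "poly ([:1, -1:] ^ 24) z * poly (smult (d j) ([:1, -1:] ^ (4 * j - 24) * [:1, 1:] ^ (128 - 4 * j))) z =
          d j * ((1 - z) ^ (4 * j) * (1 + z) ^ (128 - 4 * j))"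
        by (simp add: mult_ac)
    qed simp
    also have "\<dots> = 2 ^ 64 * (\<Sum>j\<in>{6..26}. d j * z ^ (4 * j))"
      unfolding restrict by (rule dE[OF that])
    also have "(\<Sum>j\<in>{6..26}. d j * z ^ (4 * j)) = poly (pcompose E ?q) z"
      by (simp add: E_def poly_pcompose poly_sum poly_monom power_mult eval_nat_numeral)
    finally show ?thesis
      by simp
  qed
  \<comment> \<open>\<open>eval\<close> covers only \<open>z \<noteq> -1\<close>. The factor
    \<open>1 + z\<close> makes both sides agree everywhere and is then cancelled.\<close>
  have "[:1, 1:] * ([:1, -1:] ^ 24 * R) = [:1, 1:] * smult (2 ^ 64) (pcompose E ?q)"
  proof -
    have "poly ([:1, 1:] * ([:1, -1:] ^ 24 * R)) z =
        poly ([:1, 1:] * smult (2 ^ 64) (pcompose E ?q)) z" for z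
      using eval[of z] unfolding poly_mult[of "[:1, 1:]"] by (cases "z = -1") simp_all
    then show ?thesis
      by (intro iffD1[OF poly_eq_poly_eq_iff] ext)
  qed
  then have id: "[:1, -1:] ^ 24 * R = smult (2 ^ 64) (pcompose E ?q)"
    by (subst (asm) mult_left_cancel) simp_all
  have "[:-1, 1 :: real:] ^ 24 = [:1, -1:] ^ 24"
    using power_minus_even[of 24 "[:1, -1 :: real:]"] by simp
  then have "[:-1, 1:] ^ 24 dvd smult (2 ^ 64) (pcompose E ?q)"
    using id by (metis dvd_triv_left)
  then have dvd: "[:-1, 1:] ^ 24 dvd pcompose E ?q"
    by (simp add: dvd_smult_iff)
  have coeff_E: "coeff E j = (if j \<in> {6..26} then d j else 0)" for j
    by (simp add: E_def coeff_sum)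
  have "E = 0"
  proof (rule ccontr)
    assume "E \<noteq> 0"
    then obtain G where G: "E = [:-1, 1:] ^ 24 * G"
      using order_pcompose_power4[OF _ dvd] by auto
    have "G \<noteq> 0"
      using \<open>E \<noteq> 0\<close> G by auto
    have "[:0, 1:] ^ 6 dvd E"
    proof -
      have "monom 1 6 dvd E"
        by (simp add: monom_1_dvd_iff' coeff_E)
      then show ?thesis
        by (simp add: monom_altdef)
    qed
    then have "6 \<le> order 0 E"
      using order_divides[of 0 6 E] \<open>E \<noteq> 0\<close> by simp
    also have "order 0 E = order 0 ([:-1, 1 :: real:] ^ 24) + order 0 G"
      unfolding G using \<open>E \<noteq> 0\<close> G by (intro order_mult) auto
    also have "order 0 ([:-1, 1 :: real:] ^ 24) = 0"
      by (rule order_0I) simp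
    finally have "6 \<le> degree G"
      using order_degree[OF \<open>G \<noteq> 0\<close>, of 0] by simp
    moreover have "degree E = 24 + degree G"
      unfolding G using \<open>G \<noteq> 0\<close> by (subst degree_mult_eq) (auto simp: degree_power_eq)
    moreover have "degree E \<le> 26"
      by (rule degree_le) (simp add: coeff_E)
    ultimately show False
      by simp
  qed
  then have "d j = 0" if "j \<le> 32" for j
    using coeff_E[of j] d_low[of j] d_high[of j] that by (cases "j \<in> {6..26}") auto
  then show ?thesis
    using zero[of i] by (auto simp: d_def elim!: dvdE)
qed

subsection \<open>Small sets with even flat sections\<close>

text \<open>The Fourier coefficient at \<open>a\<close> of the indicator function of
  \<open>S\<close>.\<close>

definition bias :: "(bit ^ 'n::finite) set \<Rightarrow> bit ^ 'n \<Rightarrow> real" where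
  "bias S a = (\<Sum>x\<in>S. sg (bdot a x))"

text \<open>The functionals that do not split \<open>S\<close>; for nonempty \<open>S\<close> they
  form the annihilator of the direction space of its affine hull.\<close>

definition const_functionals :: "(bit ^ 'n::finite) set \<Rightarrow> (bit ^ 'n) set" where
  "const_functionals S = {a. \<forall>x\<in>S. \<forall>y\<in>S. bdot a x = bdot a y}"

lemma parseval:
  fixes S :: "(bit ^ 'n::finite) set"
  shows "(\<Sum>a\<in>UNIV. (bias S a)\<^sup>2) = 2 ^ CARD('n) * real (card S)"
proof -
  have "(\<Sum>a\<in>UNIV. (bias S a)\<^sup>2) = (\<Sum>a\<in>UNIV. \<Sum>x\<in>S. \<Sum>y\<in>S. sg (bdot a (x + y)))"
    by (simp add: bias_def power2_eq_square sum_product bdot_add_right sg_add)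
  also have "\<dots> = (\<Sum>x\<in>S. \<Sum>y\<in>S. \<Sum>a\<in>UNIV. sg (bdot a (x + y)))"
    by (subst sum.swap, rule sum.cong[OF refl], rule sum.swap)
  also have "\<dots> = (\<Sum>x\<in>S. \<Sum>y\<in>S. if y = x then 2 ^ CARD('n) else 0)"
  proof (intro sum.cong refl)
    fix x y :: "bit ^ 'n"
    have "(\<forall>a. bdot (x + y) a = 0) \<longleftrightarrow> y = x"
      using bdot_nondegenerate[of "x + y"] by (auto simp: bdot_commute vec_bit_add_eq_0_iff)
    then show "(\<Sum>a\<in>UNIV. sg (bdot a (x + y))) = (if y = x then 2 ^ CARD('n) else 0)"
      using sum_sg_subspace[of UNIV "x + y"] by (simp add: bdot_commute)
  qed
  finally show ?thesis
    by simp
qed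

lemma card_split_hyperplane:
  "card S = card (S \<inter> {x. bdot a x = 0}) + card (S \<inter> {x. bdot a x = 1})"
proof -
  have "(S \<inter> {x. bdot a x = 0}) \<union> (S \<inter> {x. bdot a x = 1}) = S"
    by auto
  moreover have "card ((S \<inter> {x. bdot a x = 0}) \<union> (S \<inter> {x. bdot a x = 1})) =
      card (S \<inter> {x. bdot a x = 0}) + card (S \<inter> {x. bdot a x = 1})"
    by (rule card_Un_disjoint) auto
  ultimately show ?thesis
    by (simp only:)
qed

lemma bias_eq: "bias S a = real (card (S \<inter> {x. bdot a x = 0})) - real (card (S \<inter> {x. bdot a x = 1}))"
proof -
  have "bias S a = (\<Sum>x\<in>S. if bdot a x = 0 then 1 else -1)"
    by (simp add: bias_def sg_def)
  also have "\<dots> = real (card (S \<inter> {x. bdot a x = 0})) - real (card (S \<inter> {x. bdot a x = 1}))"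
    by (simp add: sum.If_cases Collect_neg_eq[symmetric])
  finally show ?thesis .
qed

lemma const_functionals_eq:
  assumes "x \<in> S"
  shows "const_functionals S = dual (coset x S)"
proof -
  have "(\<forall>y\<in>S. \<forall>z\<in>S. bdot a y = bdot a z) \<longleftrightarrow> (\<forall>y\<in>coset x S. bdot a y = 0)" for a
  proof
    assume *: "\<forall>y\<in>S. \<forall>z\<in>S. bdot a y = bdot a z"
    show "\<forall>y\<in>coset x S. bdot a y = 0"
    proof
      fix y
      assume "y \<in> coset x S"
      then have "x + y \<in> S"
        by simp
      then have "bdot a (x + y) = bdot a x"
        using * assms by blast
      then have "bdot a x + bdot a y = bdot a x"
        by (simp only: bdot_add_right)
      then show "bdot a y = 0"
        by (cases "bdot a x"; cases "bdot a y") simp_all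
    qed
  next
    assume *: "\<forall>y\<in>coset x S. bdot a y = 0"
    have "bdot a y = bdot a x" if "y \<in> S" for y
      using *[rule_format, of "x + y"] that by (simp add: bdot_add_right)
    then show "\<forall>y\<in>S. \<forall>z\<in>S. bdot a y = bdot a z"
      by simp
  qed
  then show ?thesis
    by (simp add: const_functionals_def dual_def)
qed

lemma subspace_const_functionals: "x \<in> S \<Longrightarrow> vec.subspace (const_functionals S)"
  by (simp add: const_functionals_eq subspace_dual)

text \<open>The right-hand side is the affine hull of \<open>S\<close>, so \<open>S\<close> is a
  flat as soon as the two sizes agree.\<close>

lemma subset_coset_dual_const:
  assumes "x \<in> S"
  shows "S \<subseteq> coset x (dual (const_functionals S))"
proof
  fix y
  assume "y \<in> S"
  then have "bdot a x = bdot a y" if "a \<in> const_functionals S" for a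
    using that assms unfolding const_functionals_def by blast
  then have "bdot (x + y) a = 0" if "a \<in> const_functionals S" for a
    using that unfolding bdot_commute[of "x + y" a] bdot_add_right by simp
  then show "y \<in> coset x (dual (const_functionals S))"
    by (simp add: dual_def)
qed

lemma bias_const: "a \<in> const_functionals S \<Longrightarrow> (bias S a)\<^sup>2 = (real (card S))\<^sup>2"
proof -
  assume a: "a \<in> const_functionals S"
  show ?thesis
  proof (cases "S = {}")
    case False
    then obtain x where "x \<in> S"
      by auto
    then have "bdot a y = bdot a x" if "y \<in> S" for y
      using a that unfolding const_functionals_def by blast
    then have "bias S a = (\<Sum>y\<in>S. sg (bdot a x))"
      unfolding bias_def by (intro sum.cong) simp_all
    then show ?thesis
      by (simp add: sg_def)
  qed (simp add: bias_def)
qed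

text \<open>Parseval's sum, split into the functionals constant on \<open>S\<close> and the others.
  In the applications this equation determines the number of the former, and thereby the size of the
  affine hull of \<open>S\<close>.\<close>

lemma parseval_two_valued:
  fixes S :: "(bit ^ 'n::finite) set"
    and c :: real
  assumes "\<And>a. a \<notin> const_functionals S \<Longrightarrow> (bias S a)\<^sup>2 = c"
  shows "real (card (const_functionals S)) * (real (card S))\<^sup>2 +
    (2 ^ CARD('n) - real (card (const_functionals S))) * c = 2 ^ CARD('n) * real (card S)"
proof -
  let ?A = "const_functionals S"
  have "2 ^ CARD('n) * real (card S) = (\<Sum>a\<in>?A. (bias S a)\<^sup>2) + (\<Sum>a\<in>- ?A. (bias S a)\<^sup>2)"
    unfolding parseval[symmetric] Compl_eq_Diff_UNIV
    by (subst sum.subset_diff[of ?A UNIV]) (simp_all add: add.commute)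
  also have "\<dots> = card ?A * (real (card S))\<^sup>2 + card (- ?A) * c"
    using bias_const[of _ S] assms by simp
  also have "real (card (- ?A)) = 2 ^ CARD('n) - real (card ?A)"
  proof -
    have "card (- ?A) + card ?A = card (- ?A \<union> ?A)"
      by (rule card_Un_disjoint[symmetric]) auto
    then have "card (- ?A) + card ?A = 2 ^ CARD('n)"
      by (simp add: Compl_partition2)
    then have "real (card (- ?A) + card ?A) = real (2 ^ CARD('n))"
      by (simp only:)
    then show ?thesis
      by simp
  qed
  finally show ?thesis
    by simp
qed

lemma card_dual_const:
  fixes S :: "(bit ^ 'n::finite) set"
  assumes "x \<in> S"
  shows "card (const_functionals S) * card (dual (const_functionals S)) = 2 ^ CARD('n)"
  by (rule card_dual[OF subspace_const_functionals[OF assms]])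

lemma not_const_imp:
  assumes "a \<notin> const_functionals S"
  shows "S \<inter> {x. bdot a x = c} \<noteq> {}"
proof -
  obtain x y where "x \<in> S" "y \<in> S" "bdot a x \<noteq> bdot a y"
    using assms by (auto simp: const_functionals_def)
  then have "x \<in> S \<inter> {x. bdot a x = c} \<or> y \<in> S \<inter> {x. bdot a x = c}"
    by (cases "bdot a x"; cases "bdot a y"; cases c) auto
  then show ?thesis
    by blast
qed

lemma even_on_flats_imp_even: "even_on_flats r S \<Longrightarrow> even (card S)"
  using even_on_flats_mono[of r S 0] by simp

text \<open>A functional that splits \<open>S\<close> leaves at least \<open>2 ^ Suc r\<close>
  points on either side, hence exactly half of \<open>S\<close>, so its Fourier coefficient is 0.
  Parseval then shows that the affine hull is no larger than \<open>S\<close>.\<close>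

lemma even_on_flats_min_card_imp_coset:
  fixes S :: "(bit ^ 'n::finite) set"
  assumes S: "even_on_flats (Suc r) S" and card: "card S = 2 ^ Suc (Suc r)"
  obtains x W where "vec.subspace W" "S = coset x W"
proof -
  have "S \<noteq> {}"
    using card by auto
  then obtain x where x: "x \<in> S"
    by auto
  let ?A = "const_functionals S"
  have "(bias S a)\<^sup>2 = 0" if "a \<notin> ?A" for a
  proof -
    have "2 ^ Suc r \<le> card (S \<inter> {x. bdot a x = c})" for c
      using S not_const_imp[OF that, of c] by (intro even_on_flats_min_card) auto
    from this[of 0] this[of 1] have "card (S \<inter> {x. bdot a x = 0}) = card (S \<inter> {x. bdot a x = 1})"
      using card_split_hyperplane[of S a] card by simp
    then show ?thesis
      by (simp add: bias_eq)
  qed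
  from parseval_two_valued[OF this]
  have "real (card ?A * card S) * card S = real (2 ^ CARD('n)) * card S"
    by (simp add: power2_eq_square)
  then have "real (card ?A * card S) = real (2 ^ CARD('n))"
    using card by simp
  then have "card ?A * card S = card ?A * card (dual ?A)"
    unfolding card_dual_const[OF x] by (simp only: of_nat_eq_iff)
  then have "card S = card (coset x (dual ?A))"
    using card_subspace_pos[OF subspace_const_functionals[OF x]] by auto
  then have "S = coset x (dual ?A)"
    by (intro card_subset_eq subset_coset_dual_const x) simp_all
  then show ?thesis
    using that subspace_dual by blast
qed

text \<open>A functional can split 10 points only as 4 + 6, so Parseval gives an affine hull of 16
  points. The other 6 points of the hull would again be even on flats of codimension 2, below the
  minimum size 8.\<close>

lemma even_on_flats_2_card_neq_10:
  fixes S :: "(bit ^ 'n::finite) set"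
  assumes S: "even_on_flats 2 S"
  shows "card S \<noteq> 10"
proof
  assume card: "card S = 10"
  then have "S \<noteq> {}"
    by auto
  then obtain x where x: "x \<in> S"
    by auto
  let ?A = "const_functionals S"
  have "(bias S a)\<^sup>2 = 4" if "a \<notin> ?A" for a
  proof -
    have h: "even_on_flats (Suc 0) (S \<inter> {x. bdot a x = c})" for c
      using S by (simp add: numeral_2_eq_2)
    have "4 \<le> card (S \<inter> {x. bdot a x = c})" "even (card (S \<inter> {x. bdot a x = c}))" for c
      using even_on_flats_min_card[OF h not_const_imp[OF that]] even_on_flats_imp_even[OF h] by simp_all
    from this[of 0] this[of 1] have "card (S \<inter> {x. bdot a x = 0}) \<in> {4, 6}"
      using card_split_hyperplane[of S a] card by (auto elim!: evenE; presburger)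
    then show ?thesis
      using card_split_hyperplane[of S a] card by (auto simp: bias_eq)
  qed
  from parseval_two_valued[OF this] have "real (16 * card ?A) = real (2 ^ CARD('n))"
    by (simp add: card algebra_simps)
  then have "card ?A * 16 = card ?A * card (dual ?A)"
    unfolding card_dual_const[OF x] by (simp only: of_nat_eq_iff mult.commute)
  then have F: "card (coset x (dual ?A)) = 16"
    using card_subspace_pos[OF subspace_const_functionals[OF x]] by auto
  let ?F = "coset x (dual ?A)"
  have sub: "S \<subseteq> ?F"
    using subset_coset_dual_const[OF x] .
  have "even_on_flats 2 ?F"
    using F by (intro even_on_flats_coset subspace_dual) simp
  then have "even_on_flats 2 (sym_diff ?F S)"
    using S by (intro even_on_flats_sym_diff)
  moreover have eq: "sym_diff ?F S = ?F - S"
    using sub by auto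
  moreover have "card (?F - S) = 6"
    using sub F card by (simp add: card_Diff_subset del: card_coset)
  moreover from this have "?F - S \<noteq> {}"
    by force
  ultimately show False
    using even_on_flats_min_card[of 2 "?F - S"] by simp
qed

text \<open>The two halves are even, have at least 8 points and not 10, which leaves 8 + 12.
  Parseval then makes \<open>96 * card ?A\<close> a power of 2, against the prime factor 3.\<close>

lemma even_on_flats_3_card_neq_20:
  fixes S :: "(bit ^ 'n::finite) set"
  assumes S: "even_on_flats 3 S"
  shows "card S \<noteq> 20"
proof
  assume card: "card S = 20"
  let ?A = "const_functionals S"
  have "(bias S a)\<^sup>2 = 16" if "a \<notin> ?A" for a
  proof -
    have h: "even_on_flats 2 (S \<inter> {x. bdot a x = c})" for c
      using S by (simp add: numeral_3_eq_3 numeral_2_eq_2)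
    have "8 \<le> card (S \<inter> {x. bdot a x = c})" "even (card (S \<inter> {x. bdot a x = c}))"
      "card (S \<inter> {x. bdot a x = c}) \<noteq> 10" for c
      using even_on_flats_min_card[OF h not_const_imp[OF that]] even_on_flats_imp_even[OF h]
        even_on_flats_2_card_neq_10[OF h] by simp_all
    from this[of 0] this[of 1] have "card (S \<inter> {x. bdot a x = 0}) \<in> {8, 12}"
      using card_split_hyperplane[of S a] card by (auto elim!: evenE; presburger)
    then show ?thesis
      using card_split_hyperplane[of S a] card by (auto simp: bias_eq)
  qed
  from parseval_two_valued[OF this] have "real (3 * (32 * card ?A)) = real (2 ^ CARD('n))"
    by (simp add: card algebra_simps)
  then have "3 * (32 * card ?A) = (2 :: nat) ^ CARD('n)"
    by (simp only: of_nat_eq_iff)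
  then have "3 dvd (2 :: nat) ^ CARD('n)"
    by (metis dvd_triv_left)
  moreover have "prime (3 :: nat)"
    by simp
  ultimately have "3 dvd (2 :: nat)"
    using prime_dvd_power by blast
  then show False
    by simp
qed

subsection \<open>Counting subspaces and flats\<close>

definition subspaces_between :: "(bit ^ 'n::finite) set \<Rightarrow> (bit ^ 'n) set \<Rightarrow> nat \<Rightarrow> (bit ^ 'n) set set" where
  "subspaces_between B U k = {W. vec.subspace W \<and> B \<subseteq> W \<and> W \<subseteq> U \<and> card W = 2 ^ k}"

text \<open>For \<open>b \<le> n\<close> this is the Gaussian binomial coefficient of
  \<open>n - b\<close> over \<open>j\<close> at \<open>q = 2\<close>, in the recursive form produced
  by the double counting in \<open>card_subspaces_between\<close>.\<close>

primrec num_subspaces :: "nat \<Rightarrow> nat \<Rightarrow> nat \<Rightarrow> nat" where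
  "num_subspaces 0 b n = 1"
| "num_subspaces (Suc j) b n = (2 ^ n - 2 ^ b) * num_subspaces j (Suc b) n div (2 ^ (b + Suc j) - 2 ^ b)"

lemma num_subspaces_numeral:
  "num_subspaces (numeral v) b n =
    (2 ^ n - 2 ^ b) * num_subspaces (pred_numeral v) (Suc b) n div (2 ^ (b + numeral v) - 2 ^ b)"
  by (simp add: numeral_eq_Suc)

lemma subspace_insert:
  assumes "vec.subspace B"
  shows "vec.subspace (B \<union> coset v B)"
proof -
  have *: "x + y \<in> B" if "x \<in> B" "y \<in> B" for x y
    using assms that by (simp add: subspace_bit_iff)
  have c1: "v + (x + y) \<in> B" if "x \<in> B" "v + y \<in> B" for x y
    using *[OF that] by (simp add: ac_simps)
  have c2: "v + (x + y) \<in> B" if "v + x \<in> B" "y \<in> B" for x y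
    using *[OF that] by (simp add: ac_simps)
  have c3: "x + y \<in> B" if "v + x \<in> B" "v + y \<in> B" for x y
  proof -
    have "(v + x) + (v + y) = x + y"
      by (simp add: add.assoc add.left_commute)
    then show ?thesis
      using *[OF that] by simp
  qed
  have sum: "x + y \<in> B \<union> coset v B" if "x \<in> B \<union> coset v B" "y \<in> B \<union> coset v B" for x y
    using that unfolding Un_iff mem_coset by (elim disjE) (simp_all only: * c1 c2 c3 simp_thms)
  have "0 \<in> B \<union> coset v B"
    using assms by (simp add: subspace_bit_iff)
  then show ?thesis
    unfolding subspace_bit_iff using sum by (intro conjI ballI)
qed

lemma card_insert_subspace:
  assumes "vec.subspace B" "v \<notin> B"
  shows "card (B \<union> coset v B) = 2 * card B"
proof -
  have "B \<inter> coset v B = {}"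
    using coset_disjoint[OF assms(1), of 0 v] assms(2) by simp
  then show ?thesis
    by (simp add: card_Un_disjoint)
qed

text \<open>Pairs of a vector \<open>v \<in> U - B\<close> and a subspace through it are counted
  twice over; the subspaces containing \<open>B\<close> and \<open>v\<close> are those above
  \<open>B \<union> coset v B\<close>, one dimension up.\<close>

theorem card_subspaces_between:
  fixes U B :: "(bit ^ 'n::finite) set"
  assumes U: "vec.subspace U" "card U = 2 ^ n"
    and "vec.subspace B" "B \<subseteq> U" "card B = 2 ^ b"
  shows "card (subspaces_between B U (b + j)) = num_subspaces j b n"
  using assms(3-)
proof (induction j arbitrary: B b)
  case 0
  have "W = B" if "B \<subseteq> W" "card W = 2 ^ b" for W
    using card_subset_eq[OF finite that(1)] 0 that(2) by simp
  then have "subspaces_between B U b = {B}"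
    using 0 by (auto simp: subspaces_between_def)
  then show ?case
    by simp
next
  case (Suc j)
  let ?S = "subspaces_between B U (b + Suc j)"
  have "(\<Sum>v\<in>U - B. card {W \<in> ?S. v \<in> W}) = (\<Sum>W\<in>?S. 2 ^ (b + Suc j) - 2 ^ b)"
  proof (rule sum_multicount_gen)
    show "\<forall>W\<in>?S. card {v \<in> U - B. v \<in> W} = 2 ^ (b + Suc j) - 2 ^ b"
    proof
      fix W
      assume "W \<in> ?S"
      then have "{v \<in> U - B. v \<in> W} = W - B" "B \<subseteq> W" "card W = 2 ^ (b + Suc j)"
        by (auto simp: subspaces_between_def)
      then show "card {v \<in> U - B. v \<in> W} = 2 ^ (b + Suc j) - 2 ^ b"
        using Suc.prems by (simp add: card_Diff_subset)
    qed
  qed simp_all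
  moreover have "card {W \<in> ?S. v \<in> W} = num_subspaces j (Suc b) n" if "v \<in> U - B" for v
  proof -
    let ?B = "B \<union> coset v B"
    have sub: "coset v B \<subseteq> W" if "vec.subspace W" "B \<subseteq> W" "v \<in> W" for W
    proof
      fix y
      assume "y \<in> coset v B"
      then have "v + (v + y) \<in> W"
        using that unfolding subspace_bit_iff mem_coset by blast
      then show "y \<in> W"
        by simp
    qed
    have "v \<in> coset v B"
      by (rule coset_self[OF Suc.prems(1)])
    then have "{W \<in> ?S. v \<in> W} = subspaces_between ?B U (Suc b + j)"
      using sub by (auto simp: subspaces_between_def)
    then show ?thesis
      using Suc.IH[of ?B "Suc b"] subspace_insert[OF Suc.prems(1)] card_insert_subspace[OF Suc.prems(1)]
        that sub[OF U(1) Suc.prems(2)] Suc.prems by simp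
  qed
  ultimately have "card (U - B) * num_subspaces j (Suc b) n = card ?S * (2 ^ (b + Suc j) - 2 ^ b)"
    by simp
  moreover have "card (U - B) = 2 ^ n - 2 ^ b"
    using Suc.prems U by (simp add: card_Diff_subset)
  moreover have "(0 :: nat) < 2 ^ (b + Suc j) - 2 ^ b"
    using power_strict_increasing[of b "b + Suc j" "2 :: nat"] by simp
  ultimately show ?case
    by (metis div_mult_self_is_m num_subspaces.simps(2))
qed

definition flats_in :: "bit ^ 'n::finite \<Rightarrow> (bit ^ 'n) set \<Rightarrow> (bit ^ 'n) set \<Rightarrow> (bit ^ 'n) set set" where
  "flats_in z U W = (\<lambda>x. coset x W) ` coset z U"

lemma card_flats_in:
  assumes U: "vec.subspace U" and W: "vec.subspace W" "W \<subseteq> U"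
  shows "card W * card (flats_in z U W) = card U"
proof -
  have "card W * card (flats_in z U W) = card (\<Union> (flats_in z U W))"
  proof (rule card_partition)
    fix A B
    assume "A \<in> flats_in z U W" "B \<in> flats_in z U W" "A \<noteq> B"
    then obtain x y where "A = coset x W" "B = coset y W" "x + y \<notin> W"
      using coset_eq_iff[OF W(1)] unfolding flats_in_def by blast
    then show "A \<inter> B = {}"
      using coset_disjoint[OF W(1)] by blast
  qed (auto simp: flats_in_def)
  also have "\<Union> (flats_in z U W) = coset z U"
  proof
    have "y \<in> coset z U" if "x \<in> coset z U" "y \<in> coset x W" for x y
    proof -
      have "(z + x) + (x + y) \<in> U"
        using that W(2) U unfolding subspace_bit_iff mem_coset by blast
      then show ?thesis
        by (simp add: add.assoc)
    qed
    then show "\<Union> (flats_in z U W) \<subseteq> coset z U"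
      by (auto simp: flats_in_def)
    show "coset z U \<subseteq> \<Union> (flats_in z U W)"
      using coset_self[OF W(1)] unfolding flats_in_def by blast
  qed
  finally show ?thesis
    by simp
qed

lemma coset_inj:
  assumes "vec.subspace W" "vec.subspace W'" "coset x W = coset x' W'"
  shows "W = W'"
proof -
  have "coset x' W' = coset x W'"
    using assms coset_self[of W x] coset_eq_iff[OF assms(2), of x' x] by auto
  then have "coset x W = coset x W'"
    using assms(3) by (simp only:)
  then have "x + y \<in> coset x W \<longleftrightarrow> x + y \<in> coset x W'" for y
    by (simp only:)
  then show ?thesis
    by auto
qed

lemma card_UN_flats_in:
  assumes U: "vec.subspace U" and W: "\<And>W. W \<in> \<W> \<Longrightarrow> vec.subspace W \<and> W \<subseteq> U \<and> card W = s"
  shows "s * card (\<Union>W\<in>\<W>. flats_in z U W) = card \<W> * card U"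
proof -
  have "card (\<Union>W\<in>\<W>. flats_in z U W) = (\<Sum>W\<in>\<W>. card (flats_in z U W))"
  proof (rule card_UN_disjoint)
    have "W = W'" if *: "W \<in> \<W>" "W' \<in> \<W>" "A \<in> flats_in z U W" "A \<in> flats_in z U W'" for W W' A
    proof -
      obtain x y where "A = coset x W" "A = coset y W'"
        using *(3,4) unfolding flats_in_def by blast
      then have eq: "coset x W = coset y W'"
        by simp
      have "vec.subspace W" "vec.subspace W'"
        using W *(1,2) by simp_all
      then show ?thesis
        using eq by (rule coset_inj)
    qed
    then show "\<forall>W\<in>\<W>. \<forall>W'\<in>\<W>. W \<noteq> W' \<longrightarrow> flats_in z U W \<inter> flats_in z U W' = {}"
      by blast
  qed simp_all
  then have "s * card (\<Union>W\<in>\<W>. flats_in z U W) = (\<Sum>W\<in>\<W>. s * card (flats_in z U W))"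
    by (simp add: sum_distrib_left)
  also have "\<dots> = (\<Sum>W\<in>\<W>. card U)"
    using card_flats_in[OF U, of _ z] W by (intro sum.cong) force+
  finally show ?thesis
    by simp
qed

subsection \<open>Sets inside an affine hyperplane\<close>

text \<open>A functional \<open>a\<close> whose \<open>k\<close>-th coefficient is nonzero may
  replace the \<open>k\<close>-th coordinate. This adapts the normal form to an arbitrary
  hyperplane.\<close>

lemma coordinates_inj:
  fixes a :: "bit ^ 'n::finite"
  assumes "a $ k = 1"
  shows "inj (\<lambda>x. (\<chi> j. bdot (if j = k then a else axis j 1) x + c j) :: bit ^ 'n)"
proof (rule injI)
  fix x y :: "bit ^ 'n"
  assume "(\<chi> j. bdot (if j = k then a else axis j 1) x + c j) =
    ((\<chi> j. bdot (if j = k then a else axis j 1) y + c j) :: bit ^ 'n)"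
  then have eq: "bdot (if j = k then a else axis j 1) x = bdot (if j = k then a else axis j 1) y" for j
    by (simp add: vec_eq_iff)
  have j: "x $ j = y $ j" if "j \<noteq> k" for j
    using eq[of j] that by (simp add: bdot_axis)
  have "0 = bdot a (x + y)"
    using eq[of k] by (simp add: bdot_add_right)
  also have "\<dots> = (\<Sum>i\<in>UNIV. if i = k then x $ k + y $ k else 0)"
    unfolding bdot_def by (rule sum.cong) (use j assms in auto)
  finally have "x $ k = y $ k"
    by simp
  then have "x $ j = y $ j" for j
    using j by (cases "j = k") simp_all
  then show "x = y"
    by (simp add: vec_eq_iff)
qed

lemma even_on_flats_mem_span_flats:
  fixes b :: "'n::finite \<Rightarrow> bit ^ 'n" and k :: "'n \<Rightarrow> bit"
  assumes inj: "inj (\<lambda>x. (\<chi> j. bdot (b j) x + k j) :: bit ^ 'n)"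
    and S: "even_on_flats r S" "S \<subseteq> {x. \<forall>j\<in>I. bdot (b j) x + k j = 1}"
    and K: "vec.subspace K"
    and flats: "\<And>x W. vec.subspace W \<Longrightarrow> 2 ^ Suc r \<le> card W \<Longrightarrow>
      coset x W \<subseteq> {x. \<forall>j\<in>I. bdot (b j) x + k j = 1} \<Longrightarrow> incidence_vector (coset x W) \<in> K"
  shows "incidence_vector S \<in> K"
proof (rule even_on_flats_imp_mem_span[OF inj S K])
  fix J
  assume J: "card J + r < CARD('n)" "I \<subseteq> J"
  let ?F = "{x. \<forall>j\<in>J. bdot (b j) x + k j = 1}"
  have "u + v = 1 \<longleftrightarrow> u = v + 1" for u v :: bit
    by (cases u; cases v) simp_all
  then have eq: "?F = coset 0 UNIV \<inter> {x. \<forall>j\<in>J. bdot (b j) x = k j + 1}"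
    by simp
  have sub: "?F \<subseteq> {x. \<forall>j\<in>I. bdot (b j) x + k j = 1}"
    using J(2) by blast
  consider "?F = {}" | x' W' where "vec.subspace W'" "?F = coset x' W'"
      "card (UNIV :: (bit ^ 'n) set) \<le> card W' * 2 ^ card J"
    using coset_Int_hyperplanes[of J UNIV 0 b "\<lambda>j. k j + 1"] eq by auto
  then show "incidence_vector ?F \<in> K"
  proof cases
    case 1
    then show ?thesis
      using K by (simp only: incidence_vector_empty subspace_bit_iff)
  next
    case 2
    have "2 ^ Suc r * 2 ^ card J \<le> (2 :: nat) ^ CARD('n)"
      unfolding power_add[symmetric] using J(1) by (intro power_increasing) simp_all
    also have "\<dots> \<le> card W' * 2 ^ card J"
      using 2(3) by simp
    finally have "2 ^ Suc r \<le> card W'"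
      by (simp only: mult_le_cancel2) simp
    then show ?thesis
      using flats[of W' x'] 2 sub by (simp only:)
  qed
qed

text \<open>With \<open>a\<close> as one of the coordinates, every surviving monomial contains that
  coordinate, so only flats inside the given affine hyperplane occur.\<close>

lemma even_on_flats_hyperplane_mem_span:
  fixes a :: "bit ^ 'n::finite"
  assumes a: "a \<noteq> 0" and S: "even_on_flats r S" "S \<subseteq> {x. bdot a x = c}"
    and K: "vec.subspace K"
    and flats: "\<And>x W. vec.subspace W \<Longrightarrow> 2 ^ Suc r \<le> card W \<Longrightarrow> coset x W \<subseteq> {x. bdot a x = c} \<Longrightarrow>
      incidence_vector (coset x W) \<in> K"
  shows "incidence_vector S \<in> K"
proof -
  obtain k where k: "a $ k = 1"
    using a by (auto simp: vec_eq_iff)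
  let ?b = "\<lambda>j. if j = k then a else axis j 1"
  \<comment> \<open>The shift by \<open>c + 1\<close> makes the set \<open>bdot a x = c\<close> the
    locus where coordinate \<open>k\<close> equals 1.\<close>
  let ?k = "\<lambda>j. if j = k then c + 1 else 0"
  have "u + (c + 1) = 1 \<longleftrightarrow> u = c" for u
    by (cases c; cases u) simp_all
  then have eq: "{x. \<forall>j\<in>{k}. bdot (?b j) x + ?k j = 1} = {x. bdot a x = c}"
    by simp
  show ?thesis
    by (rule even_on_flats_mem_span_flats[OF coordinates_inj[OF k, of ?k] S(1) _ K, where I = "{k}"], unfold eq)
      (use S(2) flats in auto)
qed

section \<open>Orthogonality of incidence vectors of cosets\<close>

lemma span_self_orthogonal:
  assumes "\<And>x y. x \<in> X \<Longrightarrow> y \<in> X \<Longrightarrow> bdot x y = 0"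
  shows "vec.span X \<subseteq> dual (vec.span X)"
proof -
  have "X \<subseteq> dual X"
    using assms by (auto simp: dual_def)
  then have "vec.span X \<subseteq> dual X"
    by (rule vec.span_minimal[OF _ subspace_dual])
  then have "bdot y x = 0" if "x \<in> X" "y \<in> vec.span X" for x y
    using that by (auto simp: dual_def)
  then have "X \<subseteq> dual (vec.span X)"
    by (auto simp: dual_def bdot_commute)
  then show ?thesis
    by (rule vec.span_minimal[OF _ subspace_dual])
qed

lemma even_card_subspace:
  fixes W :: "(bit ^ 'n::finite) set"
  assumes "vec.subspace W" "W \<noteq> {0}"
  shows "even (card W)"
proof -
  have "card W \<noteq> 1"
    using assms by (auto simp: subspace_bit_iff card_1_singleton_iff)
  then show ?thesis
    using card_subspace[OF assms(1)] by auto
qed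

lemma subspace_Int_bit:
  "vec.subspace A \<Longrightarrow> vec.subspace B \<Longrightarrow> vec.subspace (A \<inter> B)" for A :: "(bit ^ 'n::finite) set"
  by (simp add: subspace_bit_iff)

lemma inj_on_sum_subspaces:
  fixes A B :: "(bit ^ 'n::finite) set"
  assumes A: "vec.subspace A" and B: "vec.subspace B" and "A \<inter> B = {0}"
  shows "inj_on (\<lambda>(x, y). x + y) (A \<times> B)"
proof (rule inj_onI, clarify)
  fix x y x' y'
  assume *: "x \<in> A" "y \<in> B" "x' \<in> A" "y' \<in> B" "x + y = x' + y'"
  have "(x + x') + (y + y') = (x + y) + (x' + y')"
    by (simp only: add_ac)
  also have "\<dots> = 0"
    unfolding *(5) by simp
  finally have eq: "x + x' = y + y'"
    by (simp add: vec_bit_add_eq_0_iff)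
  have "x + x' \<in> A" "y + y' \<in> B"
    using A B * by (simp_all add: subspace_bit_iff)
  then have "x + x' = 0" "y + y' = 0"
    using eq assms(3) by auto
  then show "x = x' \<and> y = y'"
    by (simp add: vec_bit_add_eq_0_iff)
qed

lemma sum_subspaces_in:
  fixes U :: "(bit ^ 'n::finite) set"
  assumes "vec.subspace U" "A \<subseteq> U" "B \<subseteq> U"
  shows "(\<lambda>(x, y). x + y) ` (A \<times> B) \<subseteq> U"
  using assms by (auto simp: subspace_bit_iff)

text \<open>If the intersection were trivial, the sums of elements of \<open>A\<close> and
  \<open>B\<close> would be distinct and too many for \<open>U\<close>; a nontrivial subspace has
  even size.\<close>

lemma even_card_Int_subspaces:
  fixes U :: "(bit ^ 'n::finite) set"
  assumes "vec.subspace A" "vec.subspace B" "vec.subspace U" "A \<subseteq> U" "B \<subseteq> U"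
    and card: "card U < card A * card B"
  shows "even (card (A \<inter> B))"
proof (rule even_card_subspace)
  show "A \<inter> B \<noteq> {0}"
  proof
    assume "A \<inter> B = {0}"
    then have "card ((\<lambda>(x, y). x + y) ` (A \<times> B)) = card (A \<times> B)"
      by (intro card_image inj_on_sum_subspaces assms)
    moreover have "card ((\<lambda>(x, y). x + y) ` (A \<times> B)) \<le> card U"
      by (intro card_mono sum_subspaces_in assms) simp
    ultimately show False
      using card by (simp add: card_cartesian_product)
  qed
qed (use assms in \<open>simp add: subspace_Int_bit\<close>)

lemma coset_Int_coset:
  fixes A B :: "(bit ^ 'n::finite) set"
  assumes "vec.subspace A" "vec.subspace B" "x \<in> coset z A" "x \<in> coset z' B"
  shows "coset z A \<inter> coset z' B = coset x (A \<inter> B)"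
proof -
  have "coset z A = coset x A" "coset z' B = coset x B"
    using assms by (simp_all add: coset_eq_iff)
  then show ?thesis
    by auto
qed

lemma even_card_coset_Int_coset:
  fixes A B :: "(bit ^ 'n::finite) set"
  assumes "vec.subspace A" "vec.subspace B" "even (card (A \<inter> B))"
  shows "even (card (coset z A \<inter> coset z' B))"
proof (cases "coset z A \<inter> coset z' B = {}")
  case False
  then obtain x where x: "x \<in> coset z A" "x \<in> coset z' B"
    by blast
  show ?thesis
    unfolding coset_Int_coset[OF assms(1,2) x] using assms(3) by simp
next
  case True
  then show ?thesis
    by (simp only: card.empty even_zero)
qed

text \<open>\<open>Y\<close> and \<open>w\<close> do not depend on \<open>u\<close>: one splitting
  of \<open>W\<close> serves all its cosets at once.\<close>

lemma subspace_split:
  fixes W :: "(bit ^ 'n::finite) set"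
  assumes W: "vec.subspace W" "card W = 2 ^ Suc k"
  obtains Y w where "vec.subspace Y" "Y \<subseteq> W" "card Y = 2 ^ k" "w \<in> W" "w \<notin> Y"
    "\<And>u. incidence_vector (coset u W) = incidence_vector (coset u Y) + incidence_vector (coset (u + w) Y)"
proof -
  have "card W \<noteq> 1"
    using W by simp
  then have "W \<noteq> {0}"
    by auto
  then obtain v where v: "v \<in> W" "v \<noteq> 0"
    using W(1) by (auto simp: subspace_bit_iff)
  then obtain a where a: "bdot a v = 1"
    using bdot_nondegenerate[of v] by auto
  let ?K = "{w \<in> W. bdot a w = 0}"
  have in_W: "x + y \<in> W \<longleftrightarrow> y \<in> W" if "x \<in> W" for x y
    using W(1) that unfolding subspace_bit_iff by (metis vec_bit_add_left_cancel)
  have "coset u W = coset u ?K \<union> coset (u + v) ?K" for u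
  proof (intro set_eqI)
    fix y
    have eq: "u + v + y = v + (u + y)"
      by (simp add: add_ac)
    show "y \<in> coset u W \<longleftrightarrow> y \<in> coset u ?K \<union> coset (u + v) ?K"
      unfolding Un_iff mem_coset mem_Collect_eq eq using a in_W[OF v(1)] by (cases "bdot a (u + y)") (simp_all add: bdot_add_right[of a v])
  qed
  moreover have "coset u ?K \<inter> coset (u + v) ?K = {}" for u
    using a by (auto simp: bdot_add_right)
  ultimately have "incidence_vector (coset u W) =
      incidence_vector (coset u ?K) + incidence_vector (coset (u + v) ?K)" for u
    by (simp only: incidence_vector_disjoint_Un)
  then show ?thesis
    using that[of ?K v] subspace_kernel[OF W(1)] card_kernel[OF W(1) v(1) a] W(2) v a by auto
qed

lemma coset_subset_coset_imp:
  fixes U :: "(bit ^ 'n::finite) set"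
  assumes "vec.subspace U" "vec.subspace W" "coset x W \<subseteq> coset z U"
  shows "W \<subseteq> U" "x \<in> coset z U"
proof -
  show x: "x \<in> coset z U"
    using assms(3) coset_self[OF assms(2)] by blast
  show "W \<subseteq> U"
  proof
    fix w
    assume "w \<in> W"
    then have "x + w \<in> coset x W"
      by simp
    then have "x + w \<in> coset z U"
      using assms(3) by blast
    then have "(z + x) + (z + (x + w)) \<in> U"
      using x assms(1) unfolding subspace_bit_iff mem_coset by blast
    then show "w \<in> U"
      by (simp add: add.assoc add.left_commute)
  qed
qed

lemma bdot_incidence_vectors: "bdot (incidence_vector S) (incidence_vector T) = 0 \<longleftrightarrow> even (card (S \<inter> T))"
  by (simp add: bdot_eq_0_iff)

lemma bdot_incidence_vector: "bdot x (incidence_vector T) = 0 \<longleftrightarrow> even (card (supp x \<inter> T))"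
  by (simp add: bdot_eq_0_iff)

lemma num_weight_eq: "num_weight C i = card {S. incidence_vector S \<in> C \<and> card S = i}"
proof -
  have "bij_betw supp {x \<in> C. weight x = i} {S. incidence_vector S \<in> C \<and> card S = i}"
    by (rule bij_betw_byWitness[of _ incidence_vector]) (auto simp: weight_eq)
  then show ?thesis
    unfolding num_weight_def by (rule bij_betw_same_card)
qed

lemma num_weight_eq_0I: "(\<And>x. x \<in> C \<Longrightarrow> weight x \<noteq> i) \<Longrightarrow> num_weight C i = 0"
  unfolding num_weight_def by (simp add: card_eq_0_iff)

lemma even_on_flats_3_cases:
  assumes "even_on_flats 3 S"
  shows "S = {} \<or> (16 \<le> card S \<and> card S \<noteq> 20)"
  using even_on_flats_min_card[OF assms] even_on_flats_3_card_neq_20[OF assms] by auto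

subsection \<open>The weights of \<open>R(3,7)\<close>\<close>

text \<open>In dimension 7, evenness on flats of codimension 3 is orthogonality to the 4-dimensional
  flats, which themselves lie in the code. They are mutually orthogonal because
  \<open>16 * 16 > 128\<close>, and they are exactly the words of weight 16.\<close>

lemma reed_muller_3_7:
  assumes "CARD('n::finite) = 7"
  defines "R \<equiv> reed_muller 3 :: (bit ^ (bit ^ 'n)) set"
  shows "dual R = R" and "\<And>x. x \<in> R \<Longrightarrow> 4 dvd weight x"
    and "\<And>i. 0 < i \<Longrightarrow> i < 16 \<Longrightarrow> num_weight R i = 0"
    and "num_weight R 16 = 94488" and "num_weight R 20 = 0"
proof -
  have R: "R = {f. even_on_flats 3 (supp f)}"
    unfolding R_def by (rule reed_muller_eq) (simp add: assms)
  have subR: "vec.subspace R"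
    unfolding R by (rule supp_subspace_even_on_flats)
  \<comment> \<open>Flats replace the monomials as generators, because their intersections and
    weights are directly accessible.\<close>
  define X where "X = {incidence_vector (coset x W) | x W :: (bit ^ 'n) set. vec.subspace W \<and> 16 \<le> card W}"
  have coset_R: "incidence_vector (coset x W) \<in> R" if "vec.subspace W" "16 \<le> card W"
    for x and W :: "(bit ^ 'n) set"
    using even_on_flats_coset[of W 3 x] subspace_card_dvd[of W 4] that by (simp add: R)
  have "f \<in> vec.span X" if "f \<in> R" for f
  proof -
    have "incidence_vector (supp f) \<in> vec.span X"
    proof (rule even_on_flats_mem_span_flats[of "\<lambda>i. axis i 1" "\<lambda>i. 0" 3 _ "{}"])
      show "inj (\<lambda>x. (\<chi> j. bdot (axis j 1) x + 0) :: bit ^ 'n)"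
        by (simp add: bdot_axis)
      fix x and W :: "(bit ^ 'n) set"
      assume "vec.subspace W" "2 ^ Suc 3 \<le> card W"
      then show "incidence_vector (coset x W) \<in> vec.span X"
        by (intro vec.span_base) (auto simp: X_def)
    qed (use that in \<open>simp_all add: R\<close>)
    then show ?thesis
      by simp
  qed
  moreover have "X \<subseteq> R"
    using coset_R by (auto simp: X_def)
  ultimately have R_span: "R = vec.span X"
    using vec.span_minimal[OF _ subR, of X] by blast
  have orth: "bdot x y = 0" if "x \<in> X" "y \<in> X" for x y
  proof -
    obtain u v A B where *: "x = incidence_vector (coset u A)" "y = incidence_vector (coset v B)"
      "vec.subspace A" "vec.subspace B" "16 \<le> card A" "16 \<le> card B"
      using \<open>x \<in> X\<close> \<open>y \<in> X\<close> unfolding X_def by blast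
    have "16 * 16 \<le> card A * card B"
      using *(5,6) by (rule mult_le_mono)
    then have "even (card (A \<inter> B))"
      using *(3,4) by (intro even_card_Int_subspaces[where U = UNIV]) (simp_all add: assms)
    then show ?thesis
      unfolding *(1,2) bdot_incidence_vectors by (rule even_card_coset_Int_coset[OF *(3,4)])
  qed
  show "dual R = R"
  proof
    show "R \<subseteq> dual R"
      unfolding R_span by (rule span_self_orthogonal[OF orth])
    show "dual R \<subseteq> R"
    proof
      fix f
      assume "f \<in> dual R"
      then have "even (card (supp f \<inter> coset x W))" if "vec.subspace W" "card W = 2 ^ 4" for x W
        using coset_R[of W x] that by (auto simp: dual_def bdot_incidence_vector)
      then have "even_on_flats 3 (supp f \<inter> coset 0 UNIV)"
        by (intro even_on_flats_Int_coset[of 4 UNIV _ UNIV 7]) (simp_all add: assms)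
      then show "f \<in> R"
        by (simp add: R)
    qed
  qed
  show "4 dvd weight x" if "x \<in> R" for x
  proof (rule doubly_even_span[OF _ orth])
    show "x \<in> vec.span X"
      using that R_span by simp
    fix y
    assume "y \<in> X"
    then obtain u A where "y = incidence_vector (coset u A)" "vec.subspace A" "16 \<le> card A"
      unfolding X_def by blast
    then show "4 dvd weight y"
      using subspace_card_dvd[of A 2] by simp
  qed
  show "num_weight R i = 0" if "0 < i" "i < 16" for i
    by (rule num_weight_eq_0I) (use even_on_flats_3_cases that in \<open>force simp: R weight_eq\<close>)
  show "num_weight R 20 = 0"
    by (rule num_weight_eq_0I) (use even_on_flats_3_cases in \<open>force simp: R weight_eq\<close>)
  let ?\<W> = "subspaces_between {0} UNIV 4 :: (bit ^ 'n) set set"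
  have "{S. incidence_vector S \<in> R \<and> card S = 16} = (\<Union>W\<in>?\<W>. flats_in 0 UNIV W)"
  proof (intro set_eqI iffI)
    fix S :: "(bit ^ 'n) set"
    assume "S \<in> {S. incidence_vector S \<in> R \<and> card S = 16}"
    then have S: "even_on_flats (Suc 2) S" "card S = 2 ^ Suc (Suc 2)"
      by (simp_all add: R del: even_on_flats.simps)
    obtain x W where W: "vec.subspace W" "S = coset x W"
      using even_on_flats_min_card_imp_coset[OF S] .
    then have "W \<in> ?\<W>"
      using S(2) by (simp add: subspaces_between_def subspace_bit_iff)
    then show "S \<in> (\<Union>W\<in>?\<W>. flats_in 0 UNIV W)"
      unfolding W(2) flats_in_def by auto
  next
    fix S :: "(bit ^ 'n) set"
    assume "S \<in> (\<Union>W\<in>?\<W>. flats_in 0 UNIV W)"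
    then show "S \<in> {S. incidence_vector S \<in> R \<and> card S = 16}"
      using coset_R by (auto simp: flats_in_def subspaces_between_def)
  qed
  moreover have "16 * card (\<Union>W\<in>?\<W>. flats_in 0 UNIV W) = card ?\<W> * card (UNIV :: (bit ^ 'n) set)"
    by (rule card_UN_flats_in) (auto simp: subspaces_between_def)
  \<comment> \<open>The Gaussian binomial coefficient of 7 over 4; each of these subspaces has 8
    cosets.\<close>
  moreover have "card ?\<W> = 11811"
    using card_subspaces_between[of "UNIV :: (bit ^ 'n) set" 7 "{0}" 0 4]
    by (simp add: assms num_subspaces_numeral)
  ultimately show "num_weight R 16 = 94488"
    unfolding num_weight_eq by (simp add: assms)
qed

subsection \<open>The code of a polarity design\<close>

text \<open>Projective planes and solids of the hyperplane appear as vector subspaces of dimension 3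
  and 4, and \<open>\<rho>\<close> is the polarity acting on planes. Each block contains 0, the
  place of the parity coordinate, and so has 16 elements.\<close>

locale polarity_code =
  fixes a :: "bit ^ 'n::finite" and U planes solids and \<rho> :: "(bit ^ 'n) set \<Rightarrow> (bit ^ 'n) set"
    and blocks K
  assumes dim: "CARD('n) = 7" and a: "a \<noteq> 0"
  defines "U \<equiv> {x. bdot a x = 0}"
    and "planes \<equiv> subspaces_between {0} U 3"
    and "solids \<equiv> subspaces_between {0} U 4"
  assumes \<rho>: "\<And>Y. Y \<in> planes \<Longrightarrow> \<rho> Y \<in> planes" "\<And>Y. Y \<in> planes \<Longrightarrow> \<rho> (\<rho> Y) = Y"
    and card_\<rho>_Int: "\<And>Y Y'. Y \<in> planes \<Longrightarrow> Y' \<in> planes \<Longrightarrow> card (\<rho> Y \<inter> \<rho> Y') = card (Y \<inter> Y')"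
  defines "blocks \<equiv> solids \<union> {coset z Y \<union> \<rho> Y | z Y. z \<notin> U \<and> Y \<in> planes}"
    and "K \<equiv> vec.span (incidence_vector ` blocks)"
begin

lemma U_subspace: "vec.subspace U"
  by (auto simp: U_def subspace_bit_iff bdot_add_right)

lemma zero_in_U: "0 \<in> U"
  by (simp add: U_def)

lemma card_U: "card U = 64"
proof -
  obtain v where "bdot v a \<noteq> 0"
    using a bdot_nondegenerate[of a] by blast
  then have "bdot a v = 1"
    by (simp add: bdot_commute)
  then show ?thesis
    using card_kernel[of UNIV v a] by (simp add: U_def dim)
qed

lemma sum_in_U_iff: "x + y \<in> U \<longleftrightarrow> (x \<in> U \<longleftrightarrow> y \<in> U)"
  unfolding U_def by (cases "bdot a x"; cases "bdot a y") (simp_all add: bdot_add_right)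

lemma coset_U: "coset z U = {x. bdot a x = bdot a z}"
  unfolding U_def by (auto simp: bdot_add_right)

lemma mem_coset_U: "x \<in> coset z U \<longleftrightarrow> (z \<in> U \<longleftrightarrow> x \<in> U)"
  by (simp add: sum_in_U_iff)

lemma planesD: "Y \<in> planes \<Longrightarrow> vec.subspace Y" "Y \<in> planes \<Longrightarrow> Y \<subseteq> U" "Y \<in> planes \<Longrightarrow> card Y = 8"
  by (simp_all add: planes_def subspaces_between_def)

lemma solidsD: "W \<in> solids \<Longrightarrow> vec.subspace W" "W \<in> solids \<Longrightarrow> W \<subseteq> U" "W \<in> solids \<Longrightarrow> card W = 16"
  by (simp_all add: solids_def subspaces_between_def)

lemma planesI: "vec.subspace Y \<Longrightarrow> Y \<subseteq> U \<Longrightarrow> card Y = 8 \<Longrightarrow> Y \<in> planes"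
  by (simp add: planes_def subspaces_between_def subspace_bit_iff)

lemma solidsI: "vec.subspace Y \<Longrightarrow> Y \<subseteq> U \<Longrightarrow> card Y = 16 \<Longrightarrow> Y \<in> solids"
  by (simp add: solids_def subspaces_between_def subspace_bit_iff)

lemma coset_U_if: "coset z U = (if z \<in> U then U else - U)"
  by (auto simp: sum_in_U_iff)

lemma ex_not_in_U: "\<exists>z. z \<notin> U"
proof (rule ccontr)
  assume "\<not> ?thesis"
  then have "U = UNIV"
    by auto
  then show False
    using card_U by (simp add: dim)
qed

lemma coset_subset_coset_U: "W \<subseteq> U \<Longrightarrow> x \<in> coset z U \<Longrightarrow> coset x W \<subseteq> coset z U"
proof
  fix y
  assume "W \<subseteq> U" "x \<in> coset z U" "y \<in> coset x W"
  then have "x + y \<in> U" "z + x \<in> U"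
    by auto
  then show "y \<in> coset z U"
    by (simp add: sum_in_U_iff)
qed

lemma coset_Int_U: "W \<subseteq> U \<Longrightarrow> z \<notin> U \<Longrightarrow> coset z W \<inter> U = {}"
  using coset_subset_coset_U[of W z z] by (auto simp: mem_coset_U sum_in_U_iff)

lemma coset_subset_U: "W \<subseteq> U \<Longrightarrow> z \<in> U \<Longrightarrow> coset z W \<subseteq> U"
  using coset_subset_coset_U[of W z 0] by (simp add: zero_in_U)

section \<open>Cosets and pairs of cosets contained in the code\<close>

lemma K_subspace: "vec.subspace K"
  by (simp add: K_def)

lemma K_add: "x \<in> K \<Longrightarrow> y \<in> K \<Longrightarrow> x + y \<in> K"
  using K_subspace by (simp add: subspace_bit_iff)

lemma blocks_in_K: "B \<in> blocks \<Longrightarrow> incidence_vector B \<in> K"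
  unfolding K_def by (intro vec.span_base) simp

lemma solid_in_K: "W \<in> solids \<Longrightarrow> incidence_vector W \<in> K"
  by (intro blocks_in_K) (simp add: blocks_def)

lemma plane_pair_disjoint:
  "z \<notin> U \<Longrightarrow> Y \<in> planes \<Longrightarrow> B \<subseteq> U \<Longrightarrow>
    incidence_vector (coset z Y \<union> B) = incidence_vector (coset z Y) + incidence_vector B"
  using coset_Int_U[of Y z] planesD(2)[of Y] by (intro incidence_vector_disjoint_Un) blast

lemma plane_pair_0_in_K:
  assumes "z \<notin> U" "Y \<in> planes"
  shows "incidence_vector (coset z Y) + incidence_vector (\<rho> Y) \<in> K"
proof -
  have "coset z Y \<union> \<rho> Y \<in> blocks"
    using assms unfolding blocks_def by blast
  then show ?thesis
    using blocks_in_K plane_pair_disjoint[OF assms planesD(2)[OF \<rho>(1)[OF assms(2)]]] by metis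
qed

lemma plane_insert:
  assumes "Y \<in> planes" "u \<in> U" "u \<notin> Y"
  shows "Y \<union> coset u Y \<in> solids"
    and "incidence_vector (Y \<union> coset u Y) = incidence_vector Y + incidence_vector (coset u Y)"
proof -
  note Y = planesD[OF assms(1)]
  show "Y \<union> coset u Y \<in> solids"
    using subspace_insert[OF Y(1)] card_insert_subspace[OF Y(1) assms(3)] Y coset_subset_U[OF Y(2) assms(2)]
    by (intro solidsI) simp_all
  show "incidence_vector (Y \<union> coset u Y) = incidence_vector Y + incidence_vector (coset u Y)"
    using coset_disjoint[OF Y(1), of 0 u] assms(3) by (intro incidence_vector_disjoint_Un) simp
qed

text \<open>For \<open>u \<notin> Y\<close> the two translates form the solid spanned by
  \<open>Y\<close> and \<open>u\<close>. So modulo \<open>K\<close> a plane may be moved freely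
  within \<open>U\<close>.\<close>

lemma plane_translate_in_K:
  assumes "Y \<in> planes" "u \<in> U"
  shows "incidence_vector Y + incidence_vector (coset u Y) \<in> K"
proof (cases "u \<in> Y")
  case True
  then have "coset u Y = Y"
    using coset_eq_iff[OF planesD(1)[OF assms(1)], of u 0] by simp
  then show ?thesis
    using K_subspace by (simp add: subspace_bit_iff)
next
  case False
  then show ?thesis
    using plane_insert[OF assms False] solid_in_K by metis
qed

lemma plane_pair_in_K:
  assumes "z \<notin> U" "u \<in> U" "Y \<in> planes"
  shows "incidence_vector (coset z Y) + incidence_vector (coset u (\<rho> Y)) \<in> K"
proof -
  have "(incidence_vector (coset z Y) + incidence_vector (\<rho> Y)) +
      (incidence_vector (\<rho> Y) + incidence_vector (coset u (\<rho> Y))) \<in> K"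
    using assms \<rho> by (intro K_add plane_pair_0_in_K plane_translate_in_K)
  then show ?thesis
    by (simp add: add.assoc)
qed

text \<open>The generators contain only the solids themselves. A coset is split into two translates
  of a plane \<open>Y\<close>: inside \<open>U\<close> both are congruent to \<open>Y\<close> modulo
  \<open>K\<close>, outside \<open>U\<close> two plane pairs are added and their common part
  \<open>\<rho> Y\<close> cancels.\<close>

lemma solid_coset_in_K:
  assumes "W \<in> solids"
  shows "incidence_vector (coset x W) \<in> K"
proof -
  note W = solidsD[OF assms]
  obtain Y w where Y: "vec.subspace Y" "Y \<subseteq> W" "card Y = 2 ^ 3" "w \<in> W" "w \<notin> Y"
    and eq: "\<And>u. incidence_vector (coset u W) = incidence_vector (coset u Y) + incidence_vector (coset (u + w) Y)"
    using subspace_split[OF W(1), of 3] W(3) by auto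
  have "Y \<in> planes" "w \<in> U"
    using Y W by (auto intro: planesI)
  show ?thesis
  proof (cases "x \<in> U")
    case True
    then have "x + w \<in> U"
      using \<open>w \<in> U\<close> by (simp add: sum_in_U_iff)
    then have "(incidence_vector Y + incidence_vector (coset x Y)) +
        (incidence_vector Y + incidence_vector (coset (x + w) Y)) \<in> K"
      using True \<open>Y \<in> planes\<close> by (intro K_add plane_translate_in_K)
    then show ?thesis
      unfolding eq by (simp add: add.assoc add.left_commute)
  next
    case False
    then have "x + w \<notin> U"
      using \<open>w \<in> U\<close> by (simp add: sum_in_U_iff)
    then have "(incidence_vector (coset x Y) + incidence_vector (\<rho> Y)) +
        (incidence_vector (coset (x + w) Y) + incidence_vector (\<rho> Y)) \<in> K"
      using False \<open>Y \<in> planes\<close> by (intro K_add plane_pair_0_in_K)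
    moreover have "(p + r) + (q + r) = p + q" for p q r :: "bit ^ (bit ^ 'n)"
      by (simp add: add.assoc add.left_commute)
    ultimately show ?thesis
      unfolding eq by metis
  qed
qed

lemma big_coset_in_K:
  "vec.subspace W \<Longrightarrow> W \<subseteq> U \<Longrightarrow> card W = 2 ^ (4 + j) \<Longrightarrow> incidence_vector (coset x W) \<in> K"
proof (induction j arbitrary: W x)
  case 0
  then show ?case
    by (intro solid_coset_in_K solidsI) simp_all
next
  case (Suc j)
  then have "card W = 2 ^ Suc (4 + j)"
    by simp
  then obtain Y w where Y: "vec.subspace Y" "Y \<subseteq> W" "card Y = 2 ^ (4 + j)" "w \<in> W" "w \<notin> Y"
    and eq: "\<And>u. incidence_vector (coset u W) = incidence_vector (coset u Y) + incidence_vector (coset (u + w) Y)"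
    using subspace_split[OF Suc.prems(1)] by blast
  show ?case
    unfolding eq using Suc.IH[OF Y(1) _ Y(3)] Y(2) Suc.prems(2) by (intro K_add) auto
qed

lemma coset_ge_16_in_K:
  assumes "vec.subspace W" "W \<subseteq> U" "16 \<le> card W"
  shows "incidence_vector (coset x W) \<in> K"
proof -
  have "(2 :: nat) ^ 4 \<le> 2 ^ vec.dim W"
    using assms by (simp add: card_subspace)
  then have "4 \<le> vec.dim W"
    by (subst (asm) power_increasing_iff) simp_all
  then obtain j where "vec.dim W = 4 + j"
    using le_Suc_ex by blast
  then show ?thesis
    using big_coset_in_K[OF assms(1,2)] card_subspace[OF assms(1)] by simp
qed

text \<open>A solid meets every solid and every plane of the six-dimensional \<open>U\<close>
  nontrivially. For two blocks of the second kind the intersections inside and outside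
  \<open>U\<close> are both even if \<open>Y \<inter> Y' \<noteq> {0}\<close>, and both are single
  points otherwise.\<close>

lemma even_card_block_Int:
  assumes "S \<in> blocks" "T \<in> blocks"
  shows "even (card (S \<inter> T))"
proof -
  have solid_solid: "even (card (W \<inter> W'))" if "W \<in> solids" "W' \<in> solids" for W W'
    using solidsD[OF that(1)] solidsD[OF that(2)]
    by (intro even_card_Int_subspaces[OF _ _ U_subspace]) (simp_all add: card_U)
  have solid_plane: "even (card (W \<inter> (coset z Y \<union> \<rho> Y)))" if "W \<in> solids" "z \<notin> U" "Y \<in> planes" for W z Y
  proof -
    have "W \<inter> (coset z Y \<union> \<rho> Y) = W \<inter> \<rho> Y"
      using coset_Int_U[OF planesD(2)[OF that(3)] that(2)] solidsD(2)[OF that(1)] by blast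
    moreover have "even (card (W \<inter> \<rho> Y))"
      using solidsD[OF that(1)] planesD[OF \<rho>(1)[OF that(3)]]
      by (intro even_card_Int_subspaces[OF _ _ U_subspace]) (simp_all add: card_U)
    ultimately show ?thesis
      by (simp only:)
  qed
  have plane_plane: "even (card ((coset z Y \<union> \<rho> Y) \<inter> (coset z' Y' \<union> \<rho> Y')))"
    if "z \<notin> U" "Y \<in> planes" "z' \<notin> U" "Y' \<in> planes" for z z' Y Y'
  proof -
    note Y = planesD[OF that(2)] and Y' = planesD[OF that(4)]
    have "(coset z Y \<union> \<rho> Y) \<inter> (coset z' Y' \<union> \<rho> Y') = (coset z Y \<inter> coset z' Y') \<union> (\<rho> Y \<inter> \<rho> Y')"
      using coset_Int_U[OF Y(2) that(1)] coset_Int_U[OF Y'(2) that(3)]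
        planesD(2)[OF \<rho>(1)[OF that(2)]] planesD(2)[OF \<rho>(1)[OF that(4)]] by blast
    moreover have "card ((coset z Y \<inter> coset z' Y') \<union> (\<rho> Y \<inter> \<rho> Y')) =
        card (coset z Y \<inter> coset z' Y') + card (\<rho> Y \<inter> \<rho> Y')"
      using coset_Int_U[OF Y(2) that(1)] planesD(2)[OF \<rho>(1)[OF that(2)]]
      by (intro card_Un_disjoint) auto
    moreover have "even (card (coset z Y \<inter> coset z' Y') + card (Y \<inter> Y'))"
    proof (cases "Y \<inter> Y' = {0}")
      case False
      then have "even (card (Y \<inter> Y'))"
        using Y Y' by (intro even_card_subspace) (simp_all add: subspace_Int_bit)
      then show ?thesis
        using even_card_coset_Int_coset[OF Y(1) Y'(1)] by simp
    next
      case True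
      have "(\<lambda>(x, y). x + y) ` (Y \<times> Y') = U"
      proof (rule card_subset_eq)
        show "(\<lambda>(x, y). x + y) ` (Y \<times> Y') \<subseteq> U"
          by (rule sum_subspaces_in[OF U_subspace Y(2) Y'(2)])
        show "card ((\<lambda>(x, y). x + y) ` (Y \<times> Y')) = card U"
          using card_image[OF inj_on_sum_subspaces[OF Y(1) Y'(1) True]] Y(3) Y'(3)
          by (simp add: card_cartesian_product card_U)
      qed simp
      moreover have "z + z' \<in> U"
        using that by (simp add: sum_in_U_iff)
      ultimately obtain y y' where "y \<in> Y" "y' \<in> Y'" "z + z' = y + y'"
        by auto
      moreover have "z' + (z + y) = y'" if "z + z' = y + y'" for y y'
      proof -
        have "z' + (z + y) = (z + z') + y"
          by (simp add: add_ac)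
        also have "\<dots> = (y + y') + y"
          by (simp only: that)
        also have "\<dots> = (y' + y) + y"
          by (simp only: add.commute[of y y'])
        also have "\<dots> = y'"
          by (simp add: add.assoc)
        finally show ?thesis .
      qed
      ultimately have "z + y \<in> coset z Y" "z + y \<in> coset z' Y'"
        by simp_all
      from coset_Int_coset[OF Y(1) Y'(1) this] show ?thesis
        unfolding True by simp
    qed
    ultimately show ?thesis
      using card_\<rho>_Int[OF that(2,4)] by simp
  qed
  show ?thesis
    using assms solid_solid solid_plane plane_plane unfolding blocks_def
    by (auto simp: Int_commute)
qed

lemma card_plane_pair:
  assumes "z \<notin> U" "Y \<in> planes"
  shows "card (coset z Y \<union> \<rho> Y) = 16"
proof -
  have "coset z Y \<inter> \<rho> Y = {}"
    using coset_Int_U[OF planesD(2)[OF assms(2)] assms(1)] planesD(2)[OF \<rho>(1)[OF assms(2)]] by blast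
  then have "card (coset z Y \<union> \<rho> Y) = card (coset z Y) + card (\<rho> Y)"
    by (intro card_Un_disjoint) simp_all
  then show ?thesis
    using planesD(3)[OF assms(2)] planesD(3)[OF \<rho>(1)[OF assms(2)]] by simp
qed

lemma card_block: "B \<in> blocks \<Longrightarrow> card B = 16"
  unfolding blocks_def using solidsD(3) card_plane_pair by blast

lemma K_orthogonal: "K \<subseteq> dual K"
  unfolding K_def
  by (rule span_self_orthogonal) (use even_card_block_Int in \<open>auto simp: bdot_incidence_vectors\<close>)

lemma K_doubly_even: "x \<in> K \<Longrightarrow> 4 dvd weight x"
  unfolding K_def
  by (rule doubly_even_span[of "incidence_vector ` blocks"])
    (use even_card_block_Int card_block in \<open>auto simp: bdot_incidence_vectors\<close>)

text \<open>\<open>K\<close> contains all cosets of solids, which have codimension 2 in a coset of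
  \<open>U\<close>. Codimension 3 is out of reach here: half of a block may be a plane coset with
  only 8 points.\<close>

lemma even_on_flats_2_half:
  assumes "x \<in> dual K"
  shows "even_on_flats 2 (supp x \<inter> coset z U)"
proof (rule even_on_flats_Int_coset[of 4 "coset z U" _ U 6])
  fix y W
  assume W: "vec.subspace W" "card W = 2 ^ 4" "coset y W \<subseteq> coset z U"
  then have "incidence_vector (coset y W) \<in> K"
    using coset_subset_coset_imp(1)[OF U_subspace W(1,3)] by (intro solid_coset_in_K solidsI) simp_all
  then show "even (card (supp x \<inter> coset y W))"
    using assms by (auto simp: dual_def bdot_incidence_vector)
qed (simp_all add: U_subspace card_U)

text \<open>A plane pair has one part in each half, and a word supported in one half does not see
  the other part. So it is orthogonal to single plane cosets, which gains one codimension.\<close>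

lemma even_on_flats_3_half:
  assumes "x \<in> dual K" "supp x \<subseteq> coset z U"
  shows "even_on_flats 3 (supp x)"
proof -
  have "even_on_flats 3 (supp x \<inter> coset z U)"
  proof (rule even_on_flats_Int_coset[of 3 "coset z U" _ U 6])
    fix y Y
    assume Y: "vec.subspace Y" "card Y = 2 ^ 3" "coset y Y \<subseteq> coset z U"
    have "Y \<subseteq> U" and y: "y \<in> coset z U"
      using coset_subset_coset_imp[OF U_subspace Y(1,3)] by simp_all
    then have plane: "Y \<in> planes"
      using Y by (intro planesI) simp_all
    obtain T where T: "incidence_vector (coset y Y) + incidence_vector T \<in> K" "T \<inter> coset z U = {}"
    proof (cases "z \<in> U")
      case False
      then have "y \<notin> U"
        using y by (simp only: mem_coset_U) simp
      moreover have "\<rho> Y \<inter> coset z U = {}"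
        using planesD(2)[OF \<rho>(1)[OF plane]] False by (auto simp only: coset_U_if if_False)
      ultimately show ?thesis
        using that[OF plane_pair_0_in_K[OF _ plane]] by simp
    next
      case True
      then have "y \<in> U"
        using y by (simp only: mem_coset_U)
      obtain z' where z': "z' \<notin> U"
        using ex_not_in_U by blast
      \<comment> \<open>Inside \<open>U\<close> the roles are exchanged: as
        \<open>\<rho> (\<rho> Y) = Y\<close>, the coset of \<open>Y\<close> is the inner part of a
        pair whose outer part is a coset of \<open>\<rho> Y\<close>.\<close>
      have "incidence_vector (coset z' (\<rho> Y)) + incidence_vector (coset y Y) \<in> K"
        using plane_pair_in_K[OF z' \<open>y \<in> U\<close> \<rho>(1)[OF plane]] \<rho>(2)[OF plane] by simp
      moreover have "coset z' (\<rho> Y) \<inter> coset z U = {}"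
        using coset_Int_U[OF planesD(2)[OF \<rho>(1)[OF plane]] z'] True by (simp only: coset_U_if if_True)
      ultimately show ?thesis
        using that[of "coset z' (\<rho> Y)"] by (simp only: add.commute)
    qed
    have "bdot x (incidence_vector (coset y Y)) + bdot x (incidence_vector T) = 0"
      using assms(1) T(1) by (simp add: dual_def flip: bdot_add_right)
    moreover have "bdot x (incidence_vector T) = 0"
    proof -
      have "supp x \<inter> T = {}"
        using assms(2) T(2) by blast
      then show ?thesis
        by (simp add: bdot_incidence_vector)
    qed
    ultimately show "even (card (supp x \<inter> coset y Y))"
      by (simp add: bdot_incidence_vector)
  qed (simp_all add: U_subspace card_U)
  moreover have "supp x \<inter> coset z U = supp x"
    using assms(2) by blast
  ultimately show ?thesis
    by simp
qed

text \<open>A dual word is cleared outside \<open>U\<close> by expanding its outer part into flats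
  of at least 8 points, each of which a subset of \<open>U\<close> completes to a word of
  \<open>K\<close>. The remaining dual word lies in \<open>U\<close>, is even on flats of
  codimension 3, and expands into flats of at least 16 points, all in \<open>K\<close>.\<close>

lemma dual_K_subset: "dual K \<subseteq> K"
proof
  fix x
  assume x: "x \<in> dual K"
  obtain z where z: "z \<notin> U"
    using ex_not_in_U by blast
  let ?S1 = "supp x \<inter> coset z U"
  \<comment> \<open>The words that a subset of \<open>U\<close> completes to a word of
    \<open>K\<close>; being a subspace, this can receive the whole expansion of
    \<open>?S1\<close>.\<close>
  let ?K' = "{f. \<exists>R \<subseteq> U. f + incidence_vector R \<in> K}"
  have "incidence_vector ?S1 \<in> ?K'"
  proof (rule even_on_flats_hyperplane_mem_span[OF a even_on_flats_2_half[OF x, of z]])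
    show "?S1 \<subseteq> {y. bdot a y = bdot a z}"
      by (auto simp only: coset_U)
    show "vec.subspace ?K'"
      unfolding subspace_bit_iff
    proof (intro conjI ballI)
      have "incidence_vector {} \<in> K"
        using K_subspace by (simp add: subspace_bit_iff)
      then show "0 \<in> ?K'"
        by (intro CollectI exI[of _ "{}"]) simp
      fix f g
      assume "f \<in> ?K'" "g \<in> ?K'"
      then obtain R R' where *: "R \<subseteq> U" "R' \<subseteq> U"
        "f + incidence_vector R \<in> K" "g + incidence_vector R' \<in> K"
        by auto
      have "(f + incidence_vector R) + (g + incidence_vector R') \<in> K"
        using *(3,4) by (rule K_add)
      then have "(f + g) + incidence_vector (sym_diff R R') \<in> K"
        unfolding incidence_vector_sym_diff by (simp add: add_ac)
      moreover have "sym_diff R R' \<subseteq> U"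
        using * by blast
      ultimately show "f + g \<in> ?K'"
        by blast
    qed
    fix y W
    assume W: "vec.subspace W" "2 ^ Suc 2 \<le> card W" "coset y W \<subseteq> {x. bdot a x = bdot a z}"
    then have sub: "W \<subseteq> U" and y: "y \<in> coset z U"
      using coset_subset_coset_imp[OF U_subspace W(1), of y z] by (simp_all only: coset_U)
    have "y \<notin> U"
      using y z by (simp only: mem_coset_U) simp
    show "incidence_vector (coset y W) \<in> ?K'"
    proof (cases "card W = 8")
      case True
      then have plane: "W \<in> planes"
        using W sub by (intro planesI)
      then show ?thesis
        using plane_pair_0_in_K[OF \<open>y \<notin> U\<close> plane] planesD(2)[OF \<rho>(1)[OF plane]] by blast
    next
      case False
      have "2 ^ 3 \<le> (2 :: nat) ^ vec.dim W"
        using W card_subspace[OF W(1)] by simp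
      then have "3 \<le> vec.dim W"
        by (subst (asm) power_increasing_iff) simp_all
      moreover have "vec.dim W \<noteq> 3"
        using False card_subspace[OF W(1)] by auto
      ultimately have "4 \<le> vec.dim W"
        by simp
      then have "2 ^ 4 \<le> card W"
        unfolding card_subspace[OF W(1)] by (intro power_increasing) simp_all
      then have "incidence_vector (coset y W) + incidence_vector {} \<in> K"
        using coset_ge_16_in_K[OF W(1) sub] by simp
      then show ?thesis
        by blast
    qed
  qed
  then obtain R where R: "R \<subseteq> U" "incidence_vector ?S1 + incidence_vector R \<in> K"
    by blast
  let ?c = "incidence_vector ?S1 + incidence_vector R"
  let ?y = "x + ?c"
  have y: "?y \<in> dual K"
    using x R(2) K_orthogonal subspace_dual[of K] unfolding subspace_bit_iff by blast
  have "supp ?y \<subseteq> U"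
  proof -
    have "v \<in> ?S1" if "v \<in> supp x" "v \<notin> U" for v
      using that z by (simp add: sum_in_U_iff)
    then show ?thesis
      unfolding supp_add supp_incidence_vector using R(1) z by (auto simp: sum_in_U_iff)
  qed
  then have "even_on_flats 3 (supp ?y)"
    by (intro even_on_flats_3_half[OF y, of 0]) simp
  then have "incidence_vector (supp ?y) \<in> K"
  proof (rule even_on_flats_hyperplane_mem_span[OF a])
    show "supp ?y \<subseteq> {v. bdot a v = 0}"
      using \<open>supp ?y \<subseteq> U\<close> by (simp add: U_def)
    fix v W
    assume W: "vec.subspace W" "2 ^ Suc 3 \<le> card W" "coset v W \<subseteq> {x. bdot a x = 0}"
    then have "W \<subseteq> U"
      using coset_subset_coset_imp(1)[OF U_subspace W(1), of v 0] by (simp add: U_def)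
    then show "incidence_vector (coset v W) \<in> K"
      using W by (intro coset_ge_16_in_K) simp_all
  qed (rule K_subspace)
  then have "?y \<in> K"
    by (simp only: incidence_vector_supp)
  then have "?y + ?c \<in> K"
    using R(2) by (rule K_add)
  moreover have "?y + ?c = x"
    by (simp only: add.assoc vec_bit_add_self add_0_right)
  ultimately show "x \<in> K"
    by (simp only:)
qed

lemma dual_K: "dual K = K"
  using dual_K_subset K_orthogonal by blast

section \<open>Codewords of weight at most 20\<close>

lemma half_in_K_cases:
  assumes "incidence_vector S \<in> K" "S \<subseteq> coset z U"
  shows "S = {} \<or> (16 \<le> card S \<and> card S \<noteq> 20)"
  using even_on_flats_3_cases[of S] even_on_flats_3_half[of "incidence_vector S" z] assms K_orthogonal
  by auto

lemma card_8_half: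
  assumes "even_on_flats 2 S" "card S = 8" "S \<subseteq> coset z U"
  obtains x Y where "Y \<in> planes" "S = coset x Y" "x \<in> coset z U"
proof -
  have S: "even_on_flats (Suc 1) S"
    using assms(1) by (simp only: Suc_1)
  have card: "card S = 2 ^ Suc (Suc 1)"
    using assms(2) by simp
  obtain x Y where Y: "vec.subspace Y" "S = coset x Y"
    using even_on_flats_min_card_imp_coset[OF S card] .
  then have "Y \<subseteq> U" "x \<in> coset z U"
    using coset_subset_coset_imp[OF U_subspace Y(1)] assms(3) by blast+
  moreover have "card Y = 8"
    using Y(2) assms(2) by simp
  ultimately show ?thesis
    using that Y planesI by blast
qed

text \<open>Adding to \<open>T\<close> the translates of a plane inside the same half keeps it in \<open>K\<close>; the resulting
  weights \<open>card T + 8 - 2 k\<close> cannot be small, which determines the intersection sizes \<open>k\<close>.\<close>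

lemma translates_in_K:
  assumes Y: "Y \<in> planes" and T: "T \<subseteq> coset z U" "card T = 8 \<or> card T = 12"
    and K: "\<And>x. x \<in> coset z U \<Longrightarrow> incidence_vector T + incidence_vector (coset x Y) \<in> K"
  shows "card T = 8" and "x \<in> T \<Longrightarrow> T = coset x Y"
proof -
  note Y' = planesD[OF Y]
  let ?D = "\<lambda>x. sym_diff T (coset x Y)"
  have D: "card (?D x) + 2 * card (T \<inter> coset x Y) = card T + 8" for x
    using card_sym_diff[of T "coset x Y"] Y'(3) by simp
  have le: "card (T \<inter> coset x Y) \<le> 8" for x
    using card_mono[of "coset x Y" "T \<inter> coset x Y"] Y'(3) by simp
  have cases: "?D x = {} \<or> (16 \<le> card (?D x) \<and> card (?D x) \<noteq> 20)" "4 dvd card (?D x)"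
    if "x \<in> coset z U" for x
  proof -
    have in_K: "incidence_vector (?D x) \<in> K"
      using K[OF that] by (simp only: incidence_vector_sym_diff)
    then show "4 dvd card (?D x)"
      using K_doubly_even by force
    have "?D x \<subseteq> coset z U"
      using T(1) coset_subset_coset_U[OF Y'(2) that] by blast
    then show "?D x = {} \<or> (16 \<le> card (?D x) \<and> card (?D x) \<noteq> 20)"
      by (rule half_in_K_cases[OF in_K])
  qed
  show 8: "card T = 8"
  proof (rule ccontr)
    assume "card T \<noteq> 8"
    then have 12: "card T = 12"
      using T(2) by simp
    \<comment> \<open>With \<open>k\<close> common points the weight is \<open>20 - 2 * k\<close>.
      It is at least 16, divisible by 4 and not 20, hence 16.\<close>
    have k: "card (T \<inter> coset x Y) = 2" if "x \<in> coset z U" for x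
    proof -
      have "?D x \<noteq> {}"
      proof
        assume "?D x = {}"
        then have "card (?D x) = 0"
          by (simp only: card.empty)
        then show False
          using D[of x] le[of x] 12 by linarith
      qed
      then have "16 \<le> card (?D x)" "card (?D x) \<noteq> 20" "4 dvd card (?D x)"
        using cases[OF that] by blast+
      then show ?thesis
        using D[of x] 12 by presburger
    qed
    \<comment> \<open>Double counting of incidences: 12 points with 8 choices of \<open>x\<close>
      each give 96, whereas 64 choices of \<open>x\<close> with 2 points each would give
      128.\<close>
    have "(\<Sum>x\<in>coset z U. card {t \<in> T. x + t \<in> Y}) = (\<Sum>t\<in>T. 8)"
    proof (rule sum_multicount_gen)
      show "\<forall>t\<in>T. card {x \<in> coset z U. x + t \<in> Y} = 8"
      proof
        fix t
        assume "t \<in> T"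
        then have "coset t Y \<subseteq> coset z U"
          using T(1) coset_subset_coset_U[OF Y'(2)] by blast
        then have "{x \<in> coset z U. x + t \<in> Y} = coset t Y"
          by (auto simp: add.commute)
        then show "card {x \<in> coset z U. x + t \<in> Y} = 8"
          using Y'(3) by (simp only: card_coset)
      qed
    qed simp_all
    moreover have "{t \<in> T. x + t \<in> Y} = T \<inter> coset x Y" for x
      by auto
    ultimately have "(\<Sum>x\<in>coset z U. card (T \<inter> coset x Y)) = 96"
      using 12 by simp
    then show False
      using k by (simp add: card_U)
  qed
  show "T = coset x Y" if "x \<in> T"
  proof -
    have x: "x \<in> T \<inter> coset x Y"
      using that coset_self[OF Y'(1)] by blast
    then have "card (T \<inter> coset x Y) \<noteq> 0"
      by (auto simp: card_eq_0_iff simp del: mem_coset)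
    then have "card (?D x) < 16"
      using D[of x] 8 by linarith
    moreover have "x \<in> coset z U"
      using that T(1) by blast
    ultimately have "?D x = {}"
      using cases(1)[of x] by linarith
    then show ?thesis
      by blast
  qed
qed

lemma flats_in_U_half: "W \<subseteq> U \<Longrightarrow> x \<in> coset z U \<Longrightarrow> coset x W \<in> flats_in z U W"
  unfolding flats_in_def by blast

text \<open>If one half is empty, \<open>S\<close> is a flat by the minimum weight case. Otherwise
  some half has exactly 8 points and is a plane coset; adding plane pairs to \<open>S\<close>
  replaces it by any translate of the polar plane in the other half, which is the situation of
  \<open>translates_in_K\<close>.\<close>

lemma K_mem_cases:
  assumes S: "incidence_vector S \<in> K" "S \<noteq> {}" "card S \<le> 20" and z: "z \<notin> U"
  shows "card S = 16 \<and> (S \<in> (\<Union>W\<in>solids. flats_in 0 U W) \<or> S \<in> (\<Union>W\<in>solids. flats_in z U W) \<or>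
    (\<exists>Y\<in>planes. \<exists>A\<in>flats_in z U Y. \<exists>B\<in>flats_in 0 U (\<rho> Y). S = A \<union> B))"
proof -
  have half: "card S = 16 \<and> S \<in> (\<Union>W\<in>solids. flats_in v U W)" if sub: "S \<subseteq> coset v U" for v
  proof -
    have ev: "even_on_flats 3 S"
      using even_on_flats_3_half[of "incidence_vector S" v] S(1) sub K_orthogonal by auto
    have "16 \<le> card S" "card S \<noteq> 20" "4 dvd card S"
      using half_in_K_cases[OF S(1) sub] S(2) K_doubly_even[OF S(1)] by auto
    then have 16: "card S = 16"
      using S(3) by presburger
    have S': "even_on_flats (Suc 2) S" "card S = 2 ^ Suc (Suc 2)"
      using ev 16 by (simp_all del: even_on_flats.simps)
    obtain x W where W: "vec.subspace W" "S = coset x W"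
      using even_on_flats_min_card_imp_coset[OF S'] .
    have "W \<subseteq> U" "x \<in> coset v U"
      using coset_subset_coset_imp[OF U_subspace W(1)] sub W(2) by blast+
    moreover from this have "W \<in> solids"
      using W 16 by (intro solidsI) simp_all
    ultimately show ?thesis
      using 16 flats_in_U_half unfolding W(2) by blast
  qed
  show ?thesis
  proof (cases "S \<subseteq> coset 0 U \<or> S \<subseteq> coset z U")
    case True
    then show ?thesis
      using half[of 0] half[of z] by (elim disjE) simp_all
  next
    case False
    define S0 where "S0 = S \<inter> coset 0 U"
    define S1 where "S1 = S \<inter> coset z U"
    have halves: "coset 0 U \<inter> coset z U = {}" "coset 0 U \<union> coset z U = UNIV"
      using z unfolding coset_U_if by (simp_all add: zero_in_U)
    then have ne: "S0 \<noteq> {}" "S1 \<noteq> {}" and S_eq: "S = S1 \<union> S0" and disj: "S1 \<inter> S0 = {}"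
      using False unfolding S0_def S1_def by blast+
    have "incidence_vector S \<in> dual K"
      using S(1) K_orthogonal by blast
    from even_on_flats_2_half[OF this, of 0] even_on_flats_2_half[OF this, of z]
    have ev: "even_on_flats 2 S0" "even_on_flats 2 S1"
      unfolding S0_def S1_def by (simp_all only: supp_incidence_vector)
    have card_S: "card S = card S1 + card S0"
      unfolding S_eq by (rule card_Un_disjoint) (simp_all add: disj)
    have vec_S: "incidence_vector S = incidence_vector S1 + incidence_vector S0"
      unfolding S_eq by (rule incidence_vector_disjoint_Un[OF disj])
    have ge: "8 \<le> card S0" "8 \<le> card S1"
      using even_on_flats_min_card[OF ev(1) ne(1)] even_on_flats_min_card[OF ev(2) ne(2)] by simp_all
    have "4 dvd card S1 + card S0"
      using K_doubly_even[OF S(1)] card_S by simp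
    \<comment> \<open>Both sizes are even, at least 8 and different from 10, and their sum is 16 or
      20.\<close>
    then have sizes: "(card S1 = 8 \<and> (card S0 = 8 \<or> card S0 = 12)) \<or> (card S1 = 12 \<and> card S0 = 8)"
      using ge S(3) card_S even_on_flats_2_card_neq_10[OF ev(1)] even_on_flats_2_card_neq_10[OF ev(2)]
        even_on_flats_imp_even[OF ev(1)] even_on_flats_imp_even[OF ev(2)] by presburger
    have one: "card S0 = 8 \<and> (\<exists>Y\<in>planes. \<exists>A\<in>flats_in z U Y. \<exists>B\<in>flats_in 0 U (\<rho> Y). S = A \<union> B)"
      if S1: "card S1 = 8"
    proof -
      have "S1 \<subseteq> coset z U"
        by (simp add: S1_def)
      then obtain x Y where Y: "Y \<in> planes" "S1 = coset x Y" "x \<in> coset z U"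
        using card_8_half[OF ev(2) S1] by blast
      have "x \<notin> U"
        using Y(3) z mem_coset_U by blast
      have in_K: "incidence_vector S0 + incidence_vector (coset u (\<rho> Y)) \<in> K" if "u \<in> coset 0 U" for u
      proof -
        have "u \<in> U"
          using that by simp
        have "incidence_vector S + (incidence_vector S1 + incidence_vector (coset u (\<rho> Y))) \<in> K"
          unfolding Y(2) using S(1) plane_pair_in_K[OF \<open>x \<notin> U\<close> \<open>u \<in> U\<close> Y(1)] by (rule K_add)
        then show ?thesis
          unfolding vec_S by (simp add: add.assoc add.left_commute)
      qed
      obtain u where u: "u \<in> S0"
        using ne(1) by blast
      have sub: "S0 \<subseteq> coset 0 U" and "card S0 = 8 \<or> card S0 = 12"
        using sizes S1 by (auto simp: S0_def)
      note * = translates_in_K[OF \<rho>(1)[OF Y(1)] this in_K]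
      have "S0 = coset u (\<rho> Y)"
        by (rule *(2)[OF _ u])
      moreover have "coset u (\<rho> Y) \<in> flats_in 0 U (\<rho> Y)"
        using u sub planesD(2)[OF \<rho>(1)[OF Y(1)]] by (intro flats_in_U_half) blast+
      moreover have "S1 \<in> flats_in z U Y"
        unfolding Y(2) using Y(3) planesD(2)[OF Y(1)] by (intro flats_in_U_half)
      ultimately show ?thesis
        using *(1) Y(1) S_eq by blast
    qed
    \<comment> \<open>The mirror image of \<open>one\<close>, with \<open>S0\<close> as the plane
      coset; the involution property brings \<open>\<rho> (\<rho> Y)\<close> back to
      \<open>Y\<close>.\<close>
    have "card S1 = 8"
    proof (rule ccontr)
      assume "card S1 \<noteq> 8"
      then have S0: "card S0 = 8" and S1: "card S1 = 8 \<or> card S1 = 12"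
        using sizes by auto
      have "S0 \<subseteq> coset 0 U"
        by (simp add: S0_def)
      then obtain u Y where Y: "Y \<in> planes" "S0 = coset u Y" "u \<in> coset 0 U"
        using card_8_half[OF ev(1) S0] by blast
      have "u \<in> U"
        using Y(3) by simp
      have in_K: "incidence_vector S1 + incidence_vector (coset x (\<rho> Y)) \<in> K" if "x \<in> coset z U" for x
      proof -
        have "x \<notin> U"
          using that z mem_coset_U by blast
        have "incidence_vector S + (incidence_vector (coset x (\<rho> Y)) + incidence_vector (coset u (\<rho> (\<rho> Y)))) \<in> K"
          using S(1) plane_pair_in_K[OF \<open>x \<notin> U\<close> \<open>u \<in> U\<close> \<rho>(1)[OF Y(1)]] by (rule K_add)
        then show ?thesis
          unfolding vec_S \<rho>(2)[OF Y(1)] Y(2)[symmetric] by (simp add: add.assoc add.commute add.left_commute)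
      qed
      have "S1 \<subseteq> coset z U"
        by (simp add: S1_def)
      from translates_in_K(1)[OF \<rho>(1)[OF Y(1)] this S1 in_K] show False
        using \<open>card S1 \<noteq> 8\<close> by blast
    qed
    then show ?thesis
      using one card_S by simp
  qed
qed

lemma num_weight_K_small: "0 < i \<Longrightarrow> i \<le> 20 \<Longrightarrow> i \<noteq> 16 \<Longrightarrow> num_weight K i = 0"
proof (rule num_weight_eq_0I)
  fix x
  assume "0 < i" "i \<le> 20" "i \<noteq> 16" "x \<in> K"
  obtain z where "z \<notin> U"
    using ex_not_in_U by blast
  then show "weight x \<noteq> i"
    using K_mem_cases[of "supp x" z] \<open>x \<in> K\<close> \<open>0 < i\<close> \<open>i \<le> 20\<close> \<open>i \<noteq> 16\<close> by (auto simp: weight_eq card_gt_0_iff)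
qed

lemma card_planes: "card planes = 1395"
  using card_subspaces_between[OF U_subspace, of 6 "{0}" 0 3]
  by (simp add: planes_def card_U zero_in_U num_subspaces_numeral)

lemma card_solids: "card solids = 651"
  using card_subspaces_between[OF U_subspace, of 6 "{0}" 0 4]
  by (simp add: solids_def card_U zero_in_U num_subspaces_numeral)

text \<open>The three families of \<open>K_mem_cases\<close> are disjoint: words of the first two
  lie in a single half, while a mixed word has a part in each and its outer part determines
  \<open>Y\<close>.\<close>

lemma num_weight_K_16: "num_weight K 16 = 94488"
proof -
  obtain z where z: "z \<notin> U"
    using ex_not_in_U by blast
  let ?F0 = "\<Union>W\<in>solids. flats_in 0 U W" and ?F1 = "\<Union>W\<in>solids. flats_in z U W"
  let ?P = "SIGMA Y:planes. flats_in z U Y \<times> flats_in 0 U (\<rho> Y)"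
  let ?F2 = "(\<lambda>(Y, A, B). A \<union> B) ` ?P"
  have halves: "coset 0 U \<inter> coset z U = {}"
    using z unfolding coset_U_if by (simp add: zero_in_U)
  have flat_sub: "A \<subseteq> coset v U" if "A \<in> flats_in v U W" "W \<subseteq> U" for v A W
    using that coset_subset_coset_U unfolding flats_in_def by blast
  have flat_ne: "A \<noteq> {}" if "A \<in> flats_in v U W" "vec.subspace W" for v A W
    using that coset_self unfolding flats_in_def by blast
  have P: "A \<noteq> {}" "B \<noteq> {}" "A \<subseteq> coset z U" "B \<subseteq> coset 0 U"
    if "Y \<in> planes" "A \<in> flats_in z U Y" "B \<in> flats_in 0 U (\<rho> Y)" for Y A B
    using flat_ne[OF that(2)] flat_ne[OF that(3)] flat_sub[OF that(2)] flat_sub[OF that(3)]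
      planesD[OF that(1)] planesD[OF \<rho>(1)[OF that(1)]] by blast+
  have "{S. incidence_vector S \<in> K \<and> card S = 16} = (?F0 \<union> ?F1) \<union> ?F2"
  proof (intro set_eqI iffI)
    fix S
    assume "S \<in> {S. incidence_vector S \<in> K \<and> card S = 16}"
    then have S: "incidence_vector S \<in> K" "S \<noteq> {}" "card S \<le> 20"
      by auto
    consider "S \<in> ?F0" | "S \<in> ?F1"
      | Y A B where "Y \<in> planes" "A \<in> flats_in z U Y" "B \<in> flats_in 0 U (\<rho> Y)" "S = A \<union> B"
      using K_mem_cases[OF S z] by blast
    then show "S \<in> (?F0 \<union> ?F1) \<union> ?F2"
    proof cases
      case 3
      then have "S \<in> ?F2"
        by (intro image_eqI[of _ _ "(Y, A, B)"]) simp_all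
      then show ?thesis
        by (rule UnI2)
    qed (simp_all only: Un_iff simp_thms)
  next
    fix S
    assume "S \<in> (?F0 \<union> ?F1) \<union> ?F2"
    then consider W v where "W \<in> solids" "S \<in> flats_in v U W"
      | Y A B where "Y \<in> planes" "A \<in> flats_in z U Y" "B \<in> flats_in 0 U (\<rho> Y)" "S = A \<union> B"
      by blast
    then show "S \<in> {S. incidence_vector S \<in> K \<and> card S = 16}"
    proof cases
      case 1
      then show ?thesis
        using solid_coset_in_K solidsD(3) unfolding flats_in_def by auto
    next
      case 2
      obtain x u where xu: "A = coset x Y" "B = coset u (\<rho> Y)" "x \<in> coset z U" "u \<in> coset 0 U"
        using 2(2,3) unfolding flats_in_def by blast
      have "x \<notin> U" "u \<in> U"
        using xu z mem_coset_U by auto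
      have disj: "A \<inter> B = {}"
        using P(3,4)[OF 2(1-3)] halves by blast
      have "incidence_vector S \<in> K"
        unfolding 2(4) incidence_vector_disjoint_Un[OF disj] unfolding xu
        by (rule plane_pair_in_K[OF \<open>x \<notin> U\<close> \<open>u \<in> U\<close> 2(1)])
      moreover have "card S = card A + card B"
        unfolding 2(4) by (rule card_Un_disjoint) (simp_all add: disj)
      ultimately show ?thesis
        using planesD(3)[OF 2(1)] planesD(3)[OF \<rho>(1)[OF 2(1)]] by (simp add: xu)
    qed
  qed
  moreover have "card ((?F0 \<union> ?F1) \<union> ?F2) = card ?F0 + card ?F1 + card ?F2"
  proof -
    have F: "S \<noteq> {}" "S \<subseteq> coset v U" if "S \<in> (\<Union>W\<in>solids. flats_in v U W)" for S v
      using that flat_ne flat_sub solidsD by blast+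
    have "?F0 \<inter> ?F1 = {}"
    proof (rule Int_emptyI)
      fix S
      assume S: "S \<in> ?F0" "S \<in> ?F1"
      show False
        using F(1)[OF S(1)] F(2)[OF S(1)] F(2)[OF S(2)] halves by auto
    qed
    moreover have "(?F0 \<union> ?F1) \<inter> ?F2 = {}"
    proof -
      have "A \<union> B \<notin> ?F0 \<union> ?F1" if "Y \<in> planes" "A \<in> flats_in z U Y" "B \<in> flats_in 0 U (\<rho> Y)" for Y A B
      proof
        assume "A \<union> B \<in> ?F0 \<union> ?F1"
        then have "A \<union> B \<subseteq> coset 0 U \<or> A \<union> B \<subseteq> coset z U"
          using F(2)[of "A \<union> B"] by (elim UnE) blast+
        then show False
          using P[OF that] halves by blast
      qed
      then show ?thesis
        by (auto simp del: UN_iff)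
    qed
    ultimately show ?thesis
      by (simp add: card_Un_disjoint)
  qed
  moreover have "16 * card (\<Union>W\<in>solids. flats_in v U W) = 651 * 64" for v
    using card_UN_flats_in[OF U_subspace, of solids 16 v] solidsD by (simp add: card_solids card_U)
  moreover have "card ?F2 = 1395 * 64"
  proof -
    have "inj_on (\<lambda>(Y, A, B). A \<union> B) ?P"
    proof (rule inj_onI)
      fix p q
      assume pq: "p \<in> ?P" "q \<in> ?P" "(\<lambda>(Y, A, B). A \<union> B) p = (\<lambda>(Y, A, B). A \<union> B) q"
      then obtain Y A B Y' A' B' where p: "p = (Y, A, B)" "q = (Y', A', B')"
        and *: "Y \<in> planes" "A \<in> flats_in z U Y" "B \<in> flats_in 0 U (\<rho> Y)"
        "Y' \<in> planes" "A' \<in> flats_in z U Y'" "B' \<in> flats_in 0 U (\<rho> Y')" "A \<union> B = A' \<union> B'"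
        by (elim SigmaE) (simp only: prod.case)
      have AB: "A = A'" "B = B'"
        using *(7) P(3,4)[OF *(1-3)] P(3,4)[OF *(4-6)] halves by blast+
      obtain x x' where "A = coset x Y" "A' = coset x' Y'"
        using *(2,5) unfolding flats_in_def by blast
      then have "coset x Y = coset x' Y'"
        using AB by simp
      with planesD(1)[OF *(1)] planesD(1)[OF *(4)] have "Y = Y'"
        by (rule coset_inj)
      then show "p = q"
        using AB p by simp
    qed
    then have "card ?F2 = card ?P"
      by (rule card_image)
    also have "\<dots> = (\<Sum>Y\<in>planes. card (flats_in z U Y \<times> flats_in 0 U (\<rho> Y)))"
      by (rule card_SigmaI) simp_all
    also have "\<dots> = (\<Sum>Y\<in>planes. 64)"
    proof (rule sum.cong)
      fix Y
      assume "Y \<in> planes"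
      have "card (flats_in v U Y') = 8" if "Y' \<in> planes" for v Y'
        using card_flats_in[OF U_subspace planesD(1,2)[OF that], of v] planesD(3)[OF that] by (simp add: card_U)
      then show "card (flats_in z U Y \<times> flats_in 0 U (\<rho> Y)) = 64"
        using \<open>Y \<in> planes\<close> \<rho>(1) by (simp add: card_cartesian_product)
    qed simp
    finally show ?thesis
      by (simp add: card_planes)
  qed
  ultimately show ?thesis
    unfolding num_weight_eq by (simp del: UN_simps)
qed

end

text \<open>The dimension formula in terms of cardinalities; it will bound the intersection of two
  planes from below.\<close>

lemma card_subspaces_le:
  fixes Z :: "(bit ^ 'n::finite) set"
  assumes A: "vec.subspace A" and B: "vec.subspace B" and Z: "vec.subspace Z" "A \<subseteq> Z" "B \<subseteq> Z"
  shows "card A * card B \<le> card (A \<inter> B) * card Z"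
proof -
  have "{x + y | x y. x \<in> A \<and> y \<in> B} \<subseteq> Z"
    using Z by (auto simp: subspace_bit_iff subset_iff)
  then have "vec.dim {x + y | x y. x \<in> A \<and> y \<in> B} \<le> vec.dim Z"
    by (rule vec.dim_subset)
  then have "vec.dim A + vec.dim B \<le> vec.dim (A \<inter> B) + vec.dim Z"
    using vec.dim_sums_Int[OF A B] by simp
  then have "(2 :: nat) ^ (vec.dim A + vec.dim B) \<le> 2 ^ (vec.dim (A \<inter> B) + vec.dim Z)"
    by (intro power_increasing) simp_all
  then show ?thesis
    using assms by (simp add: card_subspace subspace_Int_bit power_add)
qed

section \<open>The number of blocks through two points\<close>

context polarity_code
begin

lemma block_in_U:
  assumes "z \<notin> U" "Y \<in> planes"
  shows "(coset z Y \<union> \<rho> Y) \<inter> U = \<rho> Y" "(coset z Y \<union> \<rho> Y) - U = coset z Y"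
  using coset_Int_U[OF planesD(2)[OF assms(2)] assms(1)] planesD(2)[OF \<rho>(1)[OF assms(2)]] by blast+

lemma card_planes_\<rho>: "card {Y \<in> planes. P (\<rho> Y)} = card {Y \<in> planes. P Y}"
proof -
  have "bij_betw \<rho> {Y \<in> planes. P (\<rho> Y)} {Y \<in> planes. P Y}"
    by (rule bij_betw_byWitness[of _ \<rho>]) (use \<rho> in auto)
  then show ?thesis
    by (rule bij_betw_same_card)
qed

text \<open>In the quotient of \<open>U\<close> by \<open>v\<close> this is the Gaussian binomial
  coefficient of 5 over 2.\<close>

lemma card_planes_1:
  assumes "v \<in> U" "v \<noteq> 0"
  shows "card {Y \<in> planes. v \<in> Y} = 155"
proof -
  have s: "vec.subspace {0 :: bit ^ 'n}"
    by (simp add: subspace_bit_iff)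
  let ?B = "{0} \<union> coset v {0}"
  have B: "vec.subspace ?B" "card ?B = 2 ^ 1"
    using subspace_insert[OF s] card_insert_subspace[OF s, of v] assms by simp_all
  have eq: "?B = {0, v}"
    by (auto simp: vec_bit_add_eq_0_iff)
  have "{Y \<in> planes. v \<in> Y} = subspaces_between ?B U 3"
    unfolding eq by (auto simp: planes_def subspaces_between_def)
  moreover have sub: "?B \<subseteq> U"
    unfolding eq using assms by (simp add: zero_in_U)
  have "card (subspaces_between ?B U (1 + 2)) = num_subspaces 2 1 6"
    by (rule card_subspaces_between[OF U_subspace _ B(1) sub B(2)]) (simp add: card_U)
  moreover have "1 + 2 = (3 :: nat)"
    by simp
  ultimately have "card {Y \<in> planes. v \<in> Y} = num_subspaces 2 1 6"
    by (simp only:)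
  then show ?thesis
    by (simp add: num_subspaces_numeral)
qed

text \<open>In the quotient of \<open>U\<close> by the span of \<open>v\<close> and
  \<open>w\<close>, these are the numbers of subspaces of dimension 1 and 2 in dimension 4.\<close>

lemma card_planes_solids_2:
  assumes "v \<in> U" "w \<in> U" "v \<noteq> 0" "w \<noteq> 0" "v \<noteq> w"
  shows "card {Y \<in> planes. v \<in> Y \<and> w \<in> Y} = 15" "card {W \<in> solids. v \<in> W \<and> w \<in> W} = 35"
proof -
  have s: "vec.subspace {0 :: bit ^ 'n}"
    by (simp add: subspace_bit_iff)
  let ?A = "{0} \<union> coset v {0}"
  let ?B = "?A \<union> coset w ?A"
  have A: "vec.subspace ?A" "card ?A = 2"
    using subspace_insert[OF s] card_insert_subspace[OF s, of v] assms by simp_all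
  have eqA: "?A = {0, v}"
    by (auto simp: vec_bit_add_eq_0_iff)
  then have "w \<notin> ?A"
    using assms by simp
  then have B: "vec.subspace ?B" "card ?B = 2 ^ 2"
    using subspace_insert[OF A(1)] card_insert_subspace[OF A(1), of w] A(2) by simp_all
  have eq: "?B = {0, v, w, w + v}"
    unfolding eqA by (simp add: coset_def insert_commute)
  have sub: "?B \<subseteq> U"
    unfolding eq using assms by (simp add: zero_in_U sum_in_U_iff)
  have cond: "?B \<subseteq> W \<longleftrightarrow> v \<in> W \<and> w \<in> W" if "vec.subspace W" for W
    unfolding eq using that by (auto simp: subspace_bit_iff)
  have "{Y \<in> planes. v \<in> Y \<and> w \<in> Y} = subspaces_between ?B U 3"
    using cond unfolding planes_def subspaces_between_def by (auto simp: subspace_bit_iff)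
  moreover have "card (subspaces_between ?B U (2 + 1)) = num_subspaces 1 2 6"
    by (rule card_subspaces_between[OF U_subspace _ B(1) sub B(2)]) (simp add: card_U)
  ultimately show "card {Y \<in> planes. v \<in> Y \<and> w \<in> Y} = 15"
    by simp
  have "{W \<in> solids. v \<in> W \<and> w \<in> W} = subspaces_between ?B U 4"
    using cond unfolding solids_def subspaces_between_def by (auto simp: subspace_bit_iff)
  moreover have "card (subspaces_between ?B U (2 + 2)) = num_subspaces 2 2 6"
    by (rule card_subspaces_between[OF U_subspace _ B(1) sub B(2)]) (simp add: card_U)
  ultimately show "card {W \<in> solids. v \<in> W \<and> w \<in> W} = 35"
    by (simp add: num_subspaces_numeral)
qed

text \<open>A block through \<open>w\<close> outside \<open>U\<close> has the form
  \<open>coset w Y \<union> \<rho> Y\<close> for exactly one plane \<open>Y\<close>, so blocks can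
  be counted by planes.\<close>

lemma card_blocks_through_outside:
  assumes "w \<notin> U"
    and mem: "\<And>Y. Y \<in> planes \<Longrightarrow> v \<in> coset w Y \<union> \<rho> Y \<longleftrightarrow> P Y"
    and card: "card {Y \<in> planes. P Y} = 155"
  shows "card {B \<in> blocks. v \<in> B \<and> w \<in> B} = 155"
proof -
  have "{B \<in> blocks. v \<in> B \<and> w \<in> B} = (\<lambda>Y. coset w Y \<union> \<rho> Y) ` {Y \<in> planes. P Y}"
  proof (intro set_eqI iffI)
    fix B
    assume B: "B \<in> {B \<in> blocks. v \<in> B \<and> w \<in> B}"
    then obtain z Y where Y: "z \<notin> U" "Y \<in> planes" "B = coset z Y \<union> \<rho> Y"
      using solidsD(2) assms(1) unfolding blocks_def by blast
    then have "w \<in> coset z Y"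
      using B assms(1) planesD(2)[OF \<rho>(1)[OF Y(2)]] by blast
    then have eq: "coset z Y = coset w Y"
      using coset_eq_iff[OF planesD(1)[OF Y(2)]] by simp
    then have "P Y"
      using B Y(3) mem[OF Y(2)] by (simp only: mem_Collect_eq)
    then show "B \<in> (\<lambda>Y. coset w Y \<union> \<rho> Y) ` {Y \<in> planes. P Y}"
      unfolding Y(3) eq using Y(2) by blast
  next
    fix B
    assume "B \<in> (\<lambda>Y. coset w Y \<union> \<rho> Y) ` {Y \<in> planes. P Y}"
    then obtain Y where Y: "Y \<in> planes" "P Y" "B = coset w Y \<union> \<rho> Y"
      by blast
    have "w \<in> coset w Y"
      by (rule coset_self[OF planesD(1)[OF Y(1)]])
    moreover have "B \<in> blocks"
      unfolding blocks_def Y(3) using Y(1) assms(1) by blast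
    ultimately show "B \<in> {B \<in> blocks. v \<in> B \<and> w \<in> B}"
      using mem[OF Y(1)] Y(2,3) by blast
  qed
  moreover have "inj_on (\<lambda>Y. coset w Y \<union> \<rho> Y) {Y \<in> planes. P Y}"
  proof (rule inj_onI)
    fix Y Y'
    assume *: "Y \<in> {Y \<in> planes. P Y}" "Y' \<in> {Y \<in> planes. P Y}" "coset w Y \<union> \<rho> Y = coset w Y' \<union> \<rho> Y'"
    then have "coset w Y = coset w Y'"
      using block_in_U(2)[OF assms(1), of Y] block_in_U(2)[OF assms(1), of Y'] by simp
    then show "Y = Y'"
      using *(1,2) planesD(1) coset_inj[of Y Y' w w] by blast
  qed
  ultimately show ?thesis
    using card by (simp only: card_image)
qed

text \<open>Unless both points lie in \<open>U\<close>, the blocks correspond to the 155 planes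
  through one vector. For two points of \<open>U\<close> there are 35 solids, and 15 planes with 8
  outer cosets each: \<open>35 + 15 * 8 = 155\<close>.\<close>

lemma card_blocks_through_2:
  assumes "v \<noteq> 0" "w \<noteq> 0" "v \<noteq> w"
  shows "card {B \<in> blocks. v \<in> B \<and> w \<in> B} = 155"
proof -
  have mixed: "card {B \<in> blocks. v \<in> B \<and> w \<in> B} = 155" if "v \<in> U" "w \<notin> U" "v \<noteq> 0" for v w
  proof (rule card_blocks_through_outside[OF that(2)])
    fix Y
    assume Y: "Y \<in> planes"
    show "v \<in> coset w Y \<union> \<rho> Y \<longleftrightarrow> v \<in> \<rho> Y"
      using coset_Int_U[OF planesD(2)[OF Y] that(2)] that(1) by blast
  next
    show "card {Y \<in> planes. v \<in> \<rho> Y} = 155"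
      unfolding card_planes_\<rho> by (rule card_planes_1[OF that(1,3)])
  qed
  consider "v \<in> U" "w \<in> U" | "v \<in> U" "w \<notin> U" | "v \<notin> U" "w \<in> U" | "v \<notin> U" "w \<notin> U"
    by blast
  then show ?thesis
  proof cases
    case 2
    then show ?thesis
      using mixed assms by blast
  next
    case 3
    then show ?thesis
      using mixed[of w v] assms by (subst conj_commute) blast
  next
    case 4
    show ?thesis
    proof (rule card_blocks_through_outside[OF 4(2)])
      fix Y
      assume Y: "Y \<in> planes"
      show "v \<in> coset w Y \<union> \<rho> Y \<longleftrightarrow> w + v \<in> Y"
        using planesD(2)[OF \<rho>(1)[OF Y]] 4(1) by auto
    next
      show "card {Y \<in> planes. w + v \<in> Y} = 155"
        using 4 assms(3) by (intro card_planes_1) (simp_all add: sum_in_U_iff vec_bit_add_eq_0_iff)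
    qed
  next
    case 1
    obtain z where z: "z \<notin> U"
      using ex_not_in_U by blast
    let ?Y = "{Y \<in> planes. v \<in> \<rho> Y \<and> w \<in> \<rho> Y}"
    let ?S = "{W \<in> solids. v \<in> W \<and> w \<in> W}"
    let ?P = "SIGMA Y:?Y. flats_in z U Y"
    have flat: "\<exists>x. x \<notin> U \<and> A = coset x Y" if "A \<in> flats_in z U Y" for A Y
      using that z mem_coset_U unfolding flats_in_def by blast
    have "{B \<in> blocks. v \<in> B \<and> w \<in> B} = ?S \<union> (\<lambda>(Y, A). A \<union> \<rho> Y) ` ?P"
    proof (intro set_eqI iffI)
      fix B
      assume B: "B \<in> {B \<in> blocks. v \<in> B \<and> w \<in> B}"
      then consider "B \<in> solids" | x Y where "x \<notin> U" "Y \<in> planes" "B = coset x Y \<union> \<rho> Y"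
        unfolding blocks_def by blast
      then show "B \<in> ?S \<union> (\<lambda>(Y, A). A \<union> \<rho> Y) ` ?P"
      proof cases
        case 1
        then show ?thesis
          using B by blast
      next
        case 2
        have "v \<in> \<rho> Y" "w \<in> \<rho> Y"
          using B \<open>v \<in> U\<close> \<open>w \<in> U\<close> block_in_U(1)[OF 2(1,2)] 2(3) by blast+
        moreover have "x \<in> coset z U"
          using 2(1) z mem_coset_U by blast
        then have "coset x Y \<in> flats_in z U Y"
          using planesD(2)[OF 2(2)] by (intro flats_in_U_half)
        ultimately have "(Y, coset x Y) \<in> ?P"
          using 2(2) by blast
        then have "(\<lambda>(Y, A). A \<union> \<rho> Y) (Y, coset x Y) \<in> (\<lambda>(Y, A). A \<union> \<rho> Y) ` ?P"
          by (rule imageI)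
        then show ?thesis
          using 2(3) by (simp only: prod.case Un_iff simp_thms)
      qed
    next
      fix B
      assume "B \<in> ?S \<union> (\<lambda>(Y, A). A \<union> \<rho> Y) ` ?P"
      then consider "B \<in> ?S" | Y A where "Y \<in> ?Y" "A \<in> flats_in z U Y" "B = A \<union> \<rho> Y"
        by blast
      then show "B \<in> {B \<in> blocks. v \<in> B \<and> w \<in> B}"
      proof cases
        case 1
        then show ?thesis
          by (simp add: blocks_def)
      next
        case 2
        obtain x where "x \<notin> U" "A = coset x Y"
          using flat[OF 2(2)] by blast
        then show ?thesis
          using 2(1,3) unfolding blocks_def by blast
      qed
    qed
    moreover have "?S \<inter> (\<lambda>(Y, A). A \<union> \<rho> Y) ` ?P = {}"
    proof -
      have "A \<union> \<rho> Y \<notin> ?S" if YA: "Y \<in> ?Y" "A \<in> flats_in z U Y" for Y A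
      proof
        assume "A \<union> \<rho> Y \<in> ?S"
        then have "A \<subseteq> U"
          using solidsD(2) by blast
        moreover obtain x where "x \<notin> U" "A = coset x Y"
          using flat[OF YA(2)] by blast
        moreover have "x \<in> coset x Y"
          using YA(1) by (intro coset_self planesD(1)) simp
        ultimately show False
          by blast
      qed
      then have "(\<lambda>(Y, A). A \<union> \<rho> Y) p \<notin> ?S" if "p \<in> ?P" for p
        using that by (elim SigmaE) (simp only: prod.case not_False_eq_True)
      then show ?thesis
        by blast
    qed
    moreover have "card ((\<lambda>(Y, A). A \<union> \<rho> Y) ` ?P) = 15 * 8"
    proof -
      have "inj_on (\<lambda>(Y, A). A \<union> \<rho> Y) ?P"
      proof (rule inj_onI)
        fix p q
        assume pq: "p \<in> ?P" "q \<in> ?P" "(\<lambda>(Y, A). A \<union> \<rho> Y) p = (\<lambda>(Y, A). A \<union> \<rho> Y) q"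
        then obtain Y A Y' A' where p: "p = (Y, A)" "q = (Y', A')"
          and *: "Y \<in> planes" "A \<in> flats_in z U Y" "Y' \<in> planes" "A' \<in> flats_in z U Y'"
            "A \<union> \<rho> Y = A' \<union> \<rho> Y'"
          by (elim SigmaE) (simp only: prod.case mem_Collect_eq)
        obtain x x' where x: "x \<notin> U" "A = coset x Y" "x' \<notin> U" "A' = coset x' Y'"
          using flat[OF *(2)] flat[OF *(4)] by blast
        have "coset x Y = coset x' Y'"
          using block_in_U(2)[OF x(1) *(1)] block_in_U(2)[OF x(3) *(3)] *(5) x by simp
        moreover from planesD(1)[OF *(1)] planesD(1)[OF *(3)] this have "Y = Y'"
          by (rule coset_inj)
        ultimately show "p = q"
          using p x by simp
      qed
      then have "card ((\<lambda>(Y, A). A \<union> \<rho> Y) ` ?P) = card ?P"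
        by (rule card_image)
      also have "\<dots> = (\<Sum>Y\<in>?Y. card (flats_in z U Y))"
        by (rule card_SigmaI) simp_all
      also have "\<dots> = (\<Sum>Y\<in>?Y. 8)"
      proof (rule sum.cong)
        fix Y
        assume "Y \<in> ?Y"
        then have "Y \<in> planes"
          by simp
        then show "card (flats_in z U Y) = 8"
          using card_flats_in[OF U_subspace planesD(1,2), of Y z] planesD(3)[of Y] by (simp add: card_U)
      qed simp
      also have "\<dots> = card ?Y * 8"
        by simp
      also have "card ?Y = 15"
        unfolding card_planes_\<rho>[of "\<lambda>Y. v \<in> Y \<and> w \<in> Y"]
        by (rule card_planes_solids_2(1)[OF 1 assms])
      finally show ?thesis .
    qed
    moreover have "card ?S = 35"
      by (rule card_planes_solids_2(2)[OF 1 assms])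
    ultimately show ?thesis
      by (simp add: card_Un_disjoint)
  qed
qed

end

subsection \<open>Points of the binary projective space as nonzero vectors\<close>

lemma card_2_zeroE:
  assumes "card P = 2" "0 \<in> P"
  obtains v where "v \<noteq> 0" "P = {0, v}"
proof -
  have "card (P - {0}) = 1"
    using assms by simp
  then obtain v where "P - {0} = {v}"
    by (rule card_1_singletonE)
  then show ?thesis
    using that assms(2) by blast
qed

lemma subspace_dim_1_bit_iff:
  "vec.subspace P \<and> vec.dim P = 1 \<longleftrightarrow> (\<exists>v. v \<noteq> 0 \<and> P = {0, v :: bit ^ 'n::finite})"
proof
  assume P: "vec.subspace P \<and> vec.dim P = 1"
  then have "card P = 2" "0 \<in> P"
    using card_subspace[of P] by (simp_all add: subspace_bit_iff)
  then obtain v where "v \<noteq> 0" "P = {0, v}"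
    by (rule card_2_zeroE)
  then show "\<exists>v. v \<noteq> 0 \<and> P = {0, v}"
    by (intro exI conjI)
next
  assume "\<exists>v. v \<noteq> 0 \<and> P = {0, v}"
  then obtain v where v: "v \<noteq> 0" "P = {0, v}"
    by blast
  then have P: "vec.subspace P"
    by (simp add: subspace_bit_iff)
  have "(2 :: nat) ^ vec.dim P = 2 ^ 1"
    using card_subspace[OF P] v by simp
  then show "vec.subspace P \<and> vec.dim P = 1"
    using P power_inject_exp[of "2 :: nat" "vec.dim P" 1] by simp
qed

definition vec_of_point :: "(bit, 'n::finite) pg_point \<Rightarrow> bit ^ 'n" where
  "vec_of_point p = (THE v. v \<noteq> 0 \<and> Rep_pg_point p = {0, v})"

definition point_of_vec :: "bit ^ 'n::finite \<Rightarrow> (bit, 'n) pg_point" where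
  "point_of_vec v = Abs_pg_point {0, v}"

lemma Rep_point_of_vec: "v \<noteq> 0 \<Longrightarrow> Rep_pg_point (point_of_vec v) = {0, v}"
  unfolding point_of_vec_def using subspace_dim_1_bit_iff[of "{0, v}"]
  by (subst Abs_pg_point_inverse) auto

lemma vec_of_point: "vec_of_point p \<noteq> 0" "Rep_pg_point p = {0, vec_of_point p}"
proof -
  have "\<exists>v. v \<noteq> 0 \<and> Rep_pg_point p = {0, v}"
    using Rep_pg_point[of p] subspace_dim_1_bit_iff[of "Rep_pg_point p"] by simp
  then have "\<exists>!v. v \<noteq> 0 \<and> Rep_pg_point p = {0, v}"
    by (auto simp: doubleton_eq_iff)
  from theI'[OF this] show "vec_of_point p \<noteq> 0" "Rep_pg_point p = {0, vec_of_point p}"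
    by (simp_all add: vec_of_point_def)
qed

lemma vec_of_point_of_vec [simp]: "v \<noteq> 0 \<Longrightarrow> vec_of_point (point_of_vec v) = v"
  using vec_of_point[of "point_of_vec v"] Rep_point_of_vec[of v] by (auto simp: doubleton_eq_iff)

lemma point_of_vec_of_point [simp]: "point_of_vec (vec_of_point p) = p"
  using vec_of_point[of p] Rep_point_of_vec[of "vec_of_point p"] Rep_pg_point_inject by metis

lemma vec_of_point_eq_iff [simp]: "vec_of_point p = vec_of_point q \<longleftrightarrow> p = q"
  by (metis point_of_vec_of_point)

text \<open>Adjoining 0 turns projective subspaces into vector subspaces. For a block, the same 0
  becomes the parity coordinate of the extended word.\<close>

definition vecs :: "(bit, 'n::finite) pg_point set \<Rightarrow> (bit ^ 'n) set" where
  "vecs S = insert 0 (vec_of_point ` S)"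

definition points :: "(bit ^ 'n::finite) set \<Rightarrow> (bit, 'n) pg_point set" where
  "points W = {p. vec_of_point p \<in> W}"

lemma vec_of_point_in_vecs [simp]: "vec_of_point p \<in> vecs S \<longleftrightarrow> p \<in> S"
  using vec_of_point(1)[of p] by (auto simp: vecs_def)

lemma points_vecs [simp]: "points (vecs S) = S"
  by (simp add: points_def)

lemma mem_vecs_iff: "v \<in> vecs S \<longleftrightarrow> v = 0 \<or> point_of_vec v \<in> S"
  using vec_of_point_in_vecs[of "point_of_vec v" S] by (cases "v = 0") (simp_all add: vecs_def)

lemma zero_in_vecs [simp]: "0 \<in> vecs S"
  by (simp add: vecs_def)

lemma vecs_points [simp]: "0 \<in> W \<Longrightarrow> vecs (points W) = W"
proof (rule set_eqI)
  fix v
  assume "0 \<in> W"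
  then show "v \<in> vecs (points W) \<longleftrightarrow> v \<in> W"
    by (cases "v = 0") (simp_all add: mem_vecs_iff points_def)
qed

lemma vecs_Int: "vecs (S \<inter> T) = vecs S \<inter> vecs T"
  by (auto simp: mem_vecs_iff)

lemma vecs_subset_iff: "vecs S \<subseteq> vecs T \<longleftrightarrow> S \<subseteq> T"
  by (metis Int_absorb2 inf.absorb_iff1 points_vecs vecs_Int)

lemma card_vecs: "card (vecs S) = Suc (card S)"
proof -
  have "inj_on vec_of_point S"
    by (simp add: inj_on_def)
  moreover have "0 \<notin> vec_of_point ` S"
    using vec_of_point(1) by fastforce
  ultimately show ?thesis
    by (simp add: vecs_def card_image)
qed

lemma pg_subspace_iff:
  "pg_subspace t S \<longleftrightarrow> vec.subspace (vecs S) \<and> int (vec.dim (vecs S)) = t + 1"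
proof
  assume "pg_subspace t S"
  then obtain W where W: "vec.subspace W" "int (vec.dim W) = t + 1" "S = {p. Rep_pg_point p \<subseteq> W}"
    unfolding pg_subspace_def by blast
  then have "0 \<in> W"
    by (simp add: subspace_bit_iff)
  then have "S = points W"
    unfolding W(3) points_def vec_of_point(2) by simp
  then show "vec.subspace (vecs S) \<and> int (vec.dim (vecs S)) = t + 1"
    using W \<open>0 \<in> W\<close> by simp
next
  assume *: "vec.subspace (vecs S) \<and> int (vec.dim (vecs S)) = t + 1"
  have "S = {p. Rep_pg_point p \<subseteq> vecs S}"
    unfolding vec_of_point(2) by simp
  then show "pg_subspace t S"
    unfolding pg_subspace_def using * by blast
qed

lemma pg_subspace_card:
  "pg_subspace t S \<longleftrightarrow> vec.subspace (vecs S) \<and> 0 \<le> t + 1 \<and> card (vecs S) = 2 ^ nat (t + 1)"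
proof -
  have "int (vec.dim (vecs S)) = t + 1 \<longleftrightarrow> 0 \<le> t + 1 \<and> card (vecs S) = 2 ^ nat (t + 1)"
    if "vec.subspace (vecs S)"
    unfolding card_subspace[OF that] by (simp add: power_inject_exp) linarith
  then show ?thesis
    unfolding pg_subspace_iff by blast
qed

lemma pg_subspaces_of_iff: "S \<in> pg_subspaces_of H \<longleftrightarrow> S \<subseteq> H \<and> vec.subspace (vecs S)"
proof -
  have "(\<exists>t. pg_subspace t S) \<longleftrightarrow> vec.subspace (vecs S)"
    unfolding pg_subspace_iff by (auto intro: exI[of _ "int (vec.dim (vecs S)) - 1"])
  then show ?thesis
    by (simp add: pg_subspaces_of_def)
qed

section \<open>The polarity acting on vector subspaces\<close>

definition vec_polarity ::
    "((bit, 'n::finite) pg_point set \<Rightarrow> (bit, 'n) pg_point set) \<Rightarrow> (bit ^ 'n) set \<Rightarrow> (bit ^ 'n) set" where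
  "vec_polarity \<pi> W = vecs (\<pi> (points W))"

lemma polarityD:
  assumes "polarity d H \<pi>" "S \<in> pg_subspaces_of H"
  shows "\<pi> S \<in> pg_subspaces_of H" "\<pi> (\<pi> S) = S"
    and "T \<in> pg_subspaces_of H \<Longrightarrow> S \<subseteq> T \<Longrightarrow> \<pi> T \<subseteq> \<pi> S"
    and "pg_subspace t S \<Longrightarrow> pg_subspace (d - 1 - t) (\<pi> S)"
  using assms unfolding polarity_def by (auto dest: bij_betwE)

context
  fixes H :: "(bit, 'n::finite) pg_point set" and \<pi>
  assumes dim: "CARD('n) = 7" and H: "pg_subspace 5 H" and \<pi>: "polarity 5 H \<pi>"
begin

lemma planes_H:
  assumes "Y \<in> subspaces_between {0} (vecs H) 3"
  shows "points Y \<in> pg_subspaces_of H" "pg_subspace 2 (points Y)" "vecs (points Y) = Y"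
proof -
  have Y: "vec.subspace Y" "Y \<subseteq> vecs H" "card Y = 8" "0 \<in> Y"
    using assms by (simp_all add: subspaces_between_def)
  then show eq: "vecs (points Y) = Y"
    by simp
  show "pg_subspace 2 (points Y)"
    unfolding pg_subspace_card eq using Y by simp
  have "vecs (points Y) \<subseteq> vecs H"
    unfolding eq using Y by simp
  then have "points Y \<subseteq> H"
    by (simp only: vecs_subset_iff)
  then show "points Y \<in> pg_subspaces_of H"
    unfolding pg_subspaces_of_iff eq using Y by simp
qed

lemma vec_polarity_plane:
  assumes "Y \<in> subspaces_between {0} (vecs H) 3"
  shows "vec_polarity \<pi> Y \<in> subspaces_between {0} (vecs H) 3"
    and "vec_polarity \<pi> (vec_polarity \<pi> Y) = Y"
proof -
  note P = planes_H[OF assms]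
  have "\<pi> (points Y) \<in> pg_subspaces_of H" "pg_subspace 2 (\<pi> (points Y))"
    using polarityD[OF \<pi> P(1)] P(2) by force+
  then show "vec_polarity \<pi> Y \<in> subspaces_between {0} (vecs H) 3"
    by (simp add: vec_polarity_def subspaces_between_def pg_subspaces_of_iff pg_subspace_card vecs_subset_iff)
  show "vec_polarity \<pi> (vec_polarity \<pi> Y) = Y"
    using polarityD(2)[OF \<pi> P(1)] P(3) by (simp add: vec_polarity_def)
qed

text \<open>A polarity exchanges joins and intersections, so it preserves the dimension of the
  intersection of two planes of the five-dimensional space \<open>H\<close>.\<close>

lemma card_vec_polarity_Int_le:
  assumes "Y \<in> subspaces_between {0} (vecs H) 3" "Y' \<in> subspaces_between {0} (vecs H) 3"
  shows "card (vec_polarity \<pi> Y \<inter> vec_polarity \<pi> Y') \<le> card (Y \<inter> Y')"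
proof -
  note P = planes_H[OF assms(1)] and P' = planes_H[OF assms(2)]
  let ?X = "\<pi> (points Y) \<inter> \<pi> (points Y')"
  have in_H: "\<pi> (points Y) \<in> pg_subspaces_of H" "\<pi> (points Y') \<in> pg_subspaces_of H"
    using polarityD(1)[OF \<pi>] P(1) P'(1) by blast+
  then have X: "?X \<in> pg_subspaces_of H"
    unfolding pg_subspaces_of_iff vecs_Int by (auto intro: subspace_Int_bit)
  define k where "k = vec.dim (vecs ?X)"
  have "vec.subspace (vecs ?X)"
    using X by (simp add: pg_subspaces_of_iff)
  then have card_X: "card (vecs ?X) = 2 ^ k" and "pg_subspace (int k - 1) ?X"
    by (simp_all add: card_subspace k_def pg_subspace_iff)
  \<comment> \<open>For a trivial intersection \<open>int k - 1\<close> is \<open>-1\<close>, the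
    dimension of the empty subspace. The image has vector dimension \<open>6 - k\<close> and
    contains both \<open>Y\<close> and \<open>Y'\<close>.\<close>
  then have "pg_subspace (5 - 1 - (int k - 1)) (\<pi> ?X)"
    using polarityD(4)[OF \<pi> X] by blast
  then have Z: "vec.subspace (vecs (\<pi> ?X))" "k \<le> 6" "card (vecs (\<pi> ?X)) = 2 ^ (6 - k)"
    by (auto simp: pg_subspace_card nat_diff_distrib')
  have "Y \<subseteq> vecs (\<pi> ?X)"
    using polarityD(3)[OF \<pi> X in_H(1)] polarityD(2)[OF \<pi> P(1)] P(3) vecs_subset_iff[of "points Y"] by simp
  moreover have "Y' \<subseteq> vecs (\<pi> ?X)"
    using polarityD(3)[OF \<pi> X in_H(2)] polarityD(2)[OF \<pi> P'(1)] P'(3) vecs_subset_iff[of "points Y'"] by simp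
  ultimately have "card Y * card Y' \<le> card (Y \<inter> Y') * card (vecs (\<pi> ?X))"
    using assms Z(1) by (intro card_subspaces_le) (simp_all add: subspaces_between_def)
  moreover have "card Y * card Y' = 2 ^ k * 2 ^ (6 - k)"
    using assms Z(2) by (simp add: subspaces_between_def flip: power_add)
  ultimately have "2 ^ k * 2 ^ (6 - k) \<le> card (Y \<inter> Y') * (2 :: nat) ^ (6 - k)"
    by (simp only: Z(3))
  then have "2 ^ k \<le> card (Y \<inter> Y')"
    by (simp only: mult_le_cancel2) simp
  then show ?thesis
    using card_X by (simp add: vec_polarity_def vecs_Int)
qed

lemma hyperplane_normal:
  obtains a where "a \<noteq> 0" "vecs H = {x. bdot a x = 0}"
proof -
  have U: "vec.subspace (vecs H)" "card (vecs H) = 64"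
    using H by (simp_all add: pg_subspace_card)
  then have "card (dual (vecs H)) = 2"
    using card_dual[OF U(1)] by (simp add: dim)
  moreover have "0 \<in> dual (vecs H)"
    using subspace_dual[of "vecs H"] by (simp add: subspace_bit_iff)
  ultimately obtain a where a: "a \<noteq> 0" "dual (vecs H) = {0, a}"
    using card_2_zeroE[of "dual (vecs H)"] by blast
  have "vecs H = {x. bdot a x = 0}"
    using dual_dual[OF U(1)] unfolding a(2) by (auto simp: dual_def bdot_commute)
  then show ?thesis
    using that a by blast
qed

text \<open>A 4-dimensional subspace not inside the hyperplane is
  \<open>Y \<union> coset z Y\<close> with \<open>Y\<close> its section by the hyperplane. The
  right-hand side is thus in the form of \<open>blocks\<close> in
  \<open>polarity_code\<close>.\<close>

lemma vecs_polarity_design: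
  "vecs ` polarity_design 3 H \<pi> = subspaces_between {0} (vecs H) 4 \<union>
    {coset z Y \<union> vec_polarity \<pi> Y | z Y. z \<notin> vecs H \<and> Y \<in> subspaces_between {0} (vecs H) 3}"
proof -
  let ?U = "vecs H"
  obtain a where a: "a \<noteq> 0" "?U = {x. bdot a x = 0}"
    by (rule hyperplane_normal)
  have sub_U: "vec.subspace ?U"
    using H by (simp add: pg_subspace_card)
  have 1: "vecs ` {S. pg_subspace 3 S \<and> S \<subseteq> H} = subspaces_between {0} ?U 4"
  proof (intro set_eqI iffI)
    fix W
    assume "W \<in> vecs ` {S. pg_subspace 3 S \<and> S \<subseteq> H}"
    then obtain S where "W = vecs S" "pg_subspace 3 S" "S \<subseteq> H"
      by blast
    then show "W \<in> subspaces_between {0} ?U 4"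
      by (simp add: subspaces_between_def pg_subspace_card vecs_subset_iff)
  next
    fix W
    assume "W \<in> subspaces_between {0} ?U 4"
    then have W: "vec.subspace W" "W \<subseteq> ?U" "card W = 16" "vecs (points W) = W"
      by (simp_all add: subspaces_between_def)
    then have "pg_subspace 3 (points W)" "points W \<subseteq> H"
      by (simp_all add: pg_subspace_card flip: vecs_subset_iff)
    then show "W \<in> vecs ` {S. pg_subspace 3 S \<and> S \<subseteq> H}"
      using W(4) by (intro image_eqI[of _ _ "points W"]) simp_all
  qed
  have block: "vecs ((S - H) \<union> \<pi> (S \<inter> H)) = coset z Y \<union> vec_polarity \<pi> Y"
    if "vecs S = Y \<union> coset z Y" "z \<notin> ?U" "Y \<in> subspaces_between {0} ?U 3" for S z Y
  proof -
    have Y: "vec.subspace Y" "Y \<subseteq> ?U"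
      using that(3) by (simp_all add: subspaces_between_def)
    have disj: "coset z Y \<inter> ?U = {}"
    proof -
      have "z \<in> ?U" if "z + x \<in> Y" "x \<in> ?U" for x
      proof -
        have "(z + x) + x \<in> ?U"
          using that Y(2) sub_U unfolding subspace_bit_iff by blast
        then show ?thesis
          by (simp add: add.assoc)
      qed
      then show ?thesis
        using that(2) by auto
    qed
    have "vecs (S \<inter> H) = Y"
      unfolding vecs_Int that(1) using Y(2) disj by blast
    then have SH: "S \<inter> H = points Y"
      by (metis points_vecs)
    have "v \<in> vecs ((S - H) \<union> \<pi> (S \<inter> H)) \<longleftrightarrow> v \<in> coset z Y \<union> vec_polarity \<pi> Y" for v
    proof (cases "v = 0")
      case True
      then show ?thesis
        by (simp only: zero_in_vecs vec_polarity_def Un_iff simp_thms)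
    next
      case False
      then have "v \<in> vecs ((S - H) \<union> \<pi> (S \<inter> H)) \<longleftrightarrow> (v \<in> vecs S \<and> v \<notin> ?U) \<or> v \<in> vec_polarity \<pi> Y"
        by (simp add: mem_vecs_iff vec_polarity_def SH)
      also have "v \<in> vecs S \<and> v \<notin> ?U \<longleftrightarrow> v \<in> coset z Y"
        unfolding that(1) using Y(2) disj by blast
      finally show ?thesis
        by simp
    qed
    then show ?thesis
      by blast
  qed
  have 2: "vecs ` {(S - H) \<union> \<pi> (S \<inter> H) | S. pg_subspace 3 S \<and> \<not> S \<subseteq> H} =
    {coset z Y \<union> vec_polarity \<pi> Y | z Y. z \<notin> ?U \<and> Y \<in> subspaces_between {0} ?U 3}"
  proof (intro set_eqI iffI)
    fix B
    assume "B \<in> vecs ` {(S - H) \<union> \<pi> (S \<inter> H) | S. pg_subspace 3 S \<and> \<not> S \<subseteq> H}"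
    then obtain S where S: "B = vecs ((S - H) \<union> \<pi> (S \<inter> H))" "pg_subspace 3 S" "\<not> S \<subseteq> H"
      by blast
    let ?W = "vecs S"
    have W: "vec.subspace ?W" "card ?W = 16"
      using S(2) by (simp_all add: pg_subspace_card)
    have "\<not> ?W \<subseteq> ?U"
      using S(3) by (simp add: vecs_subset_iff)
    then obtain z where "z \<in> ?W" "z \<notin> ?U"
      by blast
    then have z: "z \<in> ?W" "bdot a z = 1"
      using a(2) by simp_all
    let ?Y = "{w \<in> ?W. bdot a w = 0}"
    have Y: "?Y \<in> subspaces_between {0} ?U 3"
      using subspace_kernel[OF W(1), of a] card_kernel[OF W(1) z] W(2) a(2)
      by (auto simp: subspaces_between_def)
    have "?W = ?Y \<union> coset z ?Y"
    proof (intro set_eqI)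
      fix x
      have "z + x \<in> ?W \<longleftrightarrow> x \<in> ?W"
        using W(1) z(1) unfolding subspace_bit_iff by (metis vec_bit_add_left_cancel)
      then show "x \<in> ?W \<longleftrightarrow> x \<in> ?Y \<union> coset z ?Y"
        using z(2) by (cases "bdot a x") (simp_all add: bdot_add_right)
    qed
    moreover have "z \<notin> ?U"
      using z(2) a(2) by simp
    ultimately have "B = coset z ?Y \<union> vec_polarity \<pi> ?Y"
      unfolding S(1) using Y by (intro block)
    then show "B \<in> {coset z Y \<union> vec_polarity \<pi> Y | z Y. z \<notin> ?U \<and> Y \<in> subspaces_between {0} ?U 3}"
      using Y \<open>z \<notin> ?U\<close> by blast
  next
    fix B
    assume "B \<in> {coset z Y \<union> vec_polarity \<pi> Y | z Y. z \<notin> ?U \<and> Y \<in> subspaces_between {0} ?U 3}"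
    then obtain z Y where *: "B = coset z Y \<union> vec_polarity \<pi> Y" "z \<notin> ?U" "Y \<in> subspaces_between {0} ?U 3"
      by blast
    have Y: "vec.subspace Y" "Y \<subseteq> ?U" "card Y = 8" "0 \<in> Y"
      using *(3) by (simp_all add: subspaces_between_def)
    let ?S = "points (Y \<union> coset z Y)"
    have vS: "vecs ?S = Y \<union> coset z Y"
      using Y(4) by simp
    have "z \<notin> Y"
      using *(2) Y(2) by blast
    then have "pg_subspace 3 ?S"
      unfolding pg_subspace_card vS
      using subspace_insert[OF Y(1)] card_insert_subspace[OF Y(1)] Y(3) by simp
    moreover have "z \<in> vecs ?S"
      unfolding vS using coset_self[OF Y(1)] by blast
    then have "\<not> ?S \<subseteq> H"
      using *(2) vecs_subset_iff by blast
    ultimately show "B \<in> vecs ` {(S - H) \<union> \<pi> (S \<inter> H) | S. pg_subspace 3 S \<and> \<not> S \<subseteq> H}"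
      unfolding *(1) block[OF vS *(2,3), symmetric] by blast
  qed
  show ?thesis
    unfolding polarity_design_def image_Un 1 2 ..
qed

end

subsection \<open>Comparing the extended code with its copy indexed by vectors\<close>

text \<open>Over the field with two elements an additive map is already linear.\<close>

lemma span_image_bit:
  fixes L :: "bit ^ 'i::finite \<Rightarrow> bit ^ 'j::finite"
  assumes L: "\<And>x y. L (x + y) = L x + L y"
  shows "L ` vec.span X = vec.span (L ` X)"
proof
  have L0: "L 0 = 0"
    using L[of 0 0] by simp
  show "L ` vec.span X \<subseteq> vec.span (L ` X)"
  proof (rule image_subsetI)
    fix x
    assume "x \<in> vec.span X"
    then show "L x \<in> vec.span (L ` X)"
    proof (induction rule: vec.span_induct_alt)
      case (step c u v)
      then show ?case
        by (cases c) (auto simp: L intro: vec.span_add vec.span_base)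
    qed (simp add: L0 vec.span_zero)
  qed
  show "vec.span (L ` X) \<subseteq> L ` vec.span X"
  proof (rule vec.span_minimal)
    show "L ` X \<subseteq> L ` vec.span X"
      using vec.span_superset by blast
    have "L x + L y \<in> L ` vec.span X" if "x \<in> vec.span X" "y \<in> vec.span X" for x y
      using that by (intro image_eqI[of _ _ "x + y"] vec.span_add) (simp_all add: L)
    moreover have "0 \<in> L ` vec.span X"
      using L0 by (intro image_eqI[of _ _ 0] vec.span_zero) simp
    ultimately show "vec.subspace (L ` vec.span X)"
      unfolding subspace_bit_iff by blast
  qed
qed

lemma extend_word_add: "extend_word (x + y) = extend_word x + extend_word y"
  by (simp add: extend_word_def vec_eq_iff sum.distrib split: option.split)

text \<open>The zero vector, which is no projective point, takes the place of the parity
  coordinate.\<close>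

definition index_of_vec :: "bit ^ 'n::finite \<Rightarrow> (bit, 'n) pg_point option" where
  "index_of_vec v = (if v = 0 then None else Some (point_of_vec v))"

definition reindex :: "bit ^ (bit, 'n::finite) pg_point option \<Rightarrow> bit ^ (bit ^ 'n)" where
  "reindex x = (\<chi> v. x $ index_of_vec v)"

lemma bij_index_of_vec: "bij index_of_vec"
  by (rule bij_betw_byWitness[of _ "\<lambda>i. case i of None \<Rightarrow> 0 | Some p \<Rightarrow> vec_of_point p"])
    (auto simp: index_of_vec_def vec_of_point(1) split: option.splits)

lemma reindex_add: "reindex (x + y) = reindex x + reindex y"
  by (simp add: reindex_def vec_eq_iff)

lemma inj_reindex: "inj (reindex :: bit ^ (bit, 'n::finite) pg_point option \<Rightarrow> _)"
proof (rule injI)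
  fix x y :: "bit ^ (bit, 'n) pg_point option"
  assume eq: "reindex x = reindex y"
  have "x $ i = y $ i" for i
  proof -
    obtain v where "i = index_of_vec v"
      using bij_index_of_vec by (metis bij_pointE)
    then show ?thesis
      using eq by (simp add: reindex_def vec_eq_iff)
  qed
  then show "x = y"
    by (simp add: vec_eq_iff)
qed

lemma weight_reindex: "weight (reindex x) = weight x"
proof -
  have "bij_betw index_of_vec {v. x $ index_of_vec v \<noteq> 0} {i. x $ i \<noteq> 0}"
    using bij_index_of_vec unfolding bij_betw_def
    by (auto simp: inj_on_def image_iff surj_def)
  then show ?thesis
    using bij_betw_same_card by (fastforce simp: weight_def reindex_def)
qed

lemma num_weight_reindex: "num_weight (reindex ` C) i = num_weight C i"
proof -
  have "{x \<in> reindex ` C. weight x = i} = reindex ` {x \<in> C. weight x = i}"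
    by (auto simp: weight_reindex)
  moreover have "card (reindex ` {x \<in> C. weight x = i}) = card {x \<in> C. weight x = i}"
    by (rule card_image) (rule inj_on_subset[OF inj_reindex], simp)
  ultimately show ?thesis
    unfolding num_weight_def by (simp only:)
qed

text \<open>A block of odd size has parity bit 1, which accounts for the element 0 of
  \<open>vecs B\<close>.\<close>

lemma reindex_extend_incidence_vector:
  assumes "odd (card B)"
  shows "reindex (extend_word (incidence_vector B)) = incidence_vector (vecs B)"
proof -
  have "(\<Sum>p\<in>UNIV. if p \<in> B then 1 else 0 :: bit) = 1"
    using assms by (simp add: sum.If_cases flip: bit_not_zero_iff)
  then show ?thesis
    by (simp add: vec_eq_iff reindex_def extend_word_def incidence_vector_def index_of_vec_def mem_vecs_iff)
qed

lemma card_pg_point_7: "CARD((bit, 7) pg_point) = 127"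
proof -
  have "vecs (UNIV :: (bit, 7) pg_point set) = UNIV"
    by (auto simp: mem_vecs_iff)
  then show ?thesis
    using card_vecs[of "UNIV :: (bit, 7) pg_point set"] by simp
qed

lemma hamming_dist_eq: "hamming_dist x y = weight (x + y)"
  by (simp add: hamming_dist_def weight_def)

text \<open>The distance of two words is the weight of their sum, so the minimum distance can be
  read off the weight distribution.\<close>

lemma linear_codeI:
  fixes C :: "(bit ^ 'i::finite) set"
  assumes "CARD('i) = n" and C: "vec.subspace C" "card C = 2 ^ k"
    and small: "\<And>i. 0 < i \<Longrightarrow> i < d \<Longrightarrow> num_weight C i = 0" and d: "num_weight C d \<noteq> 0" "0 < d"
  shows "linear_code n k d C"
proof -
  let ?M = "{hamming_dist x y | x y. x \<in> C \<and> y \<in> C \<and> x \<noteq> y}"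
  have "(2 :: nat) ^ vec.dim C = 2 ^ k"
    using card_subspace[OF C(1)] C(2) by simp
  then have "vec.dim C = k"
    by simp
  have "{x \<in> C. weight x = d} \<noteq> {}"
    using d unfolding num_weight_def by (metis card.empty)
  then obtain x where x: "x \<in> C" "weight x = d"
    by blast
  have "x \<noteq> 0"
    using x d(2) by (auto simp: weight_eq)
  moreover have "0 \<in> C" "d = hamming_dist x 0"
    using x C(1) by (simp_all add: hamming_dist_eq subspace_bit_iff)
  ultimately have "d \<in> ?M"
    using x(1) by blast
  moreover have "finite ?M"
    by (rule finite_subset[of _ "(\<lambda>(x, y). hamming_dist x y) ` UNIV"]) auto
  moreover have "d \<le> m" if m: "m \<in> ?M" for m
  proof -
    obtain x y where xy: "x \<in> C" "y \<in> C" "x \<noteq> y" "m = weight (x + y)"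
      using m unfolding hamming_dist_eq by blast
    have "x + y \<in> C"
      using C(1) xy by (simp add: subspace_bit_iff)
    then have "{x \<in> C. weight x = m} \<noteq> {}"
      using xy(4) by blast
    then have "num_weight C m \<noteq> 0"
      by (simp add: num_weight_def card_eq_0_iff)
    moreover have "supp (x + y) \<noteq> {}"
      using xy(3) by (metis incidence_vector_empty incidence_vector_supp vec_bit_add_eq_0_iff)
    then have "0 < m"
      by (simp add: xy(4) weight_eq card_gt_0_iff)
    ultimately show ?thesis
      using small[of m] by (meson not_less)
  qed
  ultimately have "Min ?M = d" "?M \<noteq> {}"
    using Min_eqI[of ?M d] by blast+
  then show ?thesis
    unfolding linear_code_def using assms(1) C(1) \<open>vec.dim C = k\<close> by blast
qed

lemma weights128_symmetric: "j \<le> 32 \<Longrightarrow> weights128 ! (32 - j) = weights128 ! j"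
proof -
  assume "j \<le> 32"
  have "rev weights128 = weights128" "length weights128 = 33"
    by (simp_all add: weights128_def)
  then show ?thesis
    using rev_nth[of j weights128] \<open>j \<le> 32\<close> by simp
qed

theorem theorem1:
  fixes H :: "(bit, 7) pg_point set"
    and \<pi> :: "(bit, 7) pg_point set \<Rightarrow> (bit, 7) pg_point set"
    and D :: "(bit, 7) pg_point set set"
    and C :: "(bit ^ (bit, 7) pg_point) set"
    and Cx :: "(bit ^ (bit, 7) pg_point option) set"
    and A :: "nat \<Rightarrow> nat"
  assumes "pg_subspace 5 H"
    and "polarity 5 H \<pi>"
    and "D = polarity_design 3 H \<pi>"
    and "C = design_code D"
    and "Cx = extended_code C"
    and "A = num_weight Cx"
  shows "block_design 2 127 15 155 D
    \<and> linear_code 128 64 16 Cx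
    \<and> (\<forall>i. A i = num_weight (reed_muller 3 :: (bit ^ (bit ^ 7)) set) i)
    \<and> (\<forall>i. A i \<noteq> 0 \<longrightarrow> i \<in> {0, 16, 112, 128} \<union> {j. 24 \<le> j \<and> j \<le> 104 \<and> 4 dvd j})
    \<and> (\<forall>i \<le> 128. A (128 - i) = A i)
    \<and> A 0 = 1
    \<and> A 16 = 94488
    \<and> A 20 = 0
    \<and> A 24 = 74078592
    \<and> A 28 = 3128434688
    \<and> A 32 = 312335197020
    \<and> A 36 = 18125860315136
    \<and> A 40 = 552366841342848
    \<and> A 44 = 9491208609103872
    \<and> A 48 = 94117043084875944
    \<and> A 52 = 549823502398291968
    \<and> A 56 = 1920604779257215744
    \<and> A 60 = 4051966906789380096
    \<and> A 64 = 5193595576952890822"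
proof -
  have dim: "CARD(7) = 7"
    by simp
  obtain a where a: "a \<noteq> 0" "vecs H = {x. bdot a x = 0}"
    by (rule hyperplane_normal[OF dim assms(1,2)])
  let ?U = "{x. bdot a x = 0}"
  let ?blocks = "subspaces_between {0} ?U 4 \<union>
    {coset z Y \<union> vec_polarity \<pi> Y | z Y. z \<notin> ?U \<and> Y \<in> subspaces_between {0} ?U 3}"
  let ?K = "vec.span (incidence_vector ` ?blocks)"
  interpret P: polarity_code a ?U "subspaces_between {0} ?U 3" "subspaces_between {0} ?U 4"
    "vec_polarity \<pi>" ?blocks ?K
  proof unfold_locales
    fix Y Y'
    assume Y: "Y \<in> subspaces_between {0} ?U 3"
    show "vec_polarity \<pi> Y \<in> subspaces_between {0} ?U 3" "vec_polarity \<pi> (vec_polarity \<pi> Y) = Y"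
      using vec_polarity_plane[OF dim assms(1,2), of Y] Y unfolding a(2) by blast+
    assume Y': "Y' \<in> subspaces_between {0} ?U 3"
    note le = card_vec_polarity_Int_le[OF dim assms(1,2), unfolded a(2)]
    note pol = vec_polarity_plane[OF dim assms(1,2), unfolded a(2)]
    \<comment> \<open>The inequality \<open>le\<close> applied to the polar planes gives the reverse
      one, since the polarity is an involution.\<close>
    show "card (vec_polarity \<pi> Y \<inter> vec_polarity \<pi> Y') = card (Y \<inter> Y')"
      using le[OF Y Y'] le[OF pol(1)[OF Y] pol(1)[OF Y']] pol(2)[OF Y] pol(2)[OF Y'] by simp
  qed (use a in simp_all)
  have blocks: "vecs ` D = ?blocks"
    using vecs_polarity_design[OF dim assms(1,2)] unfolding assms(3) a(2) .
  have card_D: "card B = 15" if "B \<in> D" for B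
  proof -
    have "vecs B \<in> ?blocks"
      unfolding blocks[symmetric] using that by blast
    then show ?thesis
      using P.card_block[of "vecs B"] card_vecs[of B] by simp
  qed
  have design: "block_design 2 127 15 155 D"
    unfolding block_design_def
  proof (intro conjI ballI allI impI)
    fix T :: "(bit, 7) pg_point set"
    assume "card T = 2"
    then obtain p q where T: "T = {p, q}" "p \<noteq> q"
      by (auto simp: card_2_iff)
    have "{B \<in> D. T \<subseteq> B} = {B \<in> D. vec_of_point p \<in> vecs B \<and> vec_of_point q \<in> vecs B}"
      by (simp add: T(1))
    moreover have "vecs ` {B \<in> D. Q (vecs B)} = {B \<in> vecs ` D. Q B}" for Q
      by blast
    ultimately have "vecs ` {B \<in> D. T \<subseteq> B} =
        {B \<in> ?blocks. vec_of_point p \<in> B \<and> vec_of_point q \<in> B}"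
      unfolding blocks by (simp only:)
    moreover have "card (vecs ` {B \<in> D. T \<subseteq> B}) = card {B \<in> D. T \<subseteq> B}"
      by (rule card_image, rule inj_on_inverseI[of _ points]) simp
    moreover have "vec_of_point p \<noteq> vec_of_point q"
      using T(2) by simp
    from P.card_blocks_through_2[OF vec_of_point(1) vec_of_point(1) this]
    have "card {B \<in> ?blocks. vec_of_point p \<in> B \<and> vec_of_point q \<in> B} = 155" .
    ultimately show "card {B \<in> D. T \<subseteq> B} = 155"
      by (simp only:)
  qed (simp_all add: card_pg_point_7 card_D)
  have Cx: "Cx = vec.span (extend_word ` incidence_vector ` D)"
    unfolding assms(4,5) extended_code_def design_code_def by (rule span_image_bit[OF extend_word_add])
  have "reindex ` extend_word ` incidence_vector ` D = incidence_vector ` vecs ` D"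
    unfolding image_image using card_D by (intro image_cong refl reindex_extend_incidence_vector) simp
  then have K: "reindex ` Cx = ?K"
    unfolding Cx span_image_bit[OF reindex_add] blocks by simp
  have A_K: "A i = num_weight ?K i" for i
    unfolding assms(6) K[symmetric] num_weight_reindex ..
  have dist: "A i = (if 4 dvd i \<and> i \<le> 128 then weights128 ! (i div 4) else 0)" for i
    unfolding A_K using P.num_weight_K_small P.num_weight_K_16
    by (intro self_dual_weight_distribution P.dual_K P.K_doubly_even) simp_all
  have RM: "num_weight (reed_muller 3 :: (bit ^ (bit ^ 7)) set) i =
      (if 4 dvd i \<and> i \<le> 128 then weights128 ! (i div 4) else 0)" for i
    using reed_muller_3_7[OF dim] by (intro self_dual_weight_distribution) simp_all
  have code: "linear_code 128 64 16 Cx"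
  proof (rule linear_codeI)
    show "CARD((bit, 7) pg_point option) = 128"
      by (simp add: card_pg_point_7)
    show "vec.subspace Cx"
      by (simp add: Cx)
    have "card Cx = card (reindex ` Cx)"
      by (rule card_image[symmetric]) (rule inj_on_subset[OF inj_reindex], simp)
    then show "card Cx = 2 ^ 64"
      unfolding K using card_self_dual[OF P.dual_K, of 64] by simp
    show "num_weight Cx i = 0" if "0 < i" "i < 16" for i
      using P.num_weight_K_small[of i] that A_K[of i] assms(6) by simp
    show "num_weight Cx 16 \<noteq> 0"
      using P.num_weight_K_16 A_K[of 16] assms(6) by simp
  qed simp
  have "i \<in> {0, 16, 112, 128} \<union> {j. 24 \<le> j \<and> j \<le> 104 \<and> 4 dvd j}" if nz: "A i \<noteq> 0" for i
  proof (rule ccontr)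
    assume *: "i \<notin> {0, 16, 112, 128} \<union> {j. 24 \<le> j \<and> j \<le> 104 \<and> 4 dvd j}"
    obtain j where j: "i = 4 * j" "j \<le> 32"
      using nz unfolding dist by (auto split: if_splits elim!: dvdE)
    then have "j \<noteq> 0" "j \<noteq> 4" "j \<noteq> 28" "j \<noteq> 32" "j < 6 \<or> 26 < j"
      using * by auto
    \<comment> \<open>These are the positions of the zeros in \<open>weights128\<close>.\<close>
    then have "j \<in> {1, 2, 3, 5, 27, 29, 30, 31}"
      using j(2) unfolding insert_iff empty_iff by presburger
    then have "A i = 0"
      unfolding dist j by (auto simp: weights128_def)
    then show False
      using nz by simp
  qed
  moreover have "A (128 - i) = A i" if "i \<le> 128" for i
  proof (cases "4 dvd i")
    case True
    then obtain j where "i = 4 * j"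
      by blast
    then show ?thesis
      using that weights128_symmetric[of j] by (simp add: dist flip: diff_mult_distrib2[of 4 32, simplified])
  next
    case False
    then have "\<not> 4 dvd 128 - i"
      using that by presburger
    then show ?thesis
      using False by (simp add: dist)
  qed
  ultimately show ?thesis
    using design code RM dist by (simp add: weights128_def)
qed

end
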